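(* Let $p$ be a prime, $P$ a finite $p$-group, and ${\cal C}$ a subcategory of ${\cal C}_u(P)$ such that $P$ is an object of ${\cal C}$ and, for every object $Q$ of ${\cal C}$, the inclusion $Q\hookrightarrow P$ is a morphism of ${\cal C}$. Then there exists a discrete group $\Gamma$ containing $P$ as a subgroup such that: (a) the image of the restriction map ${\rm Res}^\Gamma_P\colon H^*(\Gamma)\to H^*(P)$ equals $I(P,{\cal C})$; (b) the product of any two elements of ${\rm Ker}({\rm Res}^\Gamma_P)$ is zero, i.e. $({\rm Ker}\,{\rm Res}^\Gamma_P)^2=0$; (c) ${\rm Res}^\Gamma_P$ induces a ring isomorphism $H^*(\Gamma)/\sqrt{0}\to I(P,{\cal C})/\sqrt{0}$, where $\sqrt 0$ denotes the nilradical; (d) $\Gamma$ has a free normal subgroup of index dividing $|P|!$.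
   Context: $H^*(\cdot)$ denotes group cohomology with coefficients in the field ${\bf F}_p$ (trivial action), viewed as a contravariant functor from groups and injective homomorphisms to graded ${\bf F}_p$-algebras. For a finite group $P$, ${\cal C}_u={\cal C}_u(P)$ is the category whose objects are the subgroups of $P$ and whose morphisms are all injective group homomorphisms between them. For ${\cal C}$ as in the statement, $I(P,{\cal C})=\lim_{Q\in{\cal C}}H^*(Q)$; equivalently, $I(P,{\cal C})$ is the subring of $H^*(P)$ consisting of those $x$ such that for every morphism $\phi\colon Q\to Q'$ of ${\cal C}$, $\phi^*({\rm Res}^P_{Q'}x)={\rm Res}^P_Q x$. *)

theory Defs
  imports "HOL-Algebra.Algebra" "HOL-Number_Theory.Cong"
begin

text \<open>Group cohomology H^*(G; F_p) with trivial coefficients, via inhomogeneous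
cochains.  A cochain of degree n is a function on lists of group elements;
only its values on lists of length n with entries in the carrier matter,
and values are integers read modulo p.\<close>

definition valid_args :: "('g, 'b) monoid_scheme \<Rightarrow> nat \<Rightarrow> 'g list \<Rightarrow> bool" where
  "valid_args G n xs \<longleftrightarrow> length xs = n \<and> set xs \<subseteq> carrier G"

definition coboundary :: "('g, 'b) monoid_scheme \<Rightarrow> nat \<Rightarrow> ('g list \<Rightarrow> int) \<Rightarrow> 'g list \<Rightarrow> int" where
  "coboundary G n f xs =
     f (tl xs)
     + (\<Sum>i\<in>{1..n}. (-1) ^ i * f (take (i - 1) xs @ [xs ! (i - 1) \<otimes>\<^bsub>G\<^esub> xs ! i] @ drop (i + 1) xs))
     + (-1) ^ (n + 1) * f (butlast xs)"

definition cocycle :: "('g, 'b) monoid_scheme \<Rightarrow> int \<Rightarrow> nat \<Rightarrow> ('g list \<Rightarrow> int) \<Rightarrow> bool" where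
  "cocycle G p n f \<longleftrightarrow> (\<forall>xs. valid_args G (Suc n) xs \<longrightarrow> [coboundary G n f xs = 0] (mod p))"

definition cohomologous :: "('g, 'b) monoid_scheme \<Rightarrow> int \<Rightarrow> nat \<Rightarrow> ('g list \<Rightarrow> int) \<Rightarrow> ('g list \<Rightarrow> int) \<Rightarrow> bool" where
  "cohomologous G p n f g \<longleftrightarrow>
     (case n of
        0 \<Rightarrow> [f [] = g []] (mod p)
      | Suc m \<Rightarrow> (\<exists>h. \<forall>xs. valid_args G n xs \<longrightarrow> [f xs = g xs + coboundary G m h xs] (mod p)))"

definition hclass :: "('g, 'b) monoid_scheme \<Rightarrow> int \<Rightarrow> nat \<Rightarrow> ('g list \<Rightarrow> int) \<Rightarrow> ('g list \<Rightarrow> int) set" where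
  "hclass G p n f = {g. cocycle G p n g \<and> cohomologous G p n f g}"

definition Hn :: "('g, 'b) monoid_scheme \<Rightarrow> int \<Rightarrow> nat \<Rightarrow> ('g list \<Rightarrow> int) set set" where
  "Hn G p n = hclass G p n ` {f. cocycle G p n f}"

definition hzero :: "('g, 'b) monoid_scheme \<Rightarrow> int \<Rightarrow> nat \<Rightarrow> ('g list \<Rightarrow> int) set \<Rightarrow> bool" where
  "hzero G p n c \<longleftrightarrow> c = hclass G p n (\<lambda>_. 0)"

type_synonym 'g coh = "nat \<Rightarrow> ('g list \<Rightarrow> int) set"

definition Htot :: "('g, 'b) monoid_scheme \<Rightarrow> int \<Rightarrow> 'g coh set" where
  "Htot G p = {c. (\<forall>n. c n \<in> Hn G p n) \<and> finite {n. \<not> hzero G p n (c n)}}"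

definition rep :: "('g list \<Rightarrow> int) set \<Rightarrow> 'g list \<Rightarrow> int" where
  "rep C = (SOME f. f \<in> C)"

definition coh_zero :: "('g, 'b) monoid_scheme \<Rightarrow> int \<Rightarrow> 'g coh" where
  "coh_zero G p = (\<lambda>n. hclass G p n (\<lambda>_. 0))"

definition coh_one :: "('g, 'b) monoid_scheme \<Rightarrow> int \<Rightarrow> 'g coh" where
  "coh_one G p = (\<lambda>n. hclass G p n (\<lambda>_. if n = 0 then 1 else 0))"

definition coh_mult :: "('g, 'b) monoid_scheme \<Rightarrow> int \<Rightarrow> 'g coh \<Rightarrow> 'g coh \<Rightarrow> 'g coh" where
  "coh_mult G p c d = (\<lambda>n. hclass G p n
      (\<lambda>xs. \<Sum>i\<le>n. rep (c i) (take i xs) * rep (d (n - i)) (drop i xs)))"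

primrec coh_pow :: "('g, 'b) monoid_scheme \<Rightarrow> int \<Rightarrow> 'g coh \<Rightarrow> nat \<Rightarrow> 'g coh" where
  "coh_pow G p c 0 = coh_one G p"
| "coh_pow G p c (Suc k) = coh_mult G p (coh_pow G p c k) c"

definition coh_nilpotent :: "('g, 'b) monoid_scheme \<Rightarrow> int \<Rightarrow> 'g coh \<Rightarrow> bool" where
  "coh_nilpotent G p c \<longleftrightarrow> (\<exists>k>0. coh_pow G p c k = coh_zero G p)"

definition pullback :: "('h, 'c) monoid_scheme \<Rightarrow> int \<Rightarrow> ('h \<Rightarrow> 'g) \<Rightarrow> 'g coh \<Rightarrow> 'h coh" where
  "pullback H p \<phi> c = (\<lambda>n. hclass H p n (\<lambda>xs. rep (c n) (map \<phi> xs)))"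

definition restr :: "('g, 'b) monoid_scheme \<Rightarrow> int \<Rightarrow> 'g set \<Rightarrow> 'g coh \<Rightarrow> 'g coh" where
  "restr P p Q c = pullback (P\<lparr>carrier := Q\<rparr>) p id c"

definition subcat_Cu :: "('a, 'b) monoid_scheme \<Rightarrow> 'a set set \<Rightarrow> ('a set \<Rightarrow> 'a set \<Rightarrow> ('a \<Rightarrow> 'a) set) \<Rightarrow> bool" where
  "subcat_Cu P Obj Mor \<longleftrightarrow>
     (\<forall>Q\<in>Obj. subgroup Q P)
   \<and> (\<forall>Q Q' \<phi>. \<phi> \<in> Mor Q Q' \<longrightarrow> Q \<in> Obj \<and> Q' \<in> Obj
        \<and> \<phi> \<in> hom (P\<lparr>carrier := Q\<rparr>) (P\<lparr>carrier := Q'\<rparr>) \<and> inj_on \<phi> Q \<and> \<phi> \<in> extensional Q)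
   \<and> (\<forall>Q\<in>Obj. (\<lambda>x\<in>Q. x) \<in> Mor Q Q)
   \<and> (\<forall>Q Q' Q'' \<phi> \<psi>. \<phi> \<in> Mor Q Q' \<longrightarrow> \<psi> \<in> Mor Q' Q'' \<longrightarrow> (\<lambda>x\<in>Q. \<psi> (\<phi> x)) \<in> Mor Q Q'')"

definition stable_elements :: "('a, 'b) monoid_scheme \<Rightarrow> int \<Rightarrow> 'a set set \<Rightarrow> ('a set \<Rightarrow> 'a set \<Rightarrow> ('a \<Rightarrow> 'a) set) \<Rightarrow> 'a coh set" where
  "stable_elements P p Obj Mor =
     {x \<in> Htot P p. \<forall>Q Q' \<phi>. \<phi> \<in> Mor Q Q' \<longrightarrow>
         pullback (P\<lparr>carrier := Q\<rparr>) p \<phi> (restr P p Q' x) = restr P p Q x}"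

definition word_eval :: "('g, 'b) monoid_scheme \<Rightarrow> (bool \<times> 'g) list \<Rightarrow> 'g" where
  "word_eval G w = foldr (\<lambda>(b, x) acc. (if b then x else inv\<^bsub>G\<^esub> x) \<otimes>\<^bsub>G\<^esub> acc) w \<one>\<^bsub>G\<^esub>"

definition reduced_word :: "(bool \<times> 'g) list \<Rightarrow> bool" where
  "reduced_word w \<longleftrightarrow> (\<forall>i. Suc i < length w \<longrightarrow>
      \<not> (snd (w ! i) = snd (w ! Suc i) \<and> fst (w ! i) \<noteq> fst (w ! Suc i)))"

definition free_subgroup :: "('g, 'b) monoid_scheme \<Rightarrow> 'g set \<Rightarrow> bool" where
  "free_subgroup G N \<longleftrightarrow> subgroup N G \<and> (\<exists>Bs. Bs \<subseteq> N \<and> generate G Bs = N \<and>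
     (\<forall>w. w \<noteq> [] \<and> set (map snd w) \<subseteq> Bs \<and> reduced_word w \<longrightarrow> word_eval G w \<noteq> \<one>\<^bsub>G\<^esub>))"

end

theory Submission
  imports Defs
begin

text \<open>
  \<Gamma> is a multiple HNN extension of P: it is generated by P and letters t with relations
  q t = t \<phi>(q), one letter for each pair of a morphism \<phi> : Q \<rightarrow> P of the category (or the trivial
  morphism of the trivial subgroup) and a permutation \<tau> of P with \<tau>(\<phi>(q) x) = q \<tau>(x). Such a \<tau> exists,
  because Q acts freely on P in both ways; hence P and the \<tau> define a map of \<Gamma> onto Sym(P).

  The Bass-Serre tree of \<Gamma> enters only through two consequences of the presentation: P and
  the letters generate \<Gamma>, and every family of right Q-invariant functions k on \<Gamma> is the family of
  differences l(x t) - l(x) of a single right P-invariant function l. They imply that a P-invariant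
  cochain on \<Gamma> whose translates by the letters differ by coboundaries becomes \<Gamma>-invariant modulo a
  coboundary. Applied to a cocycle of P pulled back along an equivariant retraction \<Gamma> \<rightarrow> P,
  this extends stable classes to \<Gamma>. Applied to l \<union> g, where f and g restrict to zero on P and l is a
  P-invariant primitive of f, it shows that f \<union> g = 0. The statement on nilradicals follows from these
  two.

  The kernel K of \<Gamma> \<rightarrow> Sym(P) is the fundamental group of a graph with vertex set Sym(P)/P. The letters
  attached to the trivial subgroup provide a star-shaped spanning tree, the remaining edges
  provide generators of K, and recording the edges crossed by a word is a homomorphism from K to the
  free group on these edges.
\<close>

section \<open>Homogeneous cochains\<close>

text \<open>In the equivariant spectral sequence of the tree only two columns can be nonzero. After
  the first differential the column of the vertices consists of the stable classes of P; the kernel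
  of restriction lies in the column of the edges, and a product of two of its elements would lie in
  a third column. The proof replaces this by explicit cochains: \<open>descent\<close> corrects a
  cochain once, and both \<open>extend_cocycle\<close> and \<open>cup_kernel\<close> arrange that
  one correction is enough.

  Normal forms for words in the HNN extension are avoided. P embeds in \<Gamma> because its
  composite with the map to Sym(P) is the regular representation, and functions on \<Gamma> with
  prescribed differences arise as outputs of an automaton that reads words.

  Functions lifted along the tree take integer values and satisfy equations, whereas cocycle
  conditions hold only modulo p. Hence invariance under P and the groups Q enters
  \<open>descent\<close> exactly, the differentials are compared modulo p, and the resulting
  invariance under \<Gamma> is modulo p.\<close>

text \<open>A single function on lists represents a cochain of every degree: on lists of length n + 1 in
  the homogeneous convention, on lists of length n in the inhomogeneous one. Homogeneous cochains
  are normalised to vanish on the empty list, since the recursion below includes the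
  augmentation.\<close>

fun hD :: "('x list \<Rightarrow> int) \<Rightarrow> 'x list \<Rightarrow> int" where
  "hD c [] = 0"
| "hD c (x # xs) = c xs - hD (\<lambda>l. c (x # l)) xs"

text \<open>The chain homotopy between the maps induced by \<open>\<sigma>\<close> and \<open>\<rho>\<close>.\<close>

fun prism :: "('x \<Rightarrow> 'y) \<Rightarrow> ('x \<Rightarrow> 'y) \<Rightarrow> ('y list \<Rightarrow> int) \<Rightarrow> 'x list \<Rightarrow> int" where
  "prism \<sigma> \<rho> c [] = 0"
| "prism \<sigma> \<rho> c (x # xs) = c (\<sigma> x # map \<rho> (x # xs)) - prism \<sigma> \<rho> (\<lambda>l. c (\<sigma> x # l)) xs"

text \<open>The Alexander-Whitney product in all bidegrees at once: the two factors share the vertex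
  at which the list is cut, so each of them sees a nonempty list. The recursion moves the vertices
  before the cut into \<open>c\<close>.\<close>

fun hcup :: "('x list \<Rightarrow> int) \<Rightarrow> ('x list \<Rightarrow> int) \<Rightarrow> 'x list \<Rightarrow> int" where
  "hcup c d [] = 0"
| "hcup c d (x # xs) = c [x] * d (x # xs) + hcup (\<lambda>l. c (x # l)) d xs"

text \<open>A list of length n + 1 has degree n, so the exponent has the parity of the
  degree.\<close>

definition signed :: "('x list \<Rightarrow> int) \<Rightarrow> 'x list \<Rightarrow> int" where
  "signed c xs = (-1) ^ Suc (length xs) * c xs"

lemma hD_add: "hD (\<lambda>l. c l + d l) xs = hD c xs + hD d xs"
  by (induction xs arbitrary: c d) auto

lemma hD_minus: "hD (\<lambda>l. - c l) xs = - hD c xs"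
  by (induction xs arbitrary: c) auto

lemma hD_diff: "hD (\<lambda>l. c l - d l) xs = hD c xs - hD d xs"
  by (induction xs arbitrary: c d) auto

lemma hD_mult: "hD (\<lambda>l. k * c l) xs = k * hD c xs"
  by (induction xs arbitrary: c) (auto simp: algebra_simps)

lemma hD_cong:
  assumes "\<And>ys. set ys \<subseteq> A \<Longrightarrow> [c ys = d ys] (mod m)" and "set xs \<subseteq> A"
  shows "[hD c xs = hD d xs] (mod m)"
  using assms by (induction xs arbitrary: c d) (auto intro!: cong_diff)

lemma hD_map: "hD c (map \<phi> xs) = hD (\<lambda>l. c (map \<phi> l)) xs"
  by (induction xs arbitrary: c) auto

lemma hD_hD: "hD (hD c) xs = 0"
  by (induction xs arbitrary: c) (simp_all add: hD_diff)

lemma hD_prism: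
  "hD (prism \<sigma> \<rho> c) xs + prism \<sigma> \<rho> (hD c) xs = c (map \<rho> xs) - c (map \<sigma> xs)"
proof (induction xs arbitrary: c)
  case (Cons x xs)
  have diff: "prism \<sigma> \<rho> (\<lambda>l. c l - d l) xs = prism \<sigma> \<rho> c xs - prism \<sigma> \<rho> d xs" for c d
    by (induction xs arbitrary: c d) auto
  show ?case
    using Cons[of "\<lambda>l. c (\<sigma> x # l)"] by (simp add: diff hD_diff hD_map)
qed auto

lemma prism_cong:
  assumes "\<And>ys. set ys \<subseteq> B \<Longrightarrow> [c ys = d ys] (mod m)" and "set xs \<subseteq> A"
    and "\<sigma> \<in> A \<rightarrow> B" and "\<rho> \<in> A \<rightarrow> B"
  shows "[prism \<sigma> \<rho> c xs = prism \<sigma> \<rho> d xs] (mod m)"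
  using assms(1,2)
proof (induction xs arbitrary: c d)
  case (Cons x xs)
  have *: "\<sigma> x \<in> B" "\<rho> x \<in> B" "\<rho> ` set xs \<subseteq> B" using Cons.prems assms(3,4) by auto
  show ?case
    unfolding prism.simps
    by (rule cong_diff; (rule Cons)) (use * Cons.prems in auto)
qed auto

lemma prism_zero [simp]: "prism \<sigma> \<rho> (\<lambda>l. 0) xs = 0"
  by (induction xs) auto

lemma prism_map: "prism \<sigma> \<rho> c (map \<phi> xs) = prism (\<sigma> \<circ> \<phi>) (\<rho> \<circ> \<phi>) c xs"
  by (induction xs arbitrary: c) auto

lemma prism_pull: "prism \<sigma> \<rho> (\<lambda>l. c (map \<phi> l)) xs = prism (\<phi> \<circ> \<sigma>) (\<phi> \<circ> \<rho>) c xs"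
  by (induction xs arbitrary: c) auto

lemma prism_eq:
  assumes "\<And>x. x \<in> set xs \<Longrightarrow> \<sigma> x = \<sigma>' x" "\<And>x. x \<in> set xs \<Longrightarrow> \<rho> x = \<rho>' x"
  shows "prism \<sigma> \<rho> c xs = prism \<sigma>' \<rho>' c xs"
  using assms
proof (induction xs arbitrary: c)
  case (Cons x xs)
  have m: "map \<rho> (x # xs) = map \<rho>' (x # xs)" by (rule map_cong[OF refl Cons.prems(2)])
  have "prism \<sigma> \<rho> e xs = prism \<sigma>' \<rho>' e xs" for e by (rule Cons) (use Cons.prems in auto)
  then show ?case using Cons.prems(1)[of x] unfolding prism.simps m by simp
qed auto

lemma hcup_add1: "hcup (\<lambda>l. c l + c' l) d xs = hcup c d xs + hcup c' d xs"
  by (induction xs arbitrary: c c') (auto simp: algebra_simps)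

lemma hcup_diff1: "hcup (\<lambda>l. c l - c' l) d xs = hcup c d xs - hcup c' d xs"
  by (induction xs arbitrary: c c') (auto simp: algebra_simps)

lemma hcup_minus1: "hcup (\<lambda>l. - c l) d xs = - hcup c d xs"
  by (induction xs arbitrary: c) (auto simp: algebra_simps)

lemma hcup_add2: "hcup c (\<lambda>l. d l + d' l) xs = hcup c d xs + hcup c d' xs"
  by (induction xs arbitrary: c) (auto simp: algebra_simps)

lemma hcup_zero [simp]: "hcup (\<lambda>l. 0) d xs = 0" "hcup c (\<lambda>l. 0) xs = 0"
  by (induction xs arbitrary: c) auto

lemma hcup_map: "hcup c d (map \<phi> xs) = hcup (\<lambda>l. c (map \<phi> l)) (\<lambda>l. d (map \<phi> l)) xs"
  by (induction xs arbitrary: c) auto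

lemma hcup_cong:
  assumes "\<And>ys. set ys \<subseteq> A \<Longrightarrow> [c ys = c' ys] (mod m)" and "\<And>ys. set ys \<subseteq> A \<Longrightarrow> [d ys = d' ys] (mod m)"
    and "set xs \<subseteq> A"
  shows "[hcup c d xs = hcup c' d' xs] (mod m)"
  using assms by (induction xs arbitrary: c c') (auto intro!: cong_add cong_mult)

lemma signed_signed [simp]: "signed (signed c) = c"
  by (auto simp: signed_def fun_eq_iff simp flip: power_add mult.assoc)

lemma signed_Cons: "signed c (x # l) = - signed (\<lambda>l. c (x # l)) l"
  by (simp add: signed_def)

lemma hD_signed: "hD (signed c) xs = - signed (hD c) xs"
proof (induction xs arbitrary: c)
  case (Cons x xs)
  have "hD (signed c) (x # xs) = signed c xs - hD (\<lambda>l. - signed (\<lambda>l. c (x # l)) l) xs"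
    by (simp add: signed_Cons)
  also have "\<dots> = - signed (hD c) (x # xs)"
    unfolding hD_minus Cons by (simp add: signed_def algebra_simps)
  finally show ?case .
qed (auto simp: signed_def)

text \<open>The Leibniz rule. The last term is due to the augmentation: on one-element lists
  \<open>hD c\<close> is the constant \<open>c []\<close>, which \<open>hcup (hD c) d\<close> counts
  although no face of the product corresponds to it. It vanishes for normalised
  \<open>c\<close>.\<close>

lemma hD_hcup:
  assumes "d [] = 0"
  shows "hD (hcup c d) xs = hcup (hD c) d xs + hcup (signed c) (hD d) xs - c [] * d xs"
proof (induction xs arbitrary: c)
  case (Cons x xs)
  have "hcup (\<lambda>l. signed c (x # l)) (hD d) xs = - hcup (signed (\<lambda>l. c (x # l))) (hD d) xs"
    unfolding signed_Cons hcup_minus1 ..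
  moreover have "hcup (\<lambda>l. hD c (x # l)) d xs = hcup c d xs - hcup (hD (\<lambda>l. c (x # l))) d xs"
    by (simp add: hcup_diff1)
  moreover have "signed c [x] = c [x]" by (simp add: signed_def)
  moreover have "hD (\<lambda>l. hcup c d (x # l)) xs
    = c [x] * hD (\<lambda>l. d (x # l)) xs + hD (hcup (\<lambda>l. c (x # l)) d) xs"
    by (simp add: hD_add hD_mult)
  ultimately show ?case using Cons[of "\<lambda>l. c (x # l)"] by (simp add: algebra_simps)
qed (auto simp: assms)

lemma hD_sum: "hD c xs = (\<Sum>i<length xs. (-1) ^ i * c (take i xs @ drop (Suc i) xs))"
proof (induction xs arbitrary: c)
  case (Cons x xs)
  have "hD c (x # xs) = c xs - (\<Sum>i<length xs. (-1) ^ i * c (x # take i xs @ drop (Suc i) xs))"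
    by (simp add: Cons)
  also have "\<dots> = (\<Sum>i<length (x # xs). (-1) ^ i * c (take i (x # xs) @ drop (Suc i) (x # xs)))"
    unfolding length_Cons sum.lessThan_Suc_shift by (simp add: sum_negf)
  finally show ?case .
qed auto

lemma hcup_sum: "hcup c d xs = (\<Sum>i<length xs. c (take (Suc i) xs) * d (drop i xs))"
proof (induction xs arbitrary: c)
  case (Cons x xs)
  show ?case
    unfolding length_Cons sum.lessThan_Suc_shift by (simp add: Cons)
qed auto

section \<open>Homogeneous and inhomogeneous cochains\<close>

fun quots :: "('g, 'b) monoid_scheme \<Rightarrow> 'g list \<Rightarrow> 'g list" where
  "quots G (x # y # zs) = (inv\<^bsub>G\<^esub> x \<otimes>\<^bsub>G\<^esub> y) # quots G (y # zs)"
| "quots G [x] = []"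
| "quots G [] = []"

fun pprods :: "('g, 'b) monoid_scheme \<Rightarrow> 'g \<Rightarrow> 'g list \<Rightarrow> 'g list" where
  "pprods G g [] = [g]"
| "pprods G g (x # xs) = g # pprods G (g \<otimes>\<^bsub>G\<^esub> x) xs"

definition homog :: "('g, 'b) monoid_scheme \<Rightarrow> ('g list \<Rightarrow> int) \<Rightarrow> 'g list \<Rightarrow> int" where
  "homog G f xs = (if xs = [] then 0 else f (quots G xs))"

definition dehomog :: "('g, 'b) monoid_scheme \<Rightarrow> ('g list \<Rightarrow> int) \<Rightarrow> 'g list \<Rightarrow> int" where
  "dehomog G F xs = F (pprods G \<one>\<^bsub>G\<^esub> xs)"

text \<open>The degree is read off from the length of the argument, so one function carries the
  coboundaries of all degrees. The value at the empty list is 0 because there are no cochains below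
  degree 0.\<close>

definition tcob :: "('g, 'b) monoid_scheme \<Rightarrow> ('g list \<Rightarrow> int) \<Rightarrow> 'g list \<Rightarrow> int" where
  "tcob G f xs = (if xs = [] then 0 else coboundary G (length xs - 1) f xs)"

text \<open>With m = 0 this is invariance in the integers, with m = p it is invariance of the
  reduced cochain; both occur.\<close>

definition linvariant :: "int \<Rightarrow> ('g, 'b) monoid_scheme \<Rightarrow> ('g list \<Rightarrow> int) \<Rightarrow> bool" where
  "linvariant m G F \<longleftrightarrow> (\<forall>g\<in>carrier G. \<forall>xs. set xs \<subseteq> carrier G \<longrightarrow> [F (map (\<lambda>x. g \<otimes>\<^bsub>G\<^esub> x) xs) = F xs] (mod m))"

lemma length_pprods [simp]: "length (pprods G g xs) = Suc (length xs)"
  by (induction xs arbitrary: g) auto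

lemma pprods_not_Nil [simp]: "pprods G g xs \<noteq> []"
  by (cases xs) auto

lemma length_quots [simp]: "length (quots G xs) = length xs - 1"
  by (induction G xs rule: quots.induct) auto

lemma homog_Nil [simp]: "homog G f [] = 0"
  by (simp add: homog_def)

context group
begin

lemma pprods_closed: "g \<in> carrier G \<Longrightarrow> set xs \<subseteq> carrier G \<Longrightarrow> set (pprods G g xs) \<subseteq> carrier G"
  by (induction xs arbitrary: g) auto

lemma quots_closed: "set xs \<subseteq> carrier G \<Longrightarrow> set (quots G xs) \<subseteq> carrier G"
  by (induction xs rule: induct_list012) auto

lemma pprods_mult:
  "g \<in> carrier G \<Longrightarrow> h \<in> carrier G \<Longrightarrow> set xs \<subseteq> carrier G \<Longrightarrow>
    pprods G (g \<otimes> h) xs = map (\<lambda>x. g \<otimes> x) (pprods G h xs)"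
  by (induction xs arbitrary: h) (auto simp: m_assoc)

lemma quots_pprods: "g \<in> carrier G \<Longrightarrow> set xs \<subseteq> carrier G \<Longrightarrow> quots G (pprods G g xs) = xs"
proof (induction xs arbitrary: g)
  case (Cons x xs)
  obtain r where r: "pprods G (g \<otimes> x) xs = (g \<otimes> x) # r" by (cases xs) auto
  have "quots G ((g \<otimes> x) # r) = xs" unfolding r[symmetric] by (rule Cons.IH) (use Cons.prems in auto)
  then show ?case using Cons.prems by (simp add: r inv_solve_left flip: m_assoc)
qed auto

lemma quots_map: "g \<in> carrier G \<Longrightarrow> set xs \<subseteq> carrier G \<Longrightarrow> quots G (map (\<lambda>x. g \<otimes> x) xs) = quots G xs"
proof (induction xs rule: induct_list012)
  case (3 x y zs)
  then have c: "x \<in> carrier G" "y \<in> carrier G" "g \<in> carrier G" by auto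
  have "inv (g \<otimes> x) \<otimes> (g \<otimes> y) = inv x \<otimes> (inv g \<otimes> g) \<otimes> y"
    using c by (simp only: inv_mult_group m_assoc inv_closed m_closed)
  then show ?case using 3 c by simp
qed auto

lemma pprods_quots: "set xs \<subseteq> carrier G \<Longrightarrow> g \<in> carrier G \<Longrightarrow> x \<in> carrier G \<Longrightarrow>
    pprods G g (quots G (x # xs)) = map (\<lambda>y. g \<otimes> inv x \<otimes> y) (x # xs)"
proof (induction xs arbitrary: x g)
  case (Cons y xs)
  have "pprods G (g \<otimes> (inv x \<otimes> y)) (quots G (y # xs)) = map (\<lambda>z. g \<otimes> (inv x \<otimes> y) \<otimes> inv y \<otimes> z) (y # xs)"
    by (rule Cons.IH) (use Cons.prems in auto)
  moreover have "g \<otimes> (inv x \<otimes> y) \<otimes> inv y = g \<otimes> inv x"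
    using Cons.prems by (simp add: m_assoc)
  ultimately show ?case using Cons.prems by (simp add: m_assoc)
qed (auto simp: m_assoc)

lemma homog_map: "g \<in> carrier G \<Longrightarrow> set xs \<subseteq> carrier G \<Longrightarrow> homog G f (map (\<lambda>x. g \<otimes> x) xs) = homog G f xs"
  by (simp add: homog_def quots_map)

lemma linvariant_homog: "linvariant m G (homog G f)"
  by (simp add: linvariant_def homog_map)

lemma dehomog_homog: "set xs \<subseteq> carrier G \<Longrightarrow> dehomog G (homog G f) xs = f xs"
  by (simp add: dehomog_def homog_def quots_pprods)

lemma homog_dehomog:
  assumes "linvariant m G F" "F [] = 0" "set xs \<subseteq> carrier G"
  shows "[homog G (dehomog G F) xs = F xs] (mod m)"
proof (cases xs)
  case (Cons y ys)
  have "pprods G \<one> (quots G xs) = map (\<lambda>z. inv y \<otimes> z) xs"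
    using pprods_quots[of ys \<one> y] assms Cons by simp
  moreover have "[F (map (\<lambda>z. inv y \<otimes> z) xs) = F xs] (mod m)"
  proof -
    have "inv y \<in> carrier G" using assms Cons by auto
    then show ?thesis using assms(1,3) unfolding linvariant_def by blast
  qed
  ultimately show ?thesis by (simp add: homog_def dehomog_def Cons)
qed (simp add: assms)

lemma pprods_butlast: "xs \<noteq> [] \<Longrightarrow> take (length xs) (pprods G g xs) = pprods G g (butlast xs)"
proof (induction xs arbitrary: g)
  case (Cons x xs)
  then show ?case by (cases xs) auto
qed auto

text \<open>Leaving out an inner vertex of a path multiplies the two adjacent increments. This
  matches the inner faces with the inner terms of the coboundary.\<close>

lemma pprods_merge:
  assumes "i \<in> {1..<length xs}" "set xs \<subseteq> carrier G" "g \<in> carrier G"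
  shows "take i (pprods G g xs) @ drop (Suc i) (pprods G g xs)
    = pprods G g (take (i - 1) xs @ [xs ! (i - 1) \<otimes> xs ! i] @ drop (i + 1) xs)"
  using assms
proof (induction xs arbitrary: i g)
  case (Cons x xs)
  obtain j where i: "i = Suc j" using Cons.prems by (cases i) auto
  show ?case
  proof (cases j)
    case 0
    then obtain y ys where "xs = y # ys" using Cons.prems i by (cases xs) auto
    then show ?thesis using 0 i Cons.prems by (cases ys) (auto simp: m_assoc)
  next
    case (Suc k)
    then show ?thesis using Cons.IH[of j "g \<otimes> x"] Cons.prems i by auto
  qed
qed auto

lemma tcob_dehomog:
  assumes F: "linvariant m G F" "F [] = 0" and xs: "set xs \<subseteq> carrier G"
  shows "[tcob G (dehomog G F) xs = hD F (pprods G \<one> xs)] (mod m)"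
proof (cases "xs = []")
  case False
  define n where "n = length xs - 1"
  have n: "length xs = Suc n" using False by (cases xs) (auto simp: n_def)
  let ?t = "\<lambda>i. (-1) ^ i * F (take i (pprods G \<one> xs) @ drop (Suc i) (pprods G \<one> xs))"
  obtain x ys where x: "xs = x # ys" using False by (cases xs) auto
  have "hD F (pprods G \<one> xs) = (\<Sum>i<Suc (Suc n). ?t i)"
    by (simp add: hD_sum n del: sum.lessThan_Suc)
  also have "{..<Suc (Suc n)} = insert 0 (insert (Suc n) {1..n})" by auto
  also have "(\<Sum>i\<in>\<dots>. ?t i) = ?t 0 + (\<Sum>i\<in>{1..n}. ?t i) + ?t (Suc n)" by simp
  also have "(\<Sum>i\<in>{1..n}. ?t i) = (\<Sum>i\<in>{1..n}. (-1) ^ i *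
      dehomog G F (take (i - 1) xs @ [xs ! (i - 1) \<otimes> xs ! i] @ drop (i + 1) xs))"
    by (intro sum.cong refl) (use pprods_merge[OF _ xs one_closed] n in \<open>auto simp: dehomog_def\<close>)
  also have "?t (Suc n) = (-1) ^ (n + 1) * dehomog G F (butlast xs)"
    using pprods_butlast[OF False] n by (simp add: dehomog_def)
  finally have "hD F (pprods G \<one> xs) - tcob G (dehomog G F) xs = ?t 0 - dehomog G F (tl xs)"
    using False by (simp add: tcob_def coboundary_def n)
  \<comment> \<open>Without its first vertex the path starts at x instead of the unit. This is the
    one face at which the invariance of F enters.\<close>
  moreover have "?t 0 = F (map (\<lambda>y. x \<otimes> y) (pprods G \<one> ys))"
    using xs pprods_mult[of x \<one> ys] by (simp add: x)
  moreover have "[F (map (\<lambda>y. x \<otimes> y) (pprods G \<one> ys)) = dehomog G F (tl xs)] (mod m)"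
    using F xs pprods_closed[of \<one> ys] unfolding linvariant_def by (simp add: x dehomog_def)
  ultimately have "[hD F (pprods G \<one> xs) = tcob G (dehomog G F) xs] (mod m)"
    by (simp add: cong_iff_dvd_diff)
  then show ?thesis by (rule cong_sym)
qed (simp add: tcob_def assms)

lemma linvariant_hD: "linvariant m G F \<Longrightarrow> linvariant m G (hD F)"
  unfolding linvariant_def by (intro ballI allI impI) (auto simp: hD_map intro!: hD_cong)

lemma hD_homog:
  assumes "set xs \<subseteq> carrier G"
  shows "hD (homog G f) xs = homog G (tcob G f) xs"
proof (cases xs)
  case (Cons y ys)
  let ?F = "homog G f"
  \<comment> \<open>Congruence modulo 0 is equality, so the statements about invariance modulo m
    also yield the integral identity.\<close>
  have 0: "[homog G (dehomog G (hD ?F)) xs = hD ?F xs] (mod 0)"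
    by (rule homog_dehomog) (auto simp: assms linvariant_hD linvariant_homog)
  have quots: "set (quots G xs) \<subseteq> carrier G" using assms by (rule quots_closed)
  have "[tcob G (dehomog G ?F) (quots G xs) = dehomog G (hD ?F) (quots G xs)] (mod 0)"
    unfolding dehomog_def[of G "hD ?F"] using tcob_dehomog[OF linvariant_homog _ quots, of f 0] by simp
  moreover have "tcob G (dehomog G ?F) (quots G xs) = tcob G f (quots G xs)"
  proof -
    have "dehomog G ?F zs = f zs" if "set zs \<subseteq> carrier G" for zs
      using that by (rule dehomog_homog)
    moreover have "set (tl (quots G xs)) \<subseteq> carrier G" "set (butlast (quots G xs)) \<subseteq> carrier G"
      using quots by (cases "quots G xs"; auto dest: in_set_butlastD)+
    moreover have "set (take (i - 1) zs @ [zs ! (i - 1) \<otimes> zs ! i] @ drop (i + 1) zs) \<subseteq> carrier G"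
      if "set zs \<subseteq> carrier G" "i \<in> {1..length zs - 1}" for zs i
      using that by (auto dest!: in_set_takeD in_set_dropD simp: subset_iff nth_mem)
    ultimately show ?thesis
      using quots by (auto simp: tcob_def coboundary_def intro!: sum.cong)
  qed
  ultimately show ?thesis using 0 Cons by (simp add: homog_def cong_def)
qed simp

end

section \<open>Total cochains and the cohomology ring\<close>

definition cocyc :: "int \<Rightarrow> ('g, 'b) monoid_scheme \<Rightarrow> ('g list \<Rightarrow> int) \<Rightarrow> bool" where
  "cocyc m G f \<longleftrightarrow> (\<forall>xs. set xs \<subseteq> carrier G \<longrightarrow> [tcob G f xs = 0] (mod m))"

definition cohom :: "int \<Rightarrow> ('g, 'b) monoid_scheme \<Rightarrow> ('g list \<Rightarrow> int) \<Rightarrow> ('g list \<Rightarrow> int) \<Rightarrow> bool" where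
  "cohom m G f g \<longleftrightarrow> (\<exists>h. \<forall>xs. set xs \<subseteq> carrier G \<longrightarrow> [f xs = g xs + tcob G h xs] (mod m))"

definition coh_cls :: "int \<Rightarrow> ('g, 'b) monoid_scheme \<Rightarrow> ('g list \<Rightarrow> int) \<Rightarrow> 'g coh" where
  "coh_cls m G f = (\<lambda>n. hclass G m n f)"

definition coh_rep :: "'g coh \<Rightarrow> 'g list \<Rightarrow> int" where
  "coh_rep c xs = rep (c (length xs)) xs"

definition cup :: "('g list \<Rightarrow> int) \<Rightarrow> ('g list \<Rightarrow> int) \<Rightarrow> 'g list \<Rightarrow> int" where
  "cup f g xs = (\<Sum>i\<le>length xs. f (take i xs) * g (drop i xs))"

definition cup_unit :: "'g list \<Rightarrow> int" where
  "cup_unit xs = (if xs = [] then 1 else 0)"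

primrec cup_pow :: "('g list \<Rightarrow> int) \<Rightarrow> nat \<Rightarrow> 'g list \<Rightarrow> int" where
  "cup_pow f 0 = cup_unit"
| "cup_pow f (Suc k) = cup (cup_pow f k) f"

lemma coboundary_cong:
  assumes "\<And>ys. length ys = n \<Longrightarrow> f ys = g ys" "length xs = Suc n"
  shows "coboundary G n f xs = coboundary G n g xs"
  unfolding coboundary_def using assms by (auto intro!: sum.cong)

lemma tcob_add: "tcob G (\<lambda>l. f l + g l) xs = tcob G f xs + tcob G g xs"
  by (simp add: tcob_def coboundary_def algebra_simps sum.distrib)

lemma tcob_minus: "tcob G (\<lambda>l. - f l) xs = - tcob G f xs"
  by (simp add: tcob_def coboundary_def algebra_simps sum_negf)

lemma tcob_zero [simp]: "tcob G (\<lambda>l. 0) xs = 0"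
  by (simp add: tcob_def coboundary_def)

lemma cocyc_iff: "cocyc m G f \<longleftrightarrow> (\<forall>n. cocycle G m n f)"
proof (intro iffI allI)
  fix n
  assume "cocyc m G f"
  then have t: "[tcob G f xs = 0] (mod m)" if "valid_args G (Suc n) xs" for xs
    using that by (simp add: cocyc_def valid_args_def)
  have "[coboundary G n f xs = 0] (mod m)" if "valid_args G (Suc n) xs" for xs
    using t[OF that] that by (cases xs) (auto simp: tcob_def valid_args_def)
  then show "cocycle G m n f"
    unfolding cocycle_def by blast
next
  assume *: "\<forall>n. cocycle G m n f"
  have "[tcob G f xs = 0] (mod m)" if "set xs \<subseteq> carrier G" for xs
  proof (cases xs)
    case (Cons y ys)
    then show ?thesis using *[rule_format, of "length ys"] that
      by (auto simp: cocycle_def valid_args_def tcob_def)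
  qed (simp add: tcob_def)
  then show "cocyc m G f" by (simp add: cocyc_def)
qed

text \<open>Primitives chosen separately in each degree combine into one function that selects by
  the length of its argument.\<close>

lemma cohom_iff: "cohom m G f g \<longleftrightarrow> (\<forall>n. cohomologous G m n f g)"
proof
  assume "cohom m G f g"
  then obtain h where h: "\<And>xs. set xs \<subseteq> carrier G \<Longrightarrow> [f xs = g xs + tcob G h xs] (mod m)"
    unfolding cohom_def by blast
  show "\<forall>n. cohomologous G m n f g"
  proof
    fix n
    show "cohomologous G m n f g"
    proof (cases n)
      case 0
      then show ?thesis using h[of "[]"] by (simp add: cohomologous_def tcob_def)
    next
      case (Suc k)
      have "[f xs = g xs + coboundary G k h xs] (mod m)" if "valid_args G n xs" for xs
        using h[of xs] that Suc by (cases xs) (auto simp: valid_args_def tcob_def)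
      then show ?thesis using Suc by (auto simp: cohomologous_def)
    qed
  qed
next
  assume *: "\<forall>n. cohomologous G m n f g"
  have "\<forall>k. \<exists>h. \<forall>xs. valid_args G (Suc k) xs \<longrightarrow> [f xs = g xs + coboundary G k h xs] (mod m)"
  proof
    show "\<exists>h. \<forall>xs. valid_args G (Suc k) xs \<longrightarrow> [f xs = g xs + coboundary G k h xs] (mod m)" for k
      using *[rule_format, of "Suc k"] by (simp add: cohomologous_def)
  qed
  from choice[OF this] obtain h
    where h: "\<And>k xs. valid_args G (Suc k) xs \<Longrightarrow> [f xs = g xs + coboundary G k (h k) xs] (mod m)"
    by blast
  have "[f xs = g xs + tcob G (\<lambda>l. h (length l) l) xs] (mod m)" if xs: "set xs \<subseteq> carrier G" for xs
  proof (cases xs)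
    case Nil
    then show ?thesis using *[rule_format, of 0] by (simp add: cohomologous_def tcob_def)
  next
    case (Cons y ys)
    then have "coboundary G (length ys) (h (length ys)) xs = tcob G (\<lambda>l. h (length l) l) xs"
      using coboundary_cong[of "length ys" "h (length ys)" "\<lambda>l. h (length l) l" xs G] by (simp add: tcob_def)
    then show ?thesis using h[of "length ys" xs] xs Cons by (simp add: valid_args_def)
  qed
  then show "cohom m G f g" unfolding cohom_def by blast
qed

lemma cohom_refl [simp]: "cohom m G f f"
  unfolding cohom_def by (rule exI[of _ "\<lambda>_. 0"]) simp

lemma cohom_sym: "cohom m G f g \<Longrightarrow> cohom m G g f"
  unfolding cohom_def
proof (elim exE)
  fix h assume h: "\<forall>xs. set xs \<subseteq> carrier G \<longrightarrow> [f xs = g xs + tcob G h xs] (mod m)"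
  have "[g xs = f xs + tcob G (\<lambda>l. - h l) xs] (mod m)" if "set xs \<subseteq> carrier G" for xs
    using h[rule_format, OF that, THEN cong_sym] by (simp add: tcob_minus cong_iff_dvd_diff algebra_simps)
  then show "\<exists>h. \<forall>xs. set xs \<subseteq> carrier G \<longrightarrow> [g xs = f xs + tcob G h xs] (mod m)" by blast
qed

lemma cohom_trans: "cohom m G f g \<Longrightarrow> cohom m G g k \<Longrightarrow> cohom m G f k"
  unfolding cohom_def
proof (elim exE)
  fix h h'
  assume h: "\<forall>xs. set xs \<subseteq> carrier G \<longrightarrow> [f xs = g xs + tcob G h xs] (mod m)"
    and h': "\<forall>xs. set xs \<subseteq> carrier G \<longrightarrow> [g xs = k xs + tcob G h' xs] (mod m)"
  have "[f xs = k xs + tcob G (\<lambda>l. h' l + h l) xs] (mod m)" if "set xs \<subseteq> carrier G" for xs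
    using cong_trans[OF h[rule_format, OF that] cong_add[OF h'[rule_format, OF that] cong_refl]]
    by (simp add: tcob_add add.assoc)
  then show "\<exists>h. \<forall>xs. set xs \<subseteq> carrier G \<longrightarrow> [f xs = k xs + tcob G h xs] (mod m)" by blast
qed

lemma cohomologous_refl [simp]: "cohomologous G m n f f"
  using cohom_refl[of m G f] unfolding cohom_iff by blast

lemma cohomologous_degree_cong:
  assumes "\<And>xs. length xs = n \<Longrightarrow> f xs = f' xs" "\<And>xs. length xs = n \<Longrightarrow> g xs = g' xs"
  shows "cohomologous G m n f g \<longleftrightarrow> cohomologous G m n f' g'"
proof (cases n)
  case (Suc k)
  have "(valid_args G n xs \<longrightarrow> [f xs = g xs + coboundary G k h xs] (mod m)) \<longleftrightarrow>
      (valid_args G n xs \<longrightarrow> [f' xs = g' xs + coboundary G k h xs] (mod m))" for h xs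
    using assms by (simp add: valid_args_def)
  then show ?thesis using Suc by (simp add: cohomologous_def)
qed (use assms in \<open>simp add: cohomologous_def\<close>)

text \<open>Extension by zero embeds a single degree into the total complex, from which symmetry and
  transitivity are then inherited.\<close>

lemma cohomologous_total:
  "cohomologous G m n f g \<longleftrightarrow>
    cohom m G (\<lambda>l. if length l = n then f l else 0) (\<lambda>l. if length l = n then g l else 0)"
    (is "_ \<longleftrightarrow> cohom m G ?f ?g")
proof -
  have "cohomologous G m k ?f ?g \<longleftrightarrow> (k = n \<longrightarrow> cohomologous G m n f g)" for k
  proof (cases "k = n")
    case True
    then show ?thesis using cohomologous_degree_cong[of n ?f f ?g g G m] by simp
  next
    case False
    then show ?thesis using cohomologous_degree_cong[of k ?f "\<lambda>_. 0" ?g "\<lambda>_. 0" G m] by simp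
  qed
  then show ?thesis unfolding cohom_iff by blast
qed

lemma cohomologous_sym: "cohomologous G m n f g \<Longrightarrow> cohomologous G m n g f"
  unfolding cohomologous_total by (rule cohom_sym)

lemma cohomologous_trans:
  "cohomologous G m n f g \<Longrightarrow> cohomologous G m n g k \<Longrightarrow> cohomologous G m n f k"
  unfolding cohomologous_total by (rule cohom_trans)

lemma hclass_eqI: "cohomologous G m n f g \<Longrightarrow> hclass G m n f = hclass G m n g"
  unfolding hclass_def by (blast intro: cohomologous_sym cohomologous_trans)

lemma hclass_eq_iff: "cocycle G m n g \<Longrightarrow> hclass G m n f = hclass G m n g \<longleftrightarrow> cohomologous G m n f g"
  using hclass_eqI[of G m n f g] cohomologous_refl[of G m n g] unfolding hclass_def by blast

lemma coh_cls_eq_iff: "cocyc m G g \<Longrightarrow> coh_cls m G f = coh_cls m G g \<longleftrightarrow> cohom m G f g"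
  unfolding coh_cls_def cohom_iff cocyc_iff fun_eq_iff by (simp add: hclass_eq_iff)

lemma coh_cls_cong: "cohom m G f g \<Longrightarrow> coh_cls m G f = coh_cls m G g"
  unfolding coh_cls_def cohom_iff fun_eq_iff by (simp add: hclass_eqI)

lemma cocycle_degree_cong:
  assumes "\<And>xs. length xs = n \<Longrightarrow> f xs = g xs"
  shows "cocycle G m n f = cocycle G m n g"
  unfolding cocycle_def valid_args_def using coboundary_cong[of n f g, OF assms] by metis

lemma hclass_degree_cong:
  assumes "\<And>xs. length xs = n \<Longrightarrow> f xs = g xs"
  shows "hclass G m n f = hclass G m n g"
proof (rule hclass_eqI)
  have "cohomologous G m n f g \<longleftrightarrow> cohomologous G m n g g"
    by (rule cohomologous_degree_cong) (simp_all add: assms)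
  then show "cohomologous G m n f g" by simp
qed

lemma cocyc_zero [simp]: "cocyc m G (\<lambda>_. 0)"
  by (simp add: cocyc_def)

lemma cohom_cong:
  assumes "\<And>xs. set xs \<subseteq> carrier G \<Longrightarrow> [f xs = g xs] (mod m)"
  shows "cohom m G f g"
  unfolding cohom_def by (rule exI[of _ "\<lambda>_. 0"]) (simp add: assms)

lemma rep_hclass:
  assumes "cocycle G m n f"
  shows "cocycle G m n (rep (hclass G m n f))" "cohomologous G m n f (rep (hclass G m n f))"
proof -
  have "f \<in> hclass G m n f" using assms by (simp add: hclass_def)
  then have "rep (hclass G m n f) \<in> hclass G m n f" unfolding rep_def by (rule someI[of "\<lambda>g. g \<in> hclass G m n f"])
  then show "cocycle G m n (rep (hclass G m n f))" "cohomologous G m n f (rep (hclass G m n f))"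
    by (simp_all add: hclass_def)
qed

lemma coh_rep_coh_cls:
  assumes "cocyc m G f"
  shows "cocyc m G (coh_rep (coh_cls m G f))" "cohom m G f (coh_rep (coh_cls m G f))"
proof -
  have "cocycle G m n (coh_rep (coh_cls m G f)) = cocycle G m n (rep (hclass G m n f))" for n
    by (rule cocycle_degree_cong) (simp add: coh_rep_def coh_cls_def)
  moreover have "cohomologous G m n f (coh_rep (coh_cls m G f)) = cohomologous G m n f (rep (hclass G m n f))" for n
    by (rule cohomologous_degree_cong) (simp_all add: coh_rep_def coh_cls_def)
  ultimately show "cocyc m G (coh_rep (coh_cls m G f))" "cohom m G f (coh_rep (coh_cls m G f))"
    using assms rep_hclass unfolding cocyc_iff cohom_iff by blast+
qed

lemma Htot_coh_rep:
  assumes "c \<in> Htot G m"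
  shows "cocyc m G (coh_rep c)" "c = coh_cls m G (coh_rep c)"
proof -
  have "\<exists>f. cocycle G m n f \<and> c n = hclass G m n f" for n
    using assms by (auto simp: Htot_def Hn_def)
  then obtain f where f: "\<And>n. cocycle G m n (f n)" "\<And>n. c n = hclass G m n (f n)" by metis
  let ?f = "\<lambda>xs. f (length xs) xs"
  have "cocycle G m n ?f = cocycle G m n (f n)" for n by (rule cocycle_degree_cong) simp
  then have 1: "cocyc m G ?f" using f by (simp add: cocyc_iff)
  have "hclass G m n (f n) = hclass G m n ?f" for n by (rule hclass_degree_cong) simp
  then have 2: "c = coh_cls m G ?f" using f by (simp add: coh_cls_def fun_eq_iff)
  show "cocyc m G (coh_rep c)" unfolding 2 by (rule coh_rep_coh_cls(1)[OF 1])
  show "c = coh_cls m G (coh_rep c)" unfolding 2 by (rule coh_cls_cong[OF coh_rep_coh_cls(2)[OF 1]])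
qed

lemma coh_cls_in_Htot:
  assumes "cocyc m G f" and "\<And>xs. length xs > N \<Longrightarrow> f xs = 0"
  shows "coh_cls m G f \<in> Htot G m"
proof -
  have "hclass G m n f = hclass G m n (\<lambda>_. 0)" if "n > N" for n
    by (rule hclass_degree_cong) (simp add: assms that)
  then have "{n. \<not> hzero G m n (coh_cls m G f n)} \<subseteq> {..N}"
    by (force simp: hzero_def coh_cls_def)
  then show ?thesis using assms(1) finite_subset
    by (auto simp: Htot_def Hn_def coh_cls_def cocyc_iff)
qed

text \<open>Truncation removes whole degrees, and the cocycle condition does not mix
  degrees.\<close>

lemma cocyc_truncate:
  assumes "cocyc m G F"
  shows "cocyc m G (\<lambda>xs. if length xs > N then 0 else F xs)" (is "cocyc m G ?F")
proof -
  have "cocycle G m n ?F" for n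
  proof (cases "n > N")
    case True
    then have "cocycle G m n ?F = cocycle G m n (\<lambda>_. 0)" by (intro cocycle_degree_cong) simp
    then show ?thesis using cocyc_zero[of m G] unfolding cocyc_iff by blast
  next
    case False
    then have "cocycle G m n ?F = cocycle G m n F" by (intro cocycle_degree_cong) simp
    then show ?thesis using assms by (simp add: cocyc_iff)
  qed
  then show ?thesis by (simp add: cocyc_iff)
qed

text \<open>In a degree where the class is zero \<open>rep\<close> may still pick a nonzero
  function, so \<open>coh_rep\<close> need not have bounded degree; it is cut off above the last
  nonzero class.\<close>

lemma Htot_bounded:
  assumes "c \<in> Htot G m"
  obtains f N where "cocyc m G f" "c = coh_cls m G f" "\<And>xs. length xs > N \<Longrightarrow> f xs = 0"
proof -
  \<comment> \<open>Inserting 0 makes the maximum meaningful when every class is zero.\<close>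
  define N where "N = Max (insert 0 {n. \<not> hzero G m n (c n)})"
  have fin: "finite (insert 0 {n. \<not> hzero G m n (c n)})" using assms by (simp add: Htot_def)
  have z: "c n = hclass G m n (\<lambda>_. 0)" if "n > N" for n
    using Max_ge[OF fin, of n] that unfolding N_def hzero_def by force
  define f where "f = (\<lambda>xs. if length xs > N then 0 else coh_rep c xs)"
  note c = Htot_coh_rep[OF assms]
  have "c n = hclass G m n f" for n
  proof (cases "n > N")
    case True
    then have "hclass G m n f = hclass G m n (\<lambda>_. 0)" by (intro hclass_degree_cong) (simp add: f_def)
    then show ?thesis using z True by simp
  next
    case False
    then have "hclass G m n f = hclass G m n (coh_rep c)" by (intro hclass_degree_cong) (simp add: f_def)
    then show ?thesis using c(2) by (metis coh_cls_def)
  qed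
  moreover have "cocyc m G f" unfolding f_def by (rule cocyc_truncate[OF c(1)])
  ultimately show thesis using that[of f N] by (auto simp: coh_cls_def f_def)
qed

lemma coh_zero_coh_cls: "coh_zero G m = coh_cls m G (\<lambda>_. 0)"
  by (simp add: coh_zero_def coh_cls_def)

lemma coh_one_coh_cls: "coh_one G m = coh_cls m G cup_unit"
  unfolding coh_one_def coh_cls_def by (intro ext hclass_degree_cong) (auto simp: cup_unit_def)

lemma coh_mult_coh_cls: "coh_mult G m c d = coh_cls m G (cup (coh_rep c) (coh_rep d))"
  unfolding coh_mult_def coh_cls_def
  by (intro ext hclass_degree_cong) (auto simp: cup_def coh_rep_def intro!: sum.cong)

lemma pullback_coh_cls: "pullback H m \<phi> c = coh_cls m H (\<lambda>xs. coh_rep c (map \<phi> xs))"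
  unfolding pullback_def coh_cls_def by (intro ext hclass_degree_cong) (simp add: coh_rep_def)

section \<open>Cup products of cochains and of classes\<close>

lemma cup_Nil: "cup f g [] = f [] * g []"
  by (simp add: cup_def)

lemma cup_Cons: "cup f g (x # xs) = f [] * g (x # xs) + cup (\<lambda>l. f (x # l)) g xs"
  unfolding cup_def length_Cons sum.atMost_Suc_shift by simp

text \<open>The combination \<open>k * f l + f' l\<close> is what \<open>cup_Cons\<close> leaves in
  the first factor during the induction for associativity.\<close>

lemma cup_lin: "cup (\<lambda>l. k * f l + f' l) g xs = k * cup f g xs + cup f' g xs"
  by (simp add: cup_def algebra_simps sum.distrib sum_distrib_left)

lemma cup_assoc: "cup (cup f g) h = cup f (cup g h)"
proof
  show "cup (cup f g) h xs = cup f (cup g h) xs" for xs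
  proof (induction xs arbitrary: f)
    case (Cons x xs)
    then show ?case by (simp add: cup_Cons cup_lin cup_Nil algebra_simps)
  qed (simp add: cup_Nil)
qed

lemma cup_one: "cup f cup_unit = f"
proof
  show "cup f cup_unit xs = f xs" for xs
    by (induction xs arbitrary: f) (simp_all add: cup_Nil cup_Cons cup_unit_def)
qed

text \<open>The product is strictly associative on cochains, before passing to classes. With j = k
  this exhibits an even power as the square of a cocycle, the form in which
  \<open>cup_kernel\<close> applies.\<close>

lemma cup_pow_add: "cup_pow f (j + k) = cup (cup_pow f j) (cup_pow f k)"
  by (induction k) (simp_all add: cup_one cup_assoc)

lemma cup_map: "cup f g (map \<phi> xs) = cup (\<lambda>l. f (map \<phi> l)) (\<lambda>l. g (map \<phi> l)) xs"
  by (simp add: cup_def take_map drop_map)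

lemma cup_pow_map: "cup_pow f k (map \<phi> xs) = cup_pow (\<lambda>l. f (map \<phi> l)) k xs"
  by (induction k arbitrary: xs) (simp_all add: cup_map cup_unit_def)

lemma quots_take: "take i (quots G xs) = quots G (take (Suc i) xs)"
proof (induction xs arbitrary: i rule: induct_list012)
  case (3 x y zs)
  then show ?case by (cases i) auto
qed auto

lemma quots_drop: "drop i (quots G xs) = quots G (drop i xs)"
proof (induction xs arbitrary: i rule: induct_list012)
  case (2 x)
  then show ?case by (cases i) auto
next
  case (3 x y zs)
  then show ?case by (cases i) auto
qed auto

lemma homog_cup: "homog G (cup f g) xs = hcup (homog G f) (homog G g) xs"
proof (cases xs)
  case (Cons y ys)
  then have "homog G (cup f g) xs = (\<Sum>i<length xs. f (take i (quots G xs)) * g (drop i (quots G xs)))"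
    by (simp add: homog_def cup_def lessThan_Suc_atMost)
  also have "\<dots> = hcup (homog G f) (homog G g) xs"
    unfolding hcup_sum by (rule sum.cong) (auto simp: homog_def quots_take quots_drop Cons)
  finally show ?thesis .
qed simp

context group
begin

lemma cocyc_homog: "cocyc m G f \<longleftrightarrow> (\<forall>xs. set xs \<subseteq> carrier G \<longrightarrow> [hD (homog G f) xs = 0] (mod m))"
proof
  assume "cocyc m G f"
  then show "\<forall>xs. set xs \<subseteq> carrier G \<longrightarrow> [hD (homog G f) xs = 0] (mod m)"
    using quots_closed unfolding cocyc_def by (simp add: hD_homog homog_def)
next
  assume *: "\<forall>xs. set xs \<subseteq> carrier G \<longrightarrow> [hD (homog G f) xs = 0] (mod m)"
  have "[tcob G f xs = 0] (mod m)" if "set xs \<subseteq> carrier G" for xs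
    using *[rule_format, of "pprods G \<one> xs"] that pprods_closed[of \<one> xs] by (simp add: hD_homog homog_def quots_pprods)
  then show "cocyc m G f" unfolding cocyc_def by blast
qed

text \<open>The primitive is the homogenisation of an arbitrary inhomogeneous cochain, hence exactly
  invariant although the equation holds only modulo m. The converse \<open>cohomI\<close> accepts
  invariance modulo m, which is what \<open>descent\<close> delivers.\<close>

lemma cohomE:
  assumes "cohom m G f g"
  obtains H where "linvariant 0 G H" "H [] = 0"
    "\<And>xs. set xs \<subseteq> carrier G \<Longrightarrow> [homog G f xs = homog G g xs + hD H xs] (mod m)"
proof -
  obtain h where h: "\<And>xs. set xs \<subseteq> carrier G \<Longrightarrow> [f xs = g xs + tcob G h xs] (mod m)"
    using assms unfolding cohom_def by blast
  show thesis
  proof (rule that[of "homog G h"])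
    fix xs assume "set xs \<subseteq> carrier G"
    then show "[homog G f xs = homog G g xs + hD (homog G h) xs] (mod m)"
      using h[of "quots G xs"] quots_closed by (simp add: homog_def hD_homog)
  qed (auto simp: linvariant_homog)
qed

lemma cohomI:
  assumes "linvariant m G H" "H [] = 0"
    "\<And>xs. set xs \<subseteq> carrier G \<Longrightarrow> [homog G f xs = homog G g xs + hD H xs] (mod m)"
  shows "cohom m G f g"
  unfolding cohom_def
proof (intro exI allI impI)
  fix xs assume xs: "set xs \<subseteq> carrier G"
  have "[f xs = g xs + hD H (pprods G \<one> xs)] (mod m)"
    using assms(3)[of "pprods G \<one> xs"] xs pprods_closed[of \<one> xs] by (simp add: homog_def quots_pprods)
  also have "[g xs + hD H (pprods G \<one> xs) = g xs + tcob G (dehomog G H) xs] (mod m)"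
    by (intro cong_add cong_refl cong_sym[OF tcob_dehomog] assms xs)
  finally show "[f xs = g xs + tcob G (dehomog G H) xs] (mod m)" .
qed

lemma linvariant_hcup: "linvariant m G F \<Longrightarrow> linvariant m G F' \<Longrightarrow> linvariant m G (hcup F F')"
  unfolding linvariant_def by (intro ballI allI impI) (auto simp: hcup_map intro!: hcup_cong)

lemma cocyc_cup:
  assumes "cocyc m G f" "cocyc m G g"
  shows "cocyc m G (cup f g)"
  unfolding cocyc_homog
proof (intro allI impI)
  fix xs assume xs: "set xs \<subseteq> carrier G"
  let ?F = "homog G f" and ?H = "homog G g"
  have "homog G (cup f g) = hcup ?F ?H" by (intro ext homog_cup)
  then have "hD (homog G (cup f g)) xs = hcup (hD ?F) ?H xs + hcup (signed ?F) (hD ?H) xs"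
    by (simp add: hD_hcup)
  also have "[\<dots> = hcup (\<lambda>_. 0) ?H xs + hcup (signed ?F) (\<lambda>_. 0) xs] (mod m)"
    by (intro cong_add; rule hcup_cong[where A = "carrier G"]) (use assms xs in \<open>auto simp: cocyc_homog\<close>)
  finally show "[hD (homog G (cup f g)) xs = 0] (mod m)" by simp
qed

lemma linvariant_signed: "linvariant m G F \<Longrightarrow> linvariant m G (signed F)"
  unfolding linvariant_def signed_def length_map by (intro ballI allI impI cong_mult cong_refl) simp_all

lemma linvariant_0: "linvariant 0 G F \<Longrightarrow> linvariant m G F"
  unfolding linvariant_def by simp

lemma cohom_icup1:
  assumes "cohom m G f f'" "cocyc m G g"
  shows "cohom m G (cup f g) (cup f' g)"
proof -
  obtain H where H: "linvariant 0 G H" "H [] = 0"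
    "\<And>xs. set xs \<subseteq> carrier G \<Longrightarrow> [homog G f xs = homog G f' xs + hD H xs] (mod m)"
    using cohomE[OF assms(1)] by blast
  let ?g = "homog G g"
  show ?thesis
  proof (rule cohomI)
    show "linvariant m G (hcup H ?g)" by (rule linvariant_hcup[OF linvariant_0[OF H(1)] linvariant_homog])
    fix xs assume xs: "set xs \<subseteq> carrier G"
    have "[homog G (cup f g) xs = hcup (\<lambda>l. homog G f' l + hD H l) ?g xs] (mod m)"
      unfolding homog_cup by (rule hcup_cong[where A = "carrier G"]) (use H xs in auto)
    also have "hcup (\<lambda>l. homog G f' l + hD H l) ?g xs = homog G (cup f' g) xs + (hcup (hD H) ?g xs + hcup (signed H) (\<lambda>_. 0) xs)"
      by (simp add: hcup_add1 homog_cup)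
    also have "[hcup (hD H) ?g xs + hcup (signed H) (\<lambda>_. 0) xs = hcup (hD H) ?g xs + hcup (signed H) (hD ?g) xs] (mod m)"
      by (intro cong_add cong_refl hcup_cong[where A = "carrier G"])
        (use assms xs in \<open>auto simp: cocyc_homog intro: cong_sym\<close>)
    then have "[homog G (cup f' g) xs + (hcup (hD H) ?g xs + hcup (signed H) (\<lambda>_. 0) xs)
        = homog G (cup f' g) xs + hD (hcup H ?g) xs] (mod m)"
      by (intro cong_add cong_refl) (simp add: hD_hcup H)
    finally show "[homog G (cup f g) xs = homog G (cup f' g) xs + hD (hcup H ?g) xs] (mod m)" .
  qed simp
qed

text \<open>The Leibniz rule attaches the sign of the first factor to the term containing
  \<open>hD H\<close>; the extra \<open>signed\<close> in the primitive
  \<open>hcup (signed ?f) H\<close> cancels it.\<close>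

lemma cohom_icup2:
  assumes "cohom m G g g'" "cocyc m G f"
  shows "cohom m G (cup f g) (cup f g')"
proof -
  obtain H where H: "linvariant 0 G H" "H [] = 0"
    "\<And>xs. set xs \<subseteq> carrier G \<Longrightarrow> [homog G g xs = homog G g' xs + hD H xs] (mod m)"
    using cohomE[OF assms(1)] by blast
  let ?f = "homog G f"
  show ?thesis
  proof (rule cohomI)
    show "linvariant m G (hcup (signed ?f) H)" by (rule linvariant_hcup[OF linvariant_signed[OF linvariant_homog] linvariant_0[OF H(1)]])
    fix xs assume xs: "set xs \<subseteq> carrier G"
    have s: "[hD (signed ?f) l = 0] (mod m)" if "set l \<subseteq> carrier G" for l
    proof -
      have "[hD (homog G f) l = 0] (mod m)" using assms(2) that by (simp add: cocyc_homog)
      then show ?thesis unfolding hD_signed signed_def by (simp add: cong_0_iff)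
    qed
    have s0: "signed ?f [] = 0" by (simp add: signed_def)
    have "[homog G (cup f g) xs = hcup ?f (\<lambda>l. homog G g' l + hD H l) xs] (mod m)"
      unfolding homog_cup by (rule hcup_cong[where A = "carrier G"]) (use H xs in auto)
    also have "hcup ?f (\<lambda>l. homog G g' l + hD H l) xs = homog G (cup f g') xs + (hcup (\<lambda>_. 0) H xs + hcup ?f (hD H) xs)"
      by (simp add: hcup_add2 homog_cup)
    also have "[hcup (\<lambda>_. 0) H xs + hcup ?f (hD H) xs = hcup (hD (signed ?f)) H xs + hcup (signed (signed ?f)) (hD H) xs] (mod m)"
      unfolding signed_signed
      by (intro cong_add cong_refl hcup_cong[where A = "carrier G"])
        (use s xs in \<open>auto intro: cong_sym\<close>)
    then have "[homog G (cup f g') xs + (hcup (\<lambda>_. 0) H xs + hcup ?f (hD H) xs)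
        = homog G (cup f g') xs + hD (hcup (signed ?f) H) xs] (mod m)"
      by (intro cong_add cong_refl) (simp add: hD_hcup H s0)
    finally show "[homog G (cup f g) xs = homog G (cup f g') xs + hD (hcup (signed ?f) H) xs] (mod m)" .
  qed simp
qed

lemma cohom_cup:
  assumes "cohom m G f f'" "cohom m G g g'" "cocyc m G f'" "cocyc m G g"
  shows "cohom m G (cup f g) (cup f' g')"
  using cohom_icup1[OF assms(1,4)] cohom_icup2[OF assms(2,3)] by (rule cohom_trans)

lemma cocyc_cup_unit: "cocyc m G cup_unit"
proof -
  have "coboundary G n cup_unit xs = 0" if len: "length xs = Suc n" for n xs
  proof (cases n)
    case 0
    then obtain x where "xs = [x]" using len by (cases xs) auto
    then show ?thesis using 0 by (simp add: coboundary_def)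
  next
    case (Suc k)
    have "length (tl xs) = Suc k" "length (butlast xs) = Suc k" using len Suc by auto
    then have "tl xs \<noteq> []" "butlast xs \<noteq> []" by (metis Zero_not_Suc list.size(3))+
    then show ?thesis by (simp add: coboundary_def cup_unit_def)
  qed
  then have "tcob G cup_unit xs = 0" for xs by (cases xs) (auto simp: tcob_def)
  then show ?thesis by (simp add: cocyc_def)
qed

lemma cocyc_cup_pow: "cocyc m G f \<Longrightarrow> cocyc m G (cup_pow f k)"
  by (induction k) (auto simp: cocyc_cup_unit cocyc_cup)

lemma coh_mult_of_coh_cls:
  assumes "cocyc m G f" "cocyc m G g"
  shows "coh_mult G m (coh_cls m G f) (coh_cls m G g) = coh_cls m G (cup f g)"
  unfolding coh_mult_coh_cls
  by (intro coh_cls_cong cohom_cup cohom_sym[OF coh_rep_coh_cls(2)] coh_rep_coh_cls(1) assms)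

lemma coh_pow_of_coh_cls:
  assumes "cocyc m G f"
  shows "coh_pow G m (coh_cls m G f) k = coh_cls m G (cup_pow f k)"
  by (induction k) (simp_all add: coh_one_coh_cls coh_mult_of_coh_cls cocyc_cup_pow assms)

lemma coh_nilpotent_of_coh_cls:
  assumes "cocyc m G f"
  shows "coh_nilpotent G m (coh_cls m G f) \<longleftrightarrow> (\<exists>k>0. cohom m G (cup_pow f k) (\<lambda>_. 0))"
  by (simp add: coh_nilpotent_def coh_pow_of_coh_cls assms coh_zero_coh_cls coh_cls_eq_iff)

end

section \<open>Functoriality of classes in the group\<close>

lemma hom_map_closed:
  assumes "\<phi> \<in> hom H G" "set xs \<subseteq> carrier H"
  shows "set (map \<phi> xs) \<subseteq> carrier G"
  using assms by (auto simp: hom_def)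

lemma tcob_hom:
  assumes "\<phi> \<in> hom H G" "set xs \<subseteq> carrier H"
  shows "tcob H (\<lambda>l. f (map \<phi> l)) xs = tcob G f (map \<phi> xs)"
proof -
  have "\<phi> (xs ! (i - 1) \<otimes>\<^bsub>H\<^esub> xs ! i) = \<phi> (xs ! (i - 1)) \<otimes>\<^bsub>G\<^esub> \<phi> (xs ! i)" if "i \<in> {1..length xs - 1}" for i
    using assms that by (intro hom_mult[OF assms(1)]) (auto simp: subset_iff)
  then show ?thesis
    by (auto simp: tcob_def coboundary_def map_tl map_butlast take_map drop_map intro!: sum.cong)
qed

lemma cocyc_hom: "\<phi> \<in> hom H G \<Longrightarrow> cocyc m G f \<Longrightarrow> cocyc m H (\<lambda>l. f (map \<phi> l))"
  unfolding cocyc_def using hom_map_closed[of \<phi> H G] by (simp add: tcob_hom)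

lemma cohom_hom:
  assumes "\<phi> \<in> hom H G" "cohom m G f g"
  shows "cohom m H (\<lambda>l. f (map \<phi> l)) (\<lambda>l. g (map \<phi> l))"
proof -
  obtain h where h: "\<And>xs. set xs \<subseteq> carrier G \<Longrightarrow> [f xs = g xs + tcob G h xs] (mod m)"
    using assms(2) unfolding cohom_def by blast
  then have "[f (map \<phi> xs) = g (map \<phi> xs) + tcob H (\<lambda>l. h (map \<phi> l)) xs] (mod m)"
    if "set xs \<subseteq> carrier H" for xs
    unfolding tcob_hom[OF assms(1) that] by (intro h hom_map_closed[OF assms(1)] that)
  then show ?thesis unfolding cohom_def by blast
qed

lemma pullback_of_coh_cls:
  assumes "\<phi> \<in> hom H G" "cocyc m G f"
  shows "pullback H m \<phi> (coh_cls m G f) = coh_cls m H (\<lambda>l. f (map \<phi> l))"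
  unfolding pullback_coh_cls by (intro coh_cls_cong cohom_hom[OF assms(1)] cohom_sym[OF coh_rep_coh_cls(2)] assms)

section \<open>Descent along stable letters\<close>

text \<open>H acts freely on G by left translation through \<iota>, and a choice of one point in
  every orbit identifies G with the product of H and the set of orbits. The map \<rho> is the first
  coordinate. In general it is not a homomorphism, but homogeneous cochains and prisms can be pulled
  back along any map of vertices.\<close>

lemma coset_retraction:
  assumes "group G" "group H" and hom: "\<iota> \<in> hom H G" and inj: "inj_on \<iota> (carrier H)"
  obtains \<rho> where "\<And>g. g \<in> carrier G \<Longrightarrow> \<rho> g \<in> carrier H"
    "\<And>h g. h \<in> carrier H \<Longrightarrow> g \<in> carrier G \<Longrightarrow> \<rho> (\<iota> h \<otimes>\<^bsub>G\<^esub> g) = h \<otimes>\<^bsub>H\<^esub> \<rho> g"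
    "\<rho> \<one>\<^bsub>G\<^esub> = \<one>\<^bsub>H\<^esub>"
proof -
  interpret G: group G by fact
  interpret H: group H by fact
  interpret \<iota>: group_hom H G \<iota> by unfold_locales (rule hom)
  \<comment> \<open>The predicate under \<open>SOME\<close> depends on g only through its coset
    under H, so r is constant on cosets; s below records the element that moves g to the chosen
    point.\<close>
  define r where "r g = (SOME x. \<exists>h\<in>carrier H. x = \<iota> h \<otimes>\<^bsub>G\<^esub> g)" for g
  have "\<exists>h\<in>carrier H. r g = \<iota> h \<otimes>\<^bsub>G\<^esub> g" for g
    unfolding r_def by (rule someI_ex) blast
  then obtain s where s: "\<And>g. s g \<in> carrier H" "\<And>g. r g = \<iota> (s g) \<otimes>\<^bsub>G\<^esub> g" by metis
  have r: "r (\<iota> h \<otimes>\<^bsub>G\<^esub> g) = r g" if h: "h \<in> carrier H" and g: "g \<in> carrier G" for h g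
  proof -
    have "(\<exists>k\<in>carrier H. x = \<iota> k \<otimes>\<^bsub>G\<^esub> (\<iota> h \<otimes>\<^bsub>G\<^esub> g)) \<longleftrightarrow> (\<exists>k\<in>carrier H. x = \<iota> k \<otimes>\<^bsub>G\<^esub> g)" for x
    proof
      assume "\<exists>k\<in>carrier H. x = \<iota> k \<otimes>\<^bsub>G\<^esub> (\<iota> h \<otimes>\<^bsub>G\<^esub> g)"
      then obtain k where "k \<in> carrier H" "x = \<iota> k \<otimes>\<^bsub>G\<^esub> (\<iota> h \<otimes>\<^bsub>G\<^esub> g)" by blast
      then show "\<exists>k\<in>carrier H. x = \<iota> k \<otimes>\<^bsub>G\<^esub> g"
        by (intro bexI[of _ "k \<otimes>\<^bsub>H\<^esub> h"]) (simp_all add: h g G.m_assoc)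
    next
      assume "\<exists>k\<in>carrier H. x = \<iota> k \<otimes>\<^bsub>G\<^esub> g"
      then obtain k where "k \<in> carrier H" "x = \<iota> k \<otimes>\<^bsub>G\<^esub> g" by blast
      then show "\<exists>k\<in>carrier H. x = \<iota> k \<otimes>\<^bsub>G\<^esub> (\<iota> h \<otimes>\<^bsub>G\<^esub> g)"
        by (intro bexI[of _ "k \<otimes>\<^bsub>H\<^esub> inv\<^bsub>H\<^esub> h"]) (simp_all add: h g G.m_assoc G.inv_solve_left)
    qed
    then show ?thesis unfolding r_def by simp
  qed
  have s': "s (\<iota> h \<otimes>\<^bsub>G\<^esub> g) \<otimes>\<^bsub>H\<^esub> h = s g" if h: "h \<in> carrier H" and g: "g \<in> carrier G" for h g
  proof -
    have "\<iota> (s (\<iota> h \<otimes>\<^bsub>G\<^esub> g) \<otimes>\<^bsub>H\<^esub> h) \<otimes>\<^bsub>G\<^esub> g = \<iota> (s g) \<otimes>\<^bsub>G\<^esub> g"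
      using r[OF h g] by (simp add: s h g G.m_assoc)
    then have "\<iota> (s (\<iota> h \<otimes>\<^bsub>G\<^esub> g) \<otimes>\<^bsub>H\<^esub> h) = \<iota> (s g)"
      by (simp add: s h g G.r_cancel)
    then show ?thesis by (rule inj_onD[OF inj]) (simp_all add: s h)
  qed
  show thesis
  \<comment> \<open>The inverse of \<open>s g\<close> leads back from the chosen point to g. The
    factor on the right normalises the value at the unit and commutes with left
    translations.\<close>
  proof (rule that[of "\<lambda>g. inv\<^bsub>H\<^esub> (s g) \<otimes>\<^bsub>H\<^esub> s \<one>\<^bsub>G\<^esub>"])
    fix h g assume h: "h \<in> carrier H" and g: "g \<in> carrier G"
    have "inv\<^bsub>H\<^esub> (s (\<iota> h \<otimes>\<^bsub>G\<^esub> g)) = h \<otimes>\<^bsub>H\<^esub> inv\<^bsub>H\<^esub> (s g)"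
      unfolding s'[OF h g, symmetric] by (simp add: H.inv_mult_group s h flip: H.m_assoc)
    then show "inv\<^bsub>H\<^esub> (s (\<iota> h \<otimes>\<^bsub>G\<^esub> g)) \<otimes>\<^bsub>H\<^esub> s \<one>\<^bsub>G\<^esub> = h \<otimes>\<^bsub>H\<^esub> (inv\<^bsub>H\<^esub> (s g) \<otimes>\<^bsub>H\<^esub> s \<one>\<^bsub>G\<^esub>)"
      by (simp add: s h H.m_assoc)
  qed (simp_all add: s)
qed

section \<open>Equivariant prisms and conjugation\<close>

lemma quots_hom:
  assumes "group H" "group G" "\<phi> \<in> hom H G" "set xs \<subseteq> carrier H"
  shows "quots G (map \<phi> xs) = map \<phi> (quots H xs)"
proof -
  interpret group_hom H G \<phi> using assms by (simp add: group_hom_def group_hom_axioms_def)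
  show ?thesis using assms(4) by (induction xs rule: induct_list012) auto
qed

lemma homog_hom:
  assumes "group H" "group G" "\<phi> \<in> hom H G" "set xs \<subseteq> carrier H"
  shows "homog H (\<lambda>l. f (map \<phi> l)) xs = homog G f (map \<phi> xs)"
  by (simp add: homog_def quots_hom[OF assms])

lemma prism_invariant:
  assumes xs: "set xs \<subseteq> A" and \<sigma>: "\<sigma> \<in> A \<rightarrow> B" and \<rho>: "\<rho> \<in> A \<rightarrow> B"
    and "\<And>x. x \<in> A \<Longrightarrow> \<sigma> (\<theta> x) = \<psi> (\<sigma> x)" "\<And>x. x \<in> A \<Longrightarrow> \<rho> (\<theta> x) = \<psi> (\<rho> x)"
    and "\<And>ys. set ys \<subseteq> B \<Longrightarrow> c (map \<psi> ys) = c ys"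
  shows "prism \<sigma> \<rho> c (map \<theta> xs) = prism \<sigma> \<rho> c xs"
proof -
  have "prism \<sigma> \<rho> c (map \<theta> xs) = prism (\<psi> \<circ> \<sigma>) (\<psi> \<circ> \<rho>) c xs"
    unfolding prism_map by (rule prism_eq) (use assms in auto)
  also have "\<dots> = prism \<sigma> \<rho> (\<lambda>l. c (map \<psi> l)) xs" by (simp add: prism_pull)
  also have "\<dots> = prism \<sigma> \<rho> c xs"
    using prism_cong[of B "\<lambda>l. c (map \<psi> l)" c 0 xs A \<sigma> \<rho>] assms by simp
  finally show ?thesis .
qed

lemma hD_prism_cong:
  assumes "\<And>ys. set ys \<subseteq> B \<Longrightarrow> [hD c ys = 0] (mod m)" and "set xs \<subseteq> A" "\<sigma> \<in> A \<rightarrow> B" "\<rho> \<in> A \<rightarrow> B"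
  shows "[hD (prism \<sigma> \<rho> c) xs = c (map \<rho> xs) - c (map \<sigma> xs)] (mod m)"
proof -
  have "[prism \<sigma> \<rho> (hD c) xs = prism \<sigma> \<rho> (\<lambda>_. 0) xs] (mod m)"
    by (rule prism_cong[where B = B]) (use assms in auto)
  then have "[prism \<sigma> \<rho> (hD c) xs = 0] (mod m)" by simp
  then have "m dvd prism \<sigma> \<rho> (hD c) xs" by (simp add: cong_0_iff)
  moreover have "hD (prism \<sigma> \<rho> c) xs - (c (map \<rho> xs) - c (map \<sigma> xs)) = - prism \<sigma> \<rho> (hD c) xs"
    using hD_prism[of \<sigma> \<rho> c xs] by simp
  ultimately show ?thesis unfolding cong_iff_dvd_diff by simp
qed

lemma (in group) cocyc_dehomog:
  assumes "linvariant m G F" "F [] = 0" "\<And>xs. set xs \<subseteq> carrier G \<Longrightarrow> [hD F xs = 0] (mod m)"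
  shows "cocyc m G (dehomog G F)"
  unfolding cocyc_homog
proof (intro allI impI)
  fix xs assume xs: "set xs \<subseteq> carrier G"
  have "[hD (homog G (dehomog G F)) xs = hD F xs] (mod m)"
    by (rule hD_cong[OF homog_dehomog[OF assms(1,2)] xs])
  then show "[hD (homog G (dehomog G F)) xs = 0] (mod m)" using assms(3)[OF xs] by (rule cong_trans)
qed

text \<open>The maps \<alpha> and x \<mapsto> \<alpha> x c are equivariant for the same action of K
  through \<alpha>, so the prism between them is invariant. By the relation the second map is
  \<beta> followed by left translation by c, which the homogeneous cochain of f does not
  see.\<close>

lemma cohom_conj:
  assumes "group K" "group G" and \<alpha>: "\<alpha> \<in> hom K G" and \<beta>: "\<beta> \<in> hom K G" and c: "c \<in> carrier G"
    and conj: "\<And>x. x \<in> carrier K \<Longrightarrow> \<alpha> x \<otimes>\<^bsub>G\<^esub> c = c \<otimes>\<^bsub>G\<^esub> \<beta> x"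
    and f: "cocyc m G f"
  shows "cohom m K (\<lambda>l. f (map \<beta> l)) (\<lambda>l. f (map \<alpha> l))"
proof -
  interpret K: group K by fact
  interpret G: group G by fact
  let ?F = "homog G f"
  let ?\<gamma> = "\<lambda>x. \<alpha> x \<otimes>\<^bsub>G\<^esub> c"
  have cl: "\<alpha> \<in> carrier K \<rightarrow> carrier G" "\<beta> \<in> carrier K \<rightarrow> carrier G" "?\<gamma> \<in> carrier K \<rightarrow> carrier G"
    using \<alpha> \<beta> c by (auto simp: hom_def)
  show ?thesis
  proof (rule K.cohomI)
    show "linvariant m K (prism \<alpha> ?\<gamma> ?F)"
      unfolding linvariant_def
    proof (intro ballI allI impI)
      fix k xs assume k: "k \<in> carrier K" and xs: "set xs \<subseteq> carrier K"
      have "prism \<alpha> ?\<gamma> ?F (map (\<lambda>x. k \<otimes>\<^bsub>K\<^esub> x) xs) = prism \<alpha> ?\<gamma> ?F xs"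
        by (rule prism_invariant[where \<psi> = "\<lambda>x. \<alpha> k \<otimes>\<^bsub>G\<^esub> x" and A = "carrier K" and B = "carrier G"])
          (use \<alpha> c cl k xs in \<open>auto simp: hom_mult G.m_assoc hom_in_carrier G.homog_map\<close>)
      then show "[prism \<alpha> ?\<gamma> ?F (map (\<lambda>x. k \<otimes>\<^bsub>K\<^esub> x) xs) = prism \<alpha> ?\<gamma> ?F xs] (mod m)" by simp
    qed
    fix xs assume xs: "set xs \<subseteq> carrier K"
    have bxs: "set (map \<beta> xs) \<subseteq> carrier G" using xs cl by auto
    have e: "map ?\<gamma> xs = map (\<lambda>x. c \<otimes>\<^bsub>G\<^esub> x) (map \<beta> xs)" using conj xs by auto
    have "?F (map ?\<gamma> xs) = ?F (map \<beta> xs)" unfolding e by (rule G.homog_map[OF c bxs])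
    moreover have "[hD (prism \<alpha> ?\<gamma> ?F) xs = ?F (map ?\<gamma> xs) - ?F (map \<alpha> xs)] (mod m)"
      by (rule hD_prism_cong[OF _ xs]) (use f cl in \<open>auto simp: G.cocyc_homog\<close>)
    ultimately have "[?F (map \<alpha> xs) + hD (prism \<alpha> ?\<gamma> ?F) xs = ?F (map \<alpha> xs) + (?F (map \<beta> xs) - ?F (map \<alpha> xs))] (mod m)"
      by (intro cong_add cong_refl) simp
    then have "[?F (map \<beta> xs) = ?F (map \<alpha> xs) + hD (prism \<alpha> ?\<gamma> ?F) xs] (mod m)"
      by (simp add: cong_sym)
    then show "[homog K (\<lambda>l. f (map \<beta> l)) xs = homog K (\<lambda>l. f (map \<alpha> l)) xs + hD (prism \<alpha> ?\<gamma> ?F) xs] (mod m)"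
      using homog_hom[OF assms(1,2) \<alpha> xs] homog_hom[OF assms(1,2) \<beta> xs] by simp
  qed simp
qed

text \<open>The tree has vertices G/P and, for each i, edges G/Q i, the edge of x joining the cosets
  of x and x t. In these terms \<open>gen\<close> expresses that the tree is connected, and
  \<open>lift\<close> that every integral cochain on the edges is the coboundary of a cochain on the
  vertices, that is, the absence of cycles.\<close>

locale stable_letters = G: group G + P: group P
  for G :: "('g, 'c) monoid_scheme" (structure) and P :: "('a, 'b) monoid_scheme" +
  fixes \<iota> :: "'a \<Rightarrow> 'g" and I :: "'i set" and Q :: "'i \<Rightarrow> 'a set" and \<phi> :: "'i \<Rightarrow> 'a \<Rightarrow> 'a" and t :: "'i \<Rightarrow> 'g"
  assumes \<iota>_hom: "\<iota> \<in> hom P G" and \<iota>_inj: "inj_on \<iota> (carrier P)"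
    and Q_sub: "\<And>i. i \<in> I \<Longrightarrow> subgroup (Q i) P"
    and \<phi>_hom: "\<And>i. i \<in> I \<Longrightarrow> \<phi> i \<in> hom (P\<lparr>carrier := Q i\<rparr>) P"
    and t_closed: "\<And>i. i \<in> I \<Longrightarrow> t i \<in> carrier G"
    and t_conj: "\<And>i q. i \<in> I \<Longrightarrow> q \<in> Q i \<Longrightarrow> \<iota> q \<otimes> t i = t i \<otimes> \<iota> (\<phi> i q)"
    and gen: "\<And>S. \<one> \<in> S \<Longrightarrow> (\<And>x a. x \<in> carrier G \<Longrightarrow> x \<in> S \<Longrightarrow> a \<in> carrier P \<Longrightarrow> x \<otimes> \<iota> a \<in> S) \<Longrightarrow>
        (\<And>x i. x \<in> carrier G \<Longrightarrow> x \<in> S \<Longrightarrow> i \<in> I \<Longrightarrow> x \<otimes> t i \<in> S) \<Longrightarrow>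
        (\<And>x i. x \<in> carrier G \<Longrightarrow> x \<in> S \<Longrightarrow> i \<in> I \<Longrightarrow> x \<otimes> inv (t i) \<in> S) \<Longrightarrow> carrier G \<subseteq> S"
    and lift: "\<And>k :: 'i \<Rightarrow> 'g \<Rightarrow> int. (\<And>i x q. i \<in> I \<Longrightarrow> x \<in> carrier G \<Longrightarrow> q \<in> Q i \<Longrightarrow> k i (x \<otimes> \<iota> q) = k i x) \<Longrightarrow>
        \<exists>l. \<forall>x\<in>carrier G. (\<forall>a\<in>carrier P. l (x \<otimes> \<iota> a) = l x) \<and> (\<forall>i\<in>I. l (x \<otimes> t i) = l x + k i x)"
begin

sublocale \<iota>: group_hom P G \<iota>
  by unfold_locales (rule \<iota>_hom)

lemma Q_carrier: "i \<in> I \<Longrightarrow> q \<in> Q i \<Longrightarrow> q \<in> carrier P"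
  using Q_sub subgroup.subset by blast

lemma \<phi>_closed: "i \<in> I \<Longrightarrow> q \<in> Q i \<Longrightarrow> \<phi> i q \<in> carrier P"
  using \<phi>_hom[of i] by (auto simp: hom_def)

abbreviation act :: "'g \<Rightarrow> 'g list \<Rightarrow> 'g list" where
  "act g xs \<equiv> map (\<lambda>x. g \<otimes> x) xs"

lemma act_act: "g \<in> carrier G \<Longrightarrow> h \<in> carrier G \<Longrightarrow> set xs \<subseteq> carrier G \<Longrightarrow> act g (act h xs) = act (g \<otimes> h) xs"
  by (auto simp: G.m_assoc)

lemma act_closed: "g \<in> carrier G \<Longrightarrow> set xs \<subseteq> carrier G \<Longrightarrow> set (act g xs) \<subseteq> carrier G"
  by auto

lemma act_one: "set xs \<subseteq> carrier G \<Longrightarrow> act \<one> xs = xs"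
  by (induction xs) auto

lemma t_inv_conj:
  assumes "i \<in> I" "q \<in> Q i"
  shows "inv (t i) \<otimes> \<iota> q = \<iota> (\<phi> i q) \<otimes> inv (t i)"
proof -
  note c = t_closed[OF assms(1)] Q_carrier[OF assms] \<phi>_closed[OF assms]
  have "inv (t i) \<otimes> (\<iota> q \<otimes> t i) = \<iota> (\<phi> i q)"
    using c by (simp add: t_conj assms flip: G.m_assoc)
  then have "\<iota> (\<phi> i q) \<otimes> inv (t i) = inv (t i) \<otimes> (\<iota> q \<otimes> t i) \<otimes> inv (t i)" by simp
  also have "\<dots> = inv (t i) \<otimes> \<iota> q" using c by (simp add: G.m_assoc)
  finally show ?thesis by simp
qed

text \<open>The function \<open>ll xs\<close> in the proof lifts the differences \<open>k\<close> along the tree. It is chosen for the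
  translate of \<open>xs\<close> that starts with the unit, which makes the choice equivariant.\<close>

lemma descent:
  fixes A :: "'g list \<Rightarrow> int" and k :: "'i \<Rightarrow> 'g list \<Rightarrow> int"
  assumes A: "\<And>a xs. a \<in> carrier P \<Longrightarrow> set xs \<subseteq> carrier G \<Longrightarrow> A (act (\<iota> a) xs) = A xs"
    and k: "\<And>i q xs. i \<in> I \<Longrightarrow> q \<in> Q i \<Longrightarrow> set xs \<subseteq> carrier G \<Longrightarrow> k i (act (\<iota> q) xs) = k i xs"
    and k0: "\<And>i. k i [] = 0"
    and rel: "\<And>i xs. i \<in> I \<Longrightarrow> set xs \<subseteq> carrier G \<Longrightarrow> [A (act (inv (t i)) xs) = A xs + hD (k i) xs] (mod m)"
  obtains l where "l [] = 0" "\<And>a xs. a \<in> carrier P \<Longrightarrow> set xs \<subseteq> carrier G \<Longrightarrow> l (act (\<iota> a) xs) = l xs"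
    "linvariant m G (\<lambda>xs. A xs - hD l xs)"
proof -
  have "\<exists>l. \<forall>x\<in>carrier G. (\<forall>a\<in>carrier P. l (x \<otimes> \<iota> a) = l x) \<and> (\<forall>i\<in>I. l (x \<otimes> t i) = l x + k i (act (inv x) ys))"
    if ys: "set ys \<subseteq> carrier G" for ys
  \<comment> \<open>Evaluating at translates of ys by inverses turns the left invariance of
    \<open>k i\<close> under \<open>Q i\<close> into the right invariance in x that
    \<open>lift\<close> asks for.\<close>
  proof (rule lift[of "\<lambda>i x. k i (act (inv x) ys)"])
    fix i x q assume i: "i \<in> I" and x: "x \<in> carrier G" and q: "q \<in> Q i"
    let ?z = "act (inv (x \<otimes> \<iota> q)) ys"
    have q': "\<iota> q \<in> carrier G" using Q_carrier[OF i q] by simp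
    have "set ?z \<subseteq> carrier G" by (rule act_closed) (use q' x ys in auto)
    then have "k i ?z = k i (act (\<iota> q) ?z)" by (rule k[OF i q, symmetric])
    also have "act (\<iota> q) ?z = act (inv x) ys"
      using q' x ys by (subst act_act) (simp_all add: G.inv_mult_group G.m_assoc[symmetric])
    finally show "k i ?z = k i (act (inv x) ys)" .
  qed
  then have "\<forall>ys. \<exists>l. set ys \<subseteq> carrier G \<longrightarrow> (\<forall>x\<in>carrier G. (\<forall>a\<in>carrier P. l (x \<otimes> \<iota> a) = l x)
      \<and> (\<forall>i\<in>I. l (x \<otimes> t i) = l x + k i (act (inv x) ys)))" by blast
  from choice[OF this] obtain L
    where L1: "\<And>ys x a. set ys \<subseteq> carrier G \<Longrightarrow> x \<in> carrier G \<Longrightarrow> a \<in> carrier P \<Longrightarrow> L ys (x \<otimes> \<iota> a) = L ys x"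
      and L2: "\<And>ys x i. set ys \<subseteq> carrier G \<Longrightarrow> x \<in> carrier G \<Longrightarrow> i \<in> I \<Longrightarrow> L ys (x \<otimes> t i) = L ys x + k i (act (inv x) ys)"
    by blast
  define ll where "ll xs x = (if xs = [] then 0 else L (act (inv (hd xs)) xs) (inv (hd xs) \<otimes> x))" for xs x
  have hd: "hd xs \<in> carrier G" if "set xs \<subseteq> carrier G" "xs \<noteq> []" for xs
    using that by (cases xs) auto
  have ll_P: "ll xs (x \<otimes> \<iota> a) = ll xs x"
    if xs: "set xs \<subseteq> carrier G" and x: "x \<in> carrier G" and a: "a \<in> carrier P" for xs x a
  proof (cases "xs = []")
    case False
    let ?h = "inv (hd xs)"
    have h: "?h \<in> carrier G" using hd[OF xs False] by auto
    have "L (act ?h xs) (?h \<otimes> x \<otimes> \<iota> a) = L (act ?h xs) (?h \<otimes> x)"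
      by (rule L1) (use h xs x a in auto)
    then show ?thesis using False h x a by (simp add: ll_def G.m_assoc)
  qed (simp add: ll_def)
  have ll_t: "ll xs (x \<otimes> t i) = ll xs x + k i (act (inv x) xs)"
    if xs: "set xs \<subseteq> carrier G" and x: "x \<in> carrier G" and i: "i \<in> I" for xs x i
  proof (cases "xs = []")
    case False
    let ?h = "inv (hd xs)"
    have h: "hd xs \<in> carrier G" "?h \<in> carrier G" using hd[OF xs False] by auto
    have "L (act ?h xs) (?h \<otimes> x \<otimes> t i) = L (act ?h xs) (?h \<otimes> x) + k i (act (inv (?h \<otimes> x)) (act ?h xs))"
      by (rule L2) (use h xs x i in auto)
    moreover have "act (inv (?h \<otimes> x)) (act ?h xs) = act (inv x) xs"
      using h xs x by (subst act_act) (simp_all add: G.inv_mult_group G.m_assoc)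
    ultimately have "L (act ?h xs) (?h \<otimes> x \<otimes> t i) = L (act ?h xs) (?h \<otimes> x) + k i (act (inv x) xs)"
      by (simp only:)
    then show ?thesis using False h x t_closed[OF i] by (simp add: ll_def G.m_assoc)
  qed (simp add: ll_def k0)
  have ll_act: "ll (act g xs) (g \<otimes> x) = ll xs x" if xs: "set xs \<subseteq> carrier G" and x: "x \<in> carrier G" and g: "g \<in> carrier G" for g xs x
  proof (cases "xs = []")
    case False
    have h: "hd xs \<in> carrier G" using hd[OF xs False] .
    have e: "inv (g \<otimes> hd xs) \<otimes> g = inv (hd xs)" using h g by (simp add: G.inv_mult_group G.m_assoc)
    have "act (inv (g \<otimes> hd xs)) (act g xs) = act (inv (hd xs)) xs"
      using h g xs by (subst act_act) (simp_all add: e)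
    moreover have "inv (g \<otimes> hd xs) \<otimes> (g \<otimes> x) = inv (hd xs) \<otimes> x"
      using e h g x by (simp add: G.m_assoc[symmetric])
    ultimately have "L (act (inv (g \<otimes> hd xs)) (act g xs)) (inv (g \<otimes> hd xs) \<otimes> (g \<otimes> x))
        = L (act (inv (hd xs)) xs) (inv (hd xs) \<otimes> x)" by (simp only:)
    then show ?thesis using False by (simp add: ll_def hd_map del: map_map)
  qed (simp add: ll_def)
  \<comment> \<open>\<open>E x\<close> is a translate of A corrected by the lift. By
    \<open>E_P\<close> and \<open>E_t\<close> it does not change modulo m when x is multiplied by a
    generator, so every \<open>E x\<close> agrees with \<open>E \<one>\<close>. By
    \<open>E_act\<close> the value of \<open>E g\<close> on a list translated by g is that of
    \<open>E \<one>\<close> on the list. Together these give the invariance of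
    \<open>E \<one>\<close> modulo m.\<close>
  define E where "E x xs = A (act (inv x) xs) - hD (\<lambda>l. ll l x) xs" for x xs
  have E_P: "E (x \<otimes> \<iota> a) xs = E x xs" if "set xs \<subseteq> carrier G" "x \<in> carrier G" "a \<in> carrier P" for x a xs
  proof -
    have "act (inv (x \<otimes> \<iota> a)) xs = act (\<iota> (inv\<^bsub>P\<^esub> a)) (act (inv x) xs)"
      using that by (subst act_act) (simp_all add: G.inv_mult_group)
    then have "A (act (inv (x \<otimes> \<iota> a)) xs) = A (act (inv x) xs)"
      using A[of "inv\<^bsub>P\<^esub> a" "act (inv x) xs"] that act_closed[of "inv x" xs] by (simp del: map_map)
    moreover have "[hD (\<lambda>l. ll l (x \<otimes> \<iota> a)) xs = hD (\<lambda>l. ll l x) xs] (mod 0)"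
      by (rule hD_cong[where A = "carrier G"]) (use that in \<open>auto simp: ll_P\<close>)
    ultimately show ?thesis by (simp add: E_def)
  qed
  have E_t: "[E (x \<otimes> t i) xs = E x xs] (mod m)" if xs: "set xs \<subseteq> carrier G" and x: "x \<in> carrier G" and i: "i \<in> I" for x i xs
  proof -
    let ?ys = "act (inv x) xs"
    have ys: "set ?ys \<subseteq> carrier G" using x xs by (simp add: act_closed del: set_map)
    have "act (inv (x \<otimes> t i)) xs = act (inv (t i)) ?ys"
      using x xs t_closed[OF i] by (subst act_act) (simp_all add: G.inv_mult_group)
    then have 1: "[A (act (inv (x \<otimes> t i)) xs) = A ?ys + hD (k i) ?ys] (mod m)"
      using rel[OF i ys] by (simp only:)
    have "[hD (\<lambda>l. ll l (x \<otimes> t i)) xs = hD (\<lambda>l. ll l x + k i (act (inv x) l)) xs] (mod 0)"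
      by (rule hD_cong[where A = "carrier G"]) (use x i xs in \<open>auto simp: ll_t\<close>)
    then have "hD (\<lambda>l. ll l (x \<otimes> t i)) xs = hD (\<lambda>l. ll l x) xs + hD (k i) ?ys"
      by (simp add: hD_add hD_map)
    then show ?thesis using cong_diff[OF 1 cong_refl[of "hD (\<lambda>l. ll l (x \<otimes> t i)) xs"]]
      by (simp add: E_def)
  qed
  let ?S = "{x \<in> carrier G. \<forall>xs. set xs \<subseteq> carrier G \<longrightarrow> [E x xs = E \<one> xs] (mod m)}"
  have "carrier G \<subseteq> ?S"
  proof (rule gen)
    show "x \<otimes> \<iota> a \<in> ?S" if "x \<in> carrier G" "x \<in> ?S" "a \<in> carrier P" for x a
      using that by (auto simp: E_P)
    show "x \<otimes> t i \<in> ?S" if "x \<in> carrier G" "x \<in> ?S" "i \<in> I" for x i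
      using that t_closed by (auto intro: cong_trans[OF E_t])
    show "x \<otimes> inv (t i) \<in> ?S" if x: "x \<in> carrier G" "x \<in> ?S" and i: "i \<in> I" for x i
    proof -
      have "[E (x \<otimes> inv (t i)) xs = E \<one> xs] (mod m)" if xs: "set xs \<subseteq> carrier G" for xs
      proof -
        have "x \<otimes> inv (t i) \<otimes> t i = x" using x t_closed[OF i] by (simp add: G.m_assoc)
        then have "[E x xs = E (x \<otimes> inv (t i)) xs] (mod m)"
          using E_t[OF xs _ i, of "x \<otimes> inv (t i)"] x t_closed[OF i] by simp
        from cong_trans[OF cong_sym[OF this]] show ?thesis using x(2) xs by blast
      qed
      then show ?thesis using x t_closed[OF i] by auto
    qed
  qed auto
  then have E_one: "[E x xs = E \<one> xs] (mod m)" if "x \<in> carrier G" "set xs \<subseteq> carrier G" for x xs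
    using that by blast
  have E_act: "E g (act g xs) = E \<one> xs" if xs: "set xs \<subseteq> carrier G" and g: "g \<in> carrier G" for g xs
  proof -
    have "act (inv g) (act g xs) = act \<one> xs" using xs g by (subst act_act) simp_all
    moreover have "[hD (\<lambda>l. ll (act g l) g) xs = hD (\<lambda>l. ll l \<one>) xs] (mod 0)"
      by (rule hD_cong[where A = "carrier G"]) (use ll_act[of _ \<one> g] g xs in auto)
    ultimately show ?thesis by (simp add: E_def hD_map del: map_map)
  qed
  show thesis
  proof (rule that[of "\<lambda>l. ll l \<one>"])
    fix a xs assume a: "a \<in> carrier P" and xs: "set xs \<subseteq> carrier G"
    have "ll (act (\<iota> a) xs) \<one> = ll (act (\<iota> a) xs) (\<iota> a \<otimes> \<iota> (inv\<^bsub>P\<^esub> a))" using a by simp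
    also have "\<dots> = ll xs (\<iota> (inv\<^bsub>P\<^esub> a))" by (rule ll_act) (use a xs in auto)
    also have "\<dots> = ll xs \<one>" using ll_P[OF xs, of \<one> "inv\<^bsub>P\<^esub> a"] a by simp
    finally show "ll (act (\<iota> a) xs) \<one> = ll xs \<one>" .
  next
    show "linvariant m G (\<lambda>xs. A xs - hD (\<lambda>l. ll l \<one>) xs)"
      unfolding linvariant_def
    proof (intro ballI allI impI)
      fix g xs assume g: "g \<in> carrier G" and xs: "set xs \<subseteq> carrier G"
      have *: "A ys - hD (\<lambda>l. ll l \<one>) ys = E \<one> ys" if "set ys \<subseteq> carrier G" for ys
        using act_one[OF that] by (simp add: E_def)
      have "[E \<one> (act g xs) = E g (act g xs)] (mod m)"
        by (rule cong_sym, rule E_one) (use g xs in auto)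
      then show "[A (act g xs) - hD (\<lambda>l. ll l \<one>) (act g xs) = A xs - hD (\<lambda>l. ll l \<one>) xs] (mod m)"
        using *[OF xs] *[OF act_closed[OF g xs]] E_act[OF xs g] by simp
    qed
  qed (simp add: ll_def)
qed

end

section \<open>Extension of stable classes and the kernel of restriction\<close>

context stable_letters
begin

text \<open>The pullback of f along a P-equivariant retraction \<rho> is P-invariant on G. Its
  translate by a stable letter is compared with it by passing through \<open>Q i\<close>, where the
  stability of f applies; this takes a second retraction, of G onto \<open>Q i\<close>.\<close>

lemma extend_cocycle:
  assumes f: "cocyc m P f"
    and st: "\<And>i. i \<in> I \<Longrightarrow> cohom m (P\<lparr>carrier := Q i\<rparr>) (\<lambda>l. f (map (\<phi> i) l)) f"
  obtains F where "cocyc m G F" "cohom m P (\<lambda>l. F (map \<iota> l)) f"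
proof -
  obtain \<rho> where \<rho>: "\<And>g. g \<in> carrier G \<Longrightarrow> \<rho> g \<in> carrier P"
    "\<And>a g. a \<in> carrier P \<Longrightarrow> g \<in> carrier G \<Longrightarrow> \<rho> (\<iota> a \<otimes> g) = a \<otimes>\<^bsub>P\<^esub> \<rho> g" "\<rho> \<one> = \<one>\<^bsub>P\<^esub>"
    using coset_retraction[OF G.group_axioms P.group_axioms \<iota>_hom \<iota>_inj] by blast
  have \<rho>_\<iota>: "\<rho> (\<iota> a) = a" if "a \<in> carrier P" for a
    using \<rho>(2)[of a \<one>] \<rho>(3) that by simp
  have "\<exists>\<tau>. (\<forall>g\<in>carrier G. \<tau> g \<in> Q i) \<and> (\<forall>q\<in>Q i. \<forall>g\<in>carrier G. \<tau> (\<iota> q \<otimes> g) = q \<otimes>\<^bsub>P\<^esub> \<tau> g)" if i: "i \<in> I" for i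
  proof -
    have 1: "group (P\<lparr>carrier := Q i\<rparr>)" by (rule subgroup.subgroup_is_group[OF Q_sub[OF i] P.group_axioms])
    have 2: "\<iota> \<in> hom (P\<lparr>carrier := Q i\<rparr>) G" using Q_carrier[OF i] by (auto simp: hom_def)
    have 3: "inj_on \<iota> (carrier (P\<lparr>carrier := Q i\<rparr>))"
      using \<iota>_inj by (rule inj_on_subset) (use Q_carrier[OF i] in auto)
    obtain \<tau> where "\<And>g. g \<in> carrier G \<Longrightarrow> \<tau> g \<in> carrier (P\<lparr>carrier := Q i\<rparr>)"
      "\<And>h g. h \<in> carrier (P\<lparr>carrier := Q i\<rparr>) \<Longrightarrow> g \<in> carrier G \<Longrightarrow> \<tau> (\<iota> h \<otimes> g) = h \<otimes>\<^bsub>P\<lparr>carrier := Q i\<rparr>\<^esub> \<tau> g"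
      "\<tau> \<one> = \<one>\<^bsub>P\<lparr>carrier := Q i\<rparr>\<^esub>"
      using coset_retraction[OF G.group_axioms 1 2 3] by blast
    then show ?thesis by (intro exI[of _ \<tau>]) simp
  qed
  then have "\<forall>i. \<exists>\<tau>. i \<in> I \<longrightarrow> (\<forall>g\<in>carrier G. \<tau> g \<in> Q i) \<and> (\<forall>q\<in>Q i. \<forall>g\<in>carrier G. \<tau> (\<iota> q \<otimes> g) = q \<otimes>\<^bsub>P\<^esub> \<tau> g)"
    by blast
  from choice[OF this] obtain \<tau> where \<tau>: "\<And>i g. i \<in> I \<Longrightarrow> g \<in> carrier G \<Longrightarrow> \<tau> i g \<in> Q i"
    "\<And>i q g. i \<in> I \<Longrightarrow> q \<in> Q i \<Longrightarrow> g \<in> carrier G \<Longrightarrow> \<tau> i (\<iota> q \<otimes> g) = q \<otimes>\<^bsub>P\<^esub> \<tau> i g"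
    by blast
  let ?f = "homog P f"
  have "\<exists>H. H [] = 0 \<and> (\<forall>q\<in>Q i. \<forall>xs. set xs \<subseteq> Q i \<longrightarrow> H (map (\<lambda>x. q \<otimes>\<^bsub>P\<^esub> x) xs) = H xs) \<and>
      (\<forall>xs. set xs \<subseteq> Q i \<longrightarrow> [?f (map (\<phi> i) xs) = ?f xs + hD H xs] (mod m))" if i: "i \<in> I" for i
  proof -
    let ?K = "P\<lparr>carrier := Q i\<rparr>"
    have K: "group ?K" by (rule subgroup.subgroup_is_group[OF Q_sub[OF i] P.group_axioms])
    have id: "(\<lambda>x. x) \<in> hom ?K P" using Q_carrier[OF i] by (auto simp: hom_def)
    obtain H where H: "linvariant 0 ?K H" "H [] = 0"
      "\<And>xs. set xs \<subseteq> carrier ?K \<Longrightarrow> [homog ?K (\<lambda>l. f (map (\<phi> i) l)) xs = homog ?K f xs + hD H xs] (mod m)"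
      using group.cohomE[OF K st[OF i]] by blast
    have "[?f (map (\<phi> i) xs) = ?f xs + hD H xs] (mod m)" if xs: "set xs \<subseteq> Q i" for xs
      using H(3)[of xs] xs homog_hom[OF K P.group_axioms \<phi>_hom[OF i], of xs f]
        homog_hom[OF K P.group_axioms id, of xs f] by simp
    then show ?thesis using H by (auto simp: linvariant_def)
  qed
  then have "\<forall>i. \<exists>H. i \<in> I \<longrightarrow> H [] = 0 \<and> (\<forall>q\<in>Q i. \<forall>xs. set xs \<subseteq> Q i \<longrightarrow> H (map (\<lambda>x. q \<otimes>\<^bsub>P\<^esub> x) xs) = H xs) \<and>
      (\<forall>xs. set xs \<subseteq> Q i \<longrightarrow> [?f (map (\<phi> i) xs) = ?f xs + hD H xs] (mod m))" by blast
  from choice[OF this] obtain H where H: "\<And>i. i \<in> I \<Longrightarrow> H i [] = 0"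
    "\<And>i q xs. i \<in> I \<Longrightarrow> q \<in> Q i \<Longrightarrow> set xs \<subseteq> Q i \<Longrightarrow> H i (map (\<lambda>x. q \<otimes>\<^bsub>P\<^esub> x) xs) = H i xs"
    "\<And>i xs. i \<in> I \<Longrightarrow> set xs \<subseteq> Q i \<Longrightarrow> [?f (map (\<phi> i) xs) = ?f xs + hD (H i) xs] (mod m)"
    by blast
  define k where "k i xs = (if xs = [] then 0 else
    prism (\<lambda>x. \<phi> i (\<tau> i x)) (\<lambda>x. \<rho> (inv (t i) \<otimes> x)) ?f xs + H i (map (\<tau> i) xs) - prism (\<tau> i) \<rho> ?f xs)" for i xs
  have fun_\<rho>: "\<rho> \<in> carrier G \<rightarrow> carrier P" using \<rho> by auto
  have fun_\<rho>': "(\<lambda>x. \<rho> (inv (t i) \<otimes> x)) \<in> carrier G \<rightarrow> carrier P" if "i \<in> I" for i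
    using \<rho> t_closed[OF that] by auto
  have fun_\<tau>: "\<tau> i \<in> carrier G \<rightarrow> carrier P" if "i \<in> I" for i
    using \<tau>(1)[OF that] Q_carrier[OF that] by auto
  have fun_\<phi>\<tau>: "(\<lambda>x. \<phi> i (\<tau> i x)) \<in> carrier G \<rightarrow> carrier P" if "i \<in> I" for i
    using \<tau>(1)[OF that] \<phi>_closed[OF that] by auto
  have Df: "[hD ?f ys = 0] (mod m)" if "set ys \<subseteq> carrier P" for ys
    using f that by (simp add: P.cocyc_homog)
  have \<phi>_mult: "\<phi> i (q \<otimes>\<^bsub>P\<^esub> r) = \<phi> i q \<otimes>\<^bsub>P\<^esub> \<phi> i r" if "i \<in> I" "q \<in> Q i" "r \<in> Q i" for i q r
    using hom_mult[OF \<phi>_hom[OF that(1)]] that by simp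
  obtain l where l: "l [] = 0" "\<And>a xs. a \<in> carrier P \<Longrightarrow> set xs \<subseteq> carrier G \<Longrightarrow> l (act (\<iota> a) xs) = l xs"
    "linvariant m G (\<lambda>xs. ?f (map \<rho> xs) - hD l xs)"
  proof (rule descent[of "\<lambda>xs. ?f (map \<rho> xs)" k m])
    fix a xs assume a: "a \<in> carrier P" and xs: "set xs \<subseteq> carrier G"
    have e: "map \<rho> (act (\<iota> a) xs) = map (\<lambda>x. a \<otimes>\<^bsub>P\<^esub> x) (map \<rho> xs)" using \<rho> a xs by auto
    show "?f (map \<rho> (act (\<iota> a) xs)) = ?f (map \<rho> xs)"
      unfolding e by (rule P.homog_map) (use \<rho> a xs in auto)
  next
    fix i q xs assume i: "i \<in> I" and q: "q \<in> Q i" and xs: "set xs \<subseteq> carrier G"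
    note c = t_closed[OF i] Q_carrier[OF i q] \<phi>_closed[OF i q]
    have \<rho>': "\<rho> (inv (t i) \<otimes> (\<iota> q \<otimes> x)) = \<phi> i q \<otimes>\<^bsub>P\<^esub> \<rho> (inv (t i) \<otimes> x)" if x: "x \<in> carrier G" for x
    proof -
      have "inv (t i) \<otimes> (\<iota> q \<otimes> x) = \<iota> (\<phi> i q) \<otimes> (inv (t i) \<otimes> x)"
        using t_inv_conj[OF i q] c x by (simp flip: G.m_assoc)
      then show ?thesis using \<rho>(2) c x by simp
    qed
    have "prism (\<lambda>x. \<phi> i (\<tau> i x)) (\<lambda>x. \<rho> (inv (t i) \<otimes> x)) ?f (act (\<iota> q) xs)
        = prism (\<lambda>x. \<phi> i (\<tau> i x)) (\<lambda>x. \<rho> (inv (t i) \<otimes> x)) ?f xs"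
      by (rule prism_invariant[OF xs fun_\<phi>\<tau>[OF i] fun_\<rho>'[OF i], where \<psi> = "\<lambda>y. \<phi> i q \<otimes>\<^bsub>P\<^esub> y"])
        (use \<rho>' \<tau> \<phi>_mult i q c in \<open>auto simp: P.homog_map\<close>)
    moreover have "prism (\<tau> i) \<rho> ?f (act (\<iota> q) xs) = prism (\<tau> i) \<rho> ?f xs"
      by (rule prism_invariant[OF xs fun_\<tau>[OF i] fun_\<rho>, where \<psi> = "\<lambda>y. q \<otimes>\<^bsub>P\<^esub> y"])
        (use \<tau> \<rho> i q c in \<open>auto simp: P.homog_map\<close>)
    moreover have "H i (map (\<tau> i) (act (\<iota> q) xs)) = H i (map (\<tau> i) xs)"
    proof -
      have e: "map (\<tau> i) (act (\<iota> q) xs) = map (\<lambda>y. q \<otimes>\<^bsub>P\<^esub> y) (map (\<tau> i) xs)" using \<tau>(2)[OF i q] xs by auto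
      show ?thesis unfolding e by (rule H(2)[OF i q]) (use \<tau>(1)[OF i] xs in auto)
    qed
    ultimately show "k i (act (\<iota> q) xs) = k i xs" by (simp add: k_def)
  next
    fix i xs assume i: "i \<in> I" and xs: "set xs \<subseteq> carrier G"
    let ?p = "prism (\<lambda>x. \<phi> i (\<tau> i x)) (\<lambda>x. \<rho> (inv (t i) \<otimes> x)) ?f" and ?p' = "prism (\<tau> i) \<rho> ?f"
    let ?ys = "map (\<tau> i) xs"
    have ys: "set ?ys \<subseteq> Q i" using \<tau>(1)[OF i] xs by auto
    have "k i = (\<lambda>xs. ?p xs + H i (map (\<tau> i) xs) - ?p' xs)"
      using H(1)[OF i] by (auto simp: k_def)
    then have Dk: "hD (k i) xs = hD ?p xs + hD (H i) ?ys - hD ?p' xs"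
      by (simp add: hD_add hD_diff hD_map)
    have p: "[hD ?p xs = ?f (map (\<lambda>x. \<rho> (inv (t i) \<otimes> x)) xs) - ?f (map (\<lambda>x. \<phi> i (\<tau> i x)) xs)] (mod m)"
      by (rule hD_prism_cong[OF Df xs fun_\<phi>\<tau>[OF i] fun_\<rho>'[OF i]])
    have p': "[hD ?p' xs = ?f (map \<rho> xs) - ?f ?ys] (mod m)"
      by (rule hD_prism_cong[OF Df xs fun_\<tau>[OF i] fun_\<rho>])
    have h: "[hD (H i) ?ys = ?f (map (\<phi> i) ?ys) - ?f ?ys] (mod m)"
      using cong_diff[OF H(3)[OF i ys] cong_refl[of "?f ?ys" m]] by (simp add: cong_sym)
    have "[?f (map \<rho> xs) + hD (k i) xs
      = ?f (map \<rho> xs) + ((?f (map (\<lambda>x. \<rho> (inv (t i) \<otimes> x)) xs) - ?f (map (\<lambda>x. \<phi> i (\<tau> i x)) xs))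
        + (?f (map (\<phi> i) ?ys) - ?f ?ys) - (?f (map \<rho> xs) - ?f ?ys))] (mod m)"
      unfolding Dk by (intro cong_add cong_diff cong_refl p p' h)
    also have "?f (map \<rho> xs) + ((?f (map (\<lambda>x. \<rho> (inv (t i) \<otimes> x)) xs) - ?f (map (\<lambda>x. \<phi> i (\<tau> i x)) xs))
        + (?f (map (\<phi> i) ?ys) - ?f ?ys) - (?f (map \<rho> xs) - ?f ?ys)) = ?f (map \<rho> (act (inv (t i)) xs))"
      by (simp add: comp_def)
    finally show "[?f (map \<rho> (act (inv (t i)) xs)) = ?f (map \<rho> xs) + hD (k i) xs] (mod m)"
      by (rule cong_sym)
  qed (auto simp: k_def)
  \<comment> \<open>Subtracting \<open>hD l\<close> gives invariance under G modulo m. It does not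
    affect the cocycle condition, and on P it only changes f by the coboundary of an invariant
    cochain.\<close>
  let ?F = "\<lambda>xs. ?f (map \<rho> xs) - hD l xs"
  have DF: "[hD ?F xs = 0] (mod m)" if xs: "set xs \<subseteq> carrier G" for xs
  proof -
    have "hD ?F xs = hD ?f (map \<rho> xs)" by (simp add: hD_diff hD_hD flip: hD_map)
    then show ?thesis using Df[of "map \<rho> xs"] \<rho> xs by auto
  qed
  show thesis
  proof (rule that)
    show "cocyc m G (dehomog G ?F)" by (rule G.cocyc_dehomog[OF l(3) _ DF]) simp_all
    show "cohom m P (\<lambda>xs. dehomog G ?F (map \<iota> xs)) f"
    proof (rule P.cohomI)
      show "linvariant m P (\<lambda>xs. - l (map \<iota> xs))"
        unfolding linvariant_def
      proof (intro ballI allI impI)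
        fix a xs assume a: "a \<in> carrier P" and xs: "set xs \<subseteq> carrier P"
        have e: "map \<iota> (map (\<lambda>x. a \<otimes>\<^bsub>P\<^esub> x) xs) = act (\<iota> a) (map \<iota> xs)" using a xs by auto
        have "l (map \<iota> (map (\<lambda>x. a \<otimes>\<^bsub>P\<^esub> x) xs)) = l (map \<iota> xs)"
          unfolding e by (rule l(2)[OF a]) (use xs in auto)
        then show "[- l (map \<iota> (map (\<lambda>x. a \<otimes>\<^bsub>P\<^esub> x) xs)) = - l (map \<iota> xs)] (mod m)" by simp
      qed
      fix xs assume xs: "set xs \<subseteq> carrier P"
      then have ixs: "set (map \<iota> xs) \<subseteq> carrier G" by auto
      have "homog P (\<lambda>xs. dehomog G ?F (map \<iota> xs)) xs = homog G (dehomog G ?F) (map \<iota> xs)"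
        by (rule homog_hom[OF P.group_axioms G.group_axioms \<iota>_hom xs])
      also have "[\<dots> = ?F (map \<iota> xs)] (mod m)"
        by (rule G.homog_dehomog[OF l(3) _ ixs]) simp
      also have "?F (map \<iota> xs) = ?f xs + hD (\<lambda>xs. - l (map \<iota> xs)) xs"
      proof -
        have "map \<rho> (map \<iota> xs) = xs" using xs \<rho>_\<iota> by (induction xs) auto
        then show ?thesis by (simp add: hD_minus hD_map del: map_map)
      qed
      finally show "[homog P (\<lambda>xs. dehomog G ?F (map \<iota> xs)) xs = ?f xs + hD (\<lambda>xs. - l (map \<iota> xs)) xs] (mod m)" .
    qed (simp add: l(1))
  qed
qed

text \<open>G is a free P-set, so the P-invariant cochains on G compute the cohomology of P: the
  prism from the identity to \<iota> after \<rho> is P-invariant and moves the cocycle into the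
  image of P, where a primitive exists by hypothesis.\<close>

lemma primitive:
  assumes f: "cocyc m G f" and z: "cohom m P (\<lambda>l. f (map \<iota> l)) (\<lambda>_. 0)"
  obtains l where "l [] = 0" "\<And>a xs. a \<in> carrier P \<Longrightarrow> set xs \<subseteq> carrier G \<Longrightarrow> l (act (\<iota> a) xs) = l xs"
    "\<And>xs. set xs \<subseteq> carrier G \<Longrightarrow> [hD l xs = homog G f xs] (mod m)"
proof -
  obtain \<rho> where \<rho>: "\<And>g. g \<in> carrier G \<Longrightarrow> \<rho> g \<in> carrier P"
    "\<And>a g. a \<in> carrier P \<Longrightarrow> g \<in> carrier G \<Longrightarrow> \<rho> (\<iota> a \<otimes> g) = a \<otimes>\<^bsub>P\<^esub> \<rho> g" "\<rho> \<one> = \<one>\<^bsub>P\<^esub>"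
    using coset_retraction[OF G.group_axioms P.group_axioms \<iota>_hom \<iota>_inj] by blast
  obtain b where b: "linvariant 0 P b" "b [] = 0"
    "\<And>xs. set xs \<subseteq> carrier P \<Longrightarrow> [homog P (\<lambda>l. f (map \<iota> l)) xs = homog P (\<lambda>_. 0) xs + hD b xs] (mod m)"
    using P.cohomE[OF z] by blast
  let ?F = "homog G f"
  let ?p = "prism (\<lambda>x. x) (\<lambda>x. \<iota> (\<rho> x)) ?F"
  have fun_id: "(\<lambda>x. x) \<in> carrier G \<rightarrow> carrier G" and fun_\<rho>: "(\<lambda>x. \<iota> (\<rho> x)) \<in> carrier G \<rightarrow> carrier G"
    using \<rho> by auto
  show thesis
  proof (rule that[of "\<lambda>xs. b (map \<rho> xs) - ?p xs"])
    fix a xs assume a: "a \<in> carrier P" and xs: "set xs \<subseteq> carrier G"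
    have e: "map \<rho> (act (\<iota> a) xs) = map (\<lambda>x. a \<otimes>\<^bsub>P\<^esub> x) (map \<rho> xs)" using \<rho> a xs by auto
    have "set (map \<rho> xs) \<subseteq> carrier P" using \<rho> xs by auto
    then have "b (map \<rho> (act (\<iota> a) xs)) = b (map \<rho> xs)"
      unfolding e using b(1) a by (simp add: linvariant_def del: map_map)
    moreover have "?p (act (\<iota> a) xs) = ?p xs"
      by (rule prism_invariant[OF xs fun_id fun_\<rho>, where \<psi> = "\<lambda>y. \<iota> a \<otimes> y"])
        (use \<rho> a in \<open>auto simp: G.homog_map\<close>)
    ultimately show "b (map \<rho> (act (\<iota> a) xs)) - ?p (act (\<iota> a) xs) = b (map \<rho> xs) - ?p xs" by simp
  next
    fix xs assume xs: "set xs \<subseteq> carrier G"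
    have rxs: "set (map \<rho> xs) \<subseteq> carrier P" using \<rho> xs by auto
    have "[hD b (map \<rho> xs) = ?F (map \<iota> (map \<rho> xs))] (mod m)"
      using b(3)[OF rxs] homog_hom[OF P.group_axioms G.group_axioms \<iota>_hom rxs, of f]
      by (simp add: homog_def[of P "\<lambda>_. 0"] cong_sym)
    moreover have "[hD ?p xs = ?F (map (\<lambda>x. \<iota> (\<rho> x)) xs) - ?F (map (\<lambda>x. x) xs)] (mod m)"
      by (rule hD_prism_cong[OF _ xs fun_id fun_\<rho>]) (use f in \<open>simp add: G.cocyc_homog\<close>)
    ultimately have "[hD b (map \<rho> xs) - hD ?p xs
        = ?F (map \<iota> (map \<rho> xs)) - (?F (map (\<lambda>x. \<iota> (\<rho> x)) xs) - ?F (map (\<lambda>x. x) xs))] (mod m)"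
      by (rule cong_diff)
    then show "[hD (\<lambda>xs. b (map \<rho> xs) - ?p xs) xs = ?F xs] (mod m)"
      by (simp add: hD_diff hD_map comp_def)
  qed (simp add: b(2))
qed

text \<open>Let l and n be P-invariant primitives of f and g. The translate of l \<union> g by a
  stable letter differs from it by \<open>u i\<close> \<union> g. Since \<open>u i\<close> is a
  cocycle modulo m, this is the coboundary of \<open>u i\<close> \<union> n up to the sign of the
  first factor. One application of \<open>descent\<close> therefore makes the primitive l \<union> g
  of f \<union> g invariant under G.\<close>

lemma cup_kernel:
  assumes f: "cocyc m G f" and g: "cocyc m G g"
    and zf: "cohom m P (\<lambda>l. f (map \<iota> l)) (\<lambda>_. 0)" and zg: "cohom m P (\<lambda>l. g (map \<iota> l)) (\<lambda>_. 0)"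
  shows "cohom m G (cup f g) (\<lambda>_. 0)"
proof -
  obtain l where l: "l [] = 0" "\<And>a xs. a \<in> carrier P \<Longrightarrow> set xs \<subseteq> carrier G \<Longrightarrow> l (act (\<iota> a) xs) = l xs"
    "\<And>xs. set xs \<subseteq> carrier G \<Longrightarrow> [hD l xs = homog G f xs] (mod m)"
    using primitive[OF f zf] by blast
  obtain n where n: "n [] = 0" "\<And>a xs. a \<in> carrier P \<Longrightarrow> set xs \<subseteq> carrier G \<Longrightarrow> n (act (\<iota> a) xs) = n xs"
    "\<And>xs. set xs \<subseteq> carrier G \<Longrightarrow> [hD n xs = homog G g xs] (mod m)"
    using primitive[OF g zg] by blast
  let ?F = "homog G f" and ?H = "homog G g"
  let ?A = "hcup l ?H"
  define u where "u i xs = l (act (inv (t i)) xs) - l xs" for i xs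
  define k where "k i = hcup (signed (u i)) n" for i
  have hcup_eq: "hcup c d xs = hcup c' d' xs"
    if "set xs \<subseteq> carrier G" "\<And>ys. set ys \<subseteq> carrier G \<Longrightarrow> c ys = c' ys" "\<And>ys. set ys \<subseteq> carrier G \<Longrightarrow> d ys = d' ys"
    for c d c' d' :: "'g list \<Rightarrow> int" and xs
    using hcup_cong[of "carrier G" c c' 0 d d' xs] that by simp
  \<comment> \<open>Both l and its translate are primitives modulo m of the same cochain, because
    the homogeneous form of f is invariant under all of G.\<close>
  have Du: "[hD (u i) xs = 0] (mod m)" if i: "i \<in> I" and xs: "set xs \<subseteq> carrier G" for i xs
  proof -
    have t: "inv (t i) \<in> carrier G" using t_closed[OF i] by simp
    have "hD (u i) xs = hD l (act (inv (t i)) xs) - hD l xs" by (simp add: u_def[abs_def] hD_diff hD_map)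
    also have "[\<dots> = ?F (act (inv (t i)) xs) - ?F xs] (mod m)"
      by (intro cong_diff l act_closed t xs)
    finally show ?thesis using G.homog_map[OF t xs] by simp
  qed
  obtain z where z: "z [] = 0" "linvariant m G (\<lambda>xs. ?A xs - hD z xs)"
  proof (rule descent[of ?A k m])
    fix a xs assume a: "a \<in> carrier P" and xs: "set xs \<subseteq> carrier G"
    show "?A (act (\<iota> a) xs) = ?A xs"
      unfolding hcup_map by (rule hcup_eq[OF xs]) (use l(2) a in \<open>auto simp: G.homog_map\<close>)
  next
    fix i q xs assume i: "i \<in> I" and q: "q \<in> Q i" and xs: "set xs \<subseteq> carrier G"
    note c = t_closed[OF i] Q_carrier[OF i q] \<phi>_closed[OF i q]
    have "u i (act (\<iota> q) ys) = u i ys" if ys: "set ys \<subseteq> carrier G" for ys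
    proof -
      have "act (inv (t i)) (act (\<iota> q) ys) = act (\<iota> (\<phi> i q)) (act (inv (t i)) ys)"
        using c ys by (subst (1 2) act_act) (simp_all add: t_inv_conj[OF i q])
      moreover have "l (act (\<iota> (\<phi> i q)) (act (inv (t i)) ys)) = l (act (inv (t i)) ys)"
        by (intro l(2) act_closed) (use c ys in auto)
      ultimately show ?thesis using l(2)[of q ys] c ys by (simp add: u_def del: map_map)
    qed
    then show "k i (act (\<iota> q) xs) = k i xs"
      unfolding k_def hcup_map by (intro hcup_eq xs) (use n(2) c in \<open>auto simp: signed_def\<close>)
  next
    fix i xs assume i: "i \<in> I" and xs: "set xs \<subseteq> carrier G"
    have t: "inv (t i) \<in> carrier G" using t_closed[OF i] by simp
    have "hD (k i) xs = hcup (hD (signed (u i))) n xs + hcup (u i) (hD n) xs"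
      unfolding k_def hD_hcup[where d = n, OF n(1)] signed_signed using l(1) by (simp add: signed_def u_def)
    also have "[\<dots> = hcup (\<lambda>_. 0) n xs + hcup (u i) ?H xs] (mod m)"
    proof (intro cong_add hcup_cong[where A = "carrier G", OF _ _ xs] cong_refl n(3))
      fix ys assume "set ys \<subseteq> carrier G"
      from Du[OF i this] show "[hD (signed (u i)) ys = 0] (mod m)"
        unfolding hD_signed signed_def by (simp add: cong_0_iff)
    qed
    finally have Dk: "[hcup (u i) ?H xs = hD (k i) xs] (mod m)" by (simp add: cong_sym)
    have "?A (act (inv (t i)) xs) = hcup (\<lambda>ys. l ys + u i ys) ?H xs"
      unfolding hcup_map by (rule hcup_eq[OF xs]) (use t in \<open>auto simp: u_def G.homog_map\<close>)
    also have "\<dots> = ?A xs + hcup (u i) ?H xs" by (rule hcup_add1)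
    also have "[\<dots> = ?A xs + hD (k i) xs] (mod m)" by (intro cong_add cong_refl Dk)
    finally show "[?A (act (inv (t i)) xs) = ?A xs + hD (k i) xs] (mod m)" .
  qed (auto simp: k_def)
  show ?thesis
  proof (rule G.cohomI[OF z(2)])
    fix xs assume xs: "set xs \<subseteq> carrier G"
    have "homog G (cup f g) xs = hcup ?F ?H xs + hcup (signed l) (\<lambda>_. 0) xs" by (simp add: homog_cup)
    also have "[\<dots> = hcup (hD l) ?H xs + hcup (signed l) (hD ?H) xs] (mod m)"
      by (intro cong_add hcup_cong[where A = "carrier G", OF _ _ xs] cong_refl cong_sym[OF l(3)])
        (use g in \<open>auto simp: G.cocyc_homog intro: cong_sym\<close>)
    also have "hcup (hD l) ?H xs + hcup (signed l) (hD ?H) xs = hD (\<lambda>xs. ?A xs - hD z xs) xs"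
      by (simp add: hD_diff hD_hD hD_hcup l(1))
    finally show "[homog G (cup f g) xs = homog G (\<lambda>_. 0) xs + hD (\<lambda>xs. ?A xs - hD z xs) xs] (mod m)"
      by (simp add: homog_def[of G "\<lambda>_. 0"])
  qed simp
qed

end

section \<open>Multiple HNN extensions by presentation\<close>

datatype ('a, 'i) letter = El 'a | Up 'i | Dn 'i

primrec run :: "('h, 'd) monoid_scheme \<Rightarrow> ('s \<Rightarrow> 'l \<Rightarrow> 's) \<Rightarrow> ('l \<Rightarrow> 's \<Rightarrow> 'h) \<Rightarrow> 'l list \<Rightarrow> 's \<Rightarrow> 'h" where
  "run H step out [] s = \<one>\<^bsub>H\<^esub>"
| "run H step out (x # w) s = out x s \<otimes>\<^bsub>H\<^esub> run H step out w (step s x)"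

locale presentation = P: group P
  for P :: "('a, 'b) monoid_scheme" (structure) +
  fixes I :: "'i set" and Q :: "'i \<Rightarrow> 'a set" and \<phi> :: "'i \<Rightarrow> 'a \<Rightarrow> 'a"
  assumes Q_sub: "\<And>i. i \<in> I \<Longrightarrow> subgroup (Q i) P"
    and \<phi>_hom: "\<And>i. i \<in> I \<Longrightarrow> \<phi> i \<in> hom (P\<lparr>carrier := Q i\<rparr>) P"
    and countable_P: "countable (carrier P)" and countable_I: "countable I"
begin

lemma Q_carrier: "i \<in> I \<Longrightarrow> q \<in> Q i \<Longrightarrow> q \<in> carrier P"
  using Q_sub subgroup.subset by blast

lemma \<phi>_closed: "i \<in> I \<Longrightarrow> q \<in> Q i \<Longrightarrow> \<phi> i q \<in> carrier P"
  using \<phi>_hom[of i] by (auto simp: hom_def)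

section \<open>The group of words modulo the relations\<close>

inductive base :: "('a, 'i) letter list \<Rightarrow> ('a, 'i) letter list \<Rightarrow> bool" where
  mult: "a \<in> carrier P \<Longrightarrow> b \<in> carrier P \<Longrightarrow> base [El a, El b] [El (a \<otimes> b)]"
| one: "base [El \<one>] []"
| up_dn: "i \<in> I \<Longrightarrow> base [Up i, Dn i] []"
| dn_up: "i \<in> I \<Longrightarrow> base [Dn i, Up i] []"
| conj: "i \<in> I \<Longrightarrow> q \<in> Q i \<Longrightarrow> base [El q, Up i] [Up i, El (\<phi> i q)]"

inductive weq :: "('a, 'i) letter list \<Rightarrow> ('a, 'i) letter list \<Rightarrow> bool" where
  refl: "weq w w"
| step: "base r l \<Longrightarrow> weq (u @ r @ v) (u @ l @ v)"
| sym: "weq w w' \<Longrightarrow> weq w' w"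
| trans: "weq w w' \<Longrightarrow> weq w' w'' \<Longrightarrow> weq w w''"

definition letters :: "('a, 'i) letter set" where
  "letters = El ` carrier P \<union> Up ` I \<union> Dn ` I"

definition wds :: "('a, 'i) letter list set" where
  "wds = lists letters"

text \<open>The group has to live on the natural numbers, so a class of words is coded by the number
  of one of its members in \<open>wds\<close>; this is where countability enters. The predicate
  under \<open>SOME\<close> depends only on the class, hence so does the code.\<close>

definition nf :: "('a, 'i) letter list \<Rightarrow> nat" where
  "nf w = to_nat_on wds (SOME w'. w' \<in> wds \<and> weq w w')"

definition wd :: "nat \<Rightarrow> ('a, 'i) letter list" where
  "wd n = (SOME w. w \<in> wds \<and> nf w = n)"

definition hnn :: "nat monoid" where
  "hnn = \<lparr>carrier = nf ` wds, monoid.mult = (\<lambda>x y. nf (wd x @ wd y)), one = nf []\<rparr>"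

lemma wds_append [simp]: "u @ v \<in> wds \<longleftrightarrow> u \<in> wds \<and> v \<in> wds"
  by (auto simp: wds_def)

lemma wds_Nil [simp]: "[] \<in> wds"
  by (simp add: wds_def)

lemma wds_Cons: "x # w \<in> wds \<longleftrightarrow> x \<in> letters \<and> w \<in> wds"
  by (simp add: wds_def)

lemma countable_wds: "countable wds"
  unfolding wds_def letters_def by (intro countable_lists countable_Un countable_image countable_P countable_I)

lemma weq_context: "weq w w' \<Longrightarrow> weq (u @ w @ v) (u @ w' @ v)"
proof (induction rule: weq.induct)
  case (step r l u' v')
  then show ?case using weq.step[of r l "u @ u'" "v' @ v"] by simp
qed (rule weq.refl, erule weq.sym, erule (1) weq.trans)

lemma weq_append:
  assumes "weq u u'" "weq v v'"
  shows "weq (u @ v) (u' @ v')"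
proof (rule weq.trans)
  show "weq (u @ v) (u' @ v)" using weq_context[OF assms(1), of "[]" v] by simp
  show "weq (u' @ v) (u' @ v')" using weq_context[OF assms(2), of u' "[]"] by simp
qed

lemma nf_eq_iff:
  assumes "w \<in> wds" "w' \<in> wds"
  shows "nf w = nf w' \<longleftrightarrow> weq w w'"
proof
  let ?s = "\<lambda>w. SOME w'. w' \<in> wds \<and> weq w w'"
  have s: "?s w \<in> wds \<and> weq w (?s w)" if "w \<in> wds" for w
    by (rule someI[of "\<lambda>w'. w' \<in> wds \<and> weq w w'" w]) (simp add: that weq.refl)
  assume "nf w = nf w'"
  then have "?s w = ?s w'"
    unfolding nf_def
    using to_nat_on_inj[OF countable_wds conjunct1[OF s[OF assms(1)]] conjunct1[OF s[OF assms(2)]]] by simp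
  then have "weq (?s w) w'" using weq.sym[OF conjunct2[OF s[OF assms(2)]]] by simp
  with conjunct2[OF s[OF assms(1)]] show "weq w w'" by (rule weq.trans)
next
  assume "weq w w'"
  then have "weq w v \<longleftrightarrow> weq w' v" for v
    using weq.trans[of w w' v] weq.trans[of w' w v] weq.sym[of w w'] by blast
  then show "nf w = nf w'" by (simp add: nf_def)
qed

lemma wd: "x \<in> carrier hnn \<Longrightarrow> wd x \<in> wds \<and> nf (wd x) = x"
  unfolding wd_def hnn_def by (rule someI_ex) auto

lemma nf_closed [simp]: "w \<in> wds \<Longrightarrow> nf w \<in> carrier hnn"
  by (simp add: hnn_def)

lemma nf_append:
  assumes "u \<in> wds" "v \<in> wds"
  shows "nf (u @ v) = nf u \<otimes>\<^bsub>hnn\<^esub> nf v"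
proof -
  have w: "wd (nf u) \<in> wds" "wd (nf v) \<in> wds" "nf (wd (nf u)) = nf u" "nf (wd (nf v)) = nf v"
    using wd[of "nf u"] wd[of "nf v"] assms by auto
  then have "weq u (wd (nf u))" "weq v (wd (nf v))"
    using nf_eq_iff[OF assms(1) w(1)] nf_eq_iff[OF assms(2) w(2)] by auto
  then have "weq (u @ v) (wd (nf u) @ wd (nf v))" by (rule weq_append)
  then show ?thesis using nf_eq_iff[of "u @ v" "wd (nf u) @ wd (nf v)"] assms w by (simp add: hnn_def)
qed

lemma nf_Nil: "nf [] = \<one>\<^bsub>hnn\<^esub>"
  by (simp add: hnn_def)

lemma carrierE:
  assumes "x \<in> carrier hnn"
  obtains w where "w \<in> wds" "x = nf w"
  using assms by (auto simp: hnn_def)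

lemma nf_base:
  assumes "base r l" "r \<in> wds" "l \<in> wds"
  shows "nf r = nf l"
  using assms weq.step[of r l "[]" "[]"] by (simp add: nf_eq_iff)

definition emb :: "'a \<Rightarrow> nat" where
  "emb a = nf [El a]"

definition st :: "'i \<Rightarrow> nat" where
  "st i = nf [Up i]"

lemma letters_simps [simp]: "El a \<in> letters \<longleftrightarrow> a \<in> carrier P" "Up i \<in> letters \<longleftrightarrow> i \<in> I" "Dn i \<in> letters \<longleftrightarrow> i \<in> I"
  by (auto simp: letters_def)

lemma group_hnn: "group hnn"
proof (rule groupI)
  fix x y assume "x \<in> carrier hnn" "y \<in> carrier hnn"
  then show "x \<otimes>\<^bsub>hnn\<^esub> y \<in> carrier hnn" by (elim carrierE) (simp flip: nf_append)
next
  fix x y z assume "x \<in> carrier hnn" "y \<in> carrier hnn" "z \<in> carrier hnn"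
  then show "x \<otimes>\<^bsub>hnn\<^esub> y \<otimes>\<^bsub>hnn\<^esub> z = x \<otimes>\<^bsub>hnn\<^esub> (y \<otimes>\<^bsub>hnn\<^esub> z)"
    by (elim carrierE) (simp flip: nf_append)
next
  show "\<one>\<^bsub>hnn\<^esub> \<in> carrier hnn" by (simp flip: nf_Nil)
next
  fix x assume "x \<in> carrier hnn"
  then show "\<one>\<^bsub>hnn\<^esub> \<otimes>\<^bsub>hnn\<^esub> x = x" by (elim carrierE) (simp flip: nf_append nf_Nil)
next
  have letter: "\<exists>v\<in>wds. weq (v @ [x]) []" if "x \<in> letters" for x
  proof (cases x)
    case (El a)
    then have a: "a \<in> carrier P" using that by simp
    have "weq [El (inv a), El a] [El \<one>]"
      using weq.step[OF mult[of "inv a" a], of "[]" "[]"] a by simp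
    then have "weq ([El (inv a)] @ [x]) []"
      using weq.step[OF one, of "[]" "[]"] El by (auto intro: weq.trans)
    then show ?thesis using a by (intro bexI[of _ "[El (inv a)]"]) (simp_all add: wds_Cons)
  next
    case (Up i)
    then show ?thesis using weq.step[OF dn_up[of i], of "[]" "[]"] that
      by (intro bexI[of _ "[Dn i]"]) (simp_all add: wds_Cons)
  next
    case (Dn i)
    then show ?thesis using weq.step[OF up_dn[of i], of "[]" "[]"] that
      by (intro bexI[of _ "[Up i]"]) (simp_all add: wds_Cons)
  qed
  have "\<exists>v\<in>wds. weq (v @ w) []" if "w \<in> wds" for w
    using that
  proof (induction w)
    case (Cons x w)
    then obtain u v where u: "u \<in> wds" "weq (u @ [x]) []" and v: "v \<in> wds" "weq (v @ w) []"
      using letter[of x] by (auto simp: wds_Cons)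
    have "weq (v @ (u @ [x]) @ w) (v @ [] @ w)" by (rule weq_context[OF u(2)])
    then have "weq ((v @ u) @ x # w) []" using v(2) by (auto intro: weq.trans)
    then show ?case using u v by (intro bexI[of _ "v @ u"]) simp_all
  qed (auto intro: weq.refl bexI[of _ "[]"])
  fix x assume "x \<in> carrier hnn"
  then obtain w where w: "w \<in> wds" "x = nf w" by (rule carrierE)
  then obtain v where "v \<in> wds" "weq (v @ w) []" using \<open>\<And>w. w \<in> wds \<Longrightarrow> \<exists>v\<in>wds. weq (v @ w) []\<close> by blast
  then show "\<exists>y\<in>carrier hnn. y \<otimes>\<^bsub>hnn\<^esub> x = \<one>\<^bsub>hnn\<^esub>"
    using w by (intro bexI[of _ "nf v"]) (simp_all add: nf_eq_iff flip: nf_append nf_Nil)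
qed

sublocale hnn: group hnn
  by (rule group_hnn)

lemma emb_hom: "emb \<in> hom P hnn"
proof (rule homI)
  fix a b assume ab: "a \<in> carrier P" "b \<in> carrier P"
  then show "emb (a \<otimes> b) = emb a \<otimes>\<^bsub>hnn\<^esub> emb b"
    using nf_base[OF mult[OF ab]] by (simp add: emb_def wds_Cons flip: nf_append)
qed (simp add: emb_def wds_Cons)

lemma st_closed: "i \<in> I \<Longrightarrow> st i \<in> carrier hnn"
  by (simp add: st_def wds_Cons)

lemma nf_Dn: "i \<in> I \<Longrightarrow> nf [Dn i] = inv\<^bsub>hnn\<^esub> (st i)"
  using nf_base[OF dn_up[of i]]
  by (intro hnn.inv_equality[symmetric]) (simp_all add: st_def wds_Cons nf_Nil flip: nf_append)

lemma st_conj: "i \<in> I \<Longrightarrow> q \<in> Q i \<Longrightarrow> emb q \<otimes>\<^bsub>hnn\<^esub> st i = st i \<otimes>\<^bsub>hnn\<^esub> emb (\<phi> i q)"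
  using nf_base[OF conj[of i q]] Q_carrier[of i q] \<phi>_closed[of i q]
  by (simp add: emb_def st_def wds_Cons flip: nf_append)

lemma hnn_induct:
  assumes "\<one>\<^bsub>hnn\<^esub> \<in> S"
    and "\<And>x a. x \<in> carrier hnn \<Longrightarrow> x \<in> S \<Longrightarrow> a \<in> carrier P \<Longrightarrow> x \<otimes>\<^bsub>hnn\<^esub> emb a \<in> S"
    and "\<And>x i. x \<in> carrier hnn \<Longrightarrow> x \<in> S \<Longrightarrow> i \<in> I \<Longrightarrow> x \<otimes>\<^bsub>hnn\<^esub> st i \<in> S"
    and "\<And>x i. x \<in> carrier hnn \<Longrightarrow> x \<in> S \<Longrightarrow> i \<in> I \<Longrightarrow> x \<otimes>\<^bsub>hnn\<^esub> inv\<^bsub>hnn\<^esub> (st i) \<in> S"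
  shows "carrier hnn \<subseteq> S"
proof
  fix x assume "x \<in> carrier hnn"
  then obtain w where w: "w \<in> wds" "x = nf w" by (rule carrierE)
  have "nf w \<in> S" using w(1)
  proof (induction w rule: rev_induct)
    case Nil
    then show ?case using assms(1) by (simp add: nf_Nil)
  next
    case (snoc l w)
    then have l: "l \<in> letters" "w \<in> wds" "nf w \<in> S" by (auto simp: wds_Cons)
    have "nf (w @ [l]) = nf w \<otimes>\<^bsub>hnn\<^esub> nf [l]" by (rule nf_append) (use l in \<open>auto simp: wds_Cons\<close>)
    then show ?case
      using l assms(2)[of "nf w"] assms(3)[of "nf w"] assms(4)[of "nf w"]
      by (cases l) (auto simp: emb_def st_def nf_Dn)
  qed
  then show "x \<in> S" by (simp add: w)
qed

text \<open>A word is read by an automaton whose state is moved by \<open>\<sigma>\<close>; the outputs along the word are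
  multiplied. The output is compatible with the presentation as soon as it respects the defining
  relations in every state.\<close>

lemma crossed_hom:
  fixes K :: "('k, 'e) monoid_scheme" and H :: "('h, 'd) monoid_scheme"
  assumes "group K" "group H" and \<sigma>: "\<sigma> \<in> hom hnn K"
    and out: "\<And>l s. l \<in> letters \<Longrightarrow> s \<in> carrier K \<Longrightarrow> out l s \<in> carrier H"
    and c1: "\<And>a b s. a \<in> carrier P \<Longrightarrow> b \<in> carrier P \<Longrightarrow> s \<in> carrier K \<Longrightarrow>
      out (El a) s \<otimes>\<^bsub>H\<^esub> out (El b) (s \<otimes>\<^bsub>K\<^esub> \<sigma> (emb a)) = out (El (a \<otimes> b)) s"
    and c2: "\<And>s. s \<in> carrier K \<Longrightarrow> out (El \<one>) s = \<one>\<^bsub>H\<^esub>"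
    and c3: "\<And>i s. i \<in> I \<Longrightarrow> s \<in> carrier K \<Longrightarrow> out (Up i) s \<otimes>\<^bsub>H\<^esub> out (Dn i) (s \<otimes>\<^bsub>K\<^esub> \<sigma> (st i)) = \<one>\<^bsub>H\<^esub>"
    and c4: "\<And>i q s. i \<in> I \<Longrightarrow> q \<in> Q i \<Longrightarrow> s \<in> carrier K \<Longrightarrow>
      out (El q) s \<otimes>\<^bsub>H\<^esub> out (Up i) (s \<otimes>\<^bsub>K\<^esub> \<sigma> (emb q)) = out (Up i) s \<otimes>\<^bsub>H\<^esub> out (El (\<phi> i q)) (s \<otimes>\<^bsub>K\<^esub> \<sigma> (st i))"
  obtains A where "\<And>x s. x \<in> carrier hnn \<Longrightarrow> s \<in> carrier K \<Longrightarrow> A x s \<in> carrier H"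
    "\<And>x y s. x \<in> carrier hnn \<Longrightarrow> y \<in> carrier hnn \<Longrightarrow> s \<in> carrier K \<Longrightarrow>
      A (x \<otimes>\<^bsub>hnn\<^esub> y) s = A x s \<otimes>\<^bsub>H\<^esub> A y (s \<otimes>\<^bsub>K\<^esub> \<sigma> x)"
    "\<And>a s. a \<in> carrier P \<Longrightarrow> s \<in> carrier K \<Longrightarrow> A (emb a) s = out (El a) s"
    "\<And>i s. i \<in> I \<Longrightarrow> s \<in> carrier K \<Longrightarrow> A (st i) s = out (Up i) s"
proof -
  interpret K: group K by fact
  interpret H: group H by fact
  interpret \<sigma>: group_hom hnn K \<sigma> by unfold_locales (rule \<sigma>)
  let ?step = "\<lambda>s l. s \<otimes>\<^bsub>K\<^esub> \<sigma> (nf [l])"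
  let ?run = "run H ?step out"
  have \<sigma>l: "\<sigma> (nf [l]) \<in> carrier K" if "l \<in> letters" for l
    using that by (simp add: wds_Cons)
  \<comment> \<open>The other cancellation relation follows from \<open>c3\<close> in the shifted
    state, since a right inverse in a group is also a left inverse.\<close>
  have c5: "out (Dn i) s \<otimes>\<^bsub>H\<^esub> out (Up i) (s \<otimes>\<^bsub>K\<^esub> \<sigma> (nf [Dn i])) = \<one>\<^bsub>H\<^esub>" if i: "i \<in> I" and s: "s \<in> carrier K" for i s
  proof -
    let ?s = "s \<otimes>\<^bsub>K\<^esub> \<sigma> (nf [Dn i])"
    have s': "?s \<in> carrier K" using i s by (simp add: \<sigma>l)
    have "?s \<otimes>\<^bsub>K\<^esub> \<sigma> (st i) = s" using i s st_closed[OF i] by (simp add: nf_Dn K.m_assoc)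
    then have "out (Up i) ?s \<otimes>\<^bsub>H\<^esub> out (Dn i) s = \<one>\<^bsub>H\<^esub>" using c3[OF i s'] by simp
    then show ?thesis by (rule H.inv_comm) (use i s s' out in auto)
  qed
  have run_closed: "?run w s \<in> carrier H" if "w \<in> wds" "s \<in> carrier K" for w s
    using that by (induction w arbitrary: s) (auto simp: wds_Cons out \<sigma>l)
  have run_append: "?run (u @ v) s = ?run u s \<otimes>\<^bsub>H\<^esub> ?run v (s \<otimes>\<^bsub>K\<^esub> \<sigma> (nf u))"
    if "u \<in> wds" "v \<in> wds" "s \<in> carrier K" for u v s
    using that
  proof (induction u arbitrary: s)
    case Nil
    then show ?case by (simp add: nf_Nil run_closed)
  next
    case (Cons l u)
    then have l: "l \<in> letters" "u \<in> wds" "[l] \<in> wds" by (auto simp: wds_Cons)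
    have "nf (l # u) = nf [l] \<otimes>\<^bsub>hnn\<^esub> nf u" using nf_append[of "[l]" u] l by simp
    moreover have "?step s l \<otimes>\<^bsub>K\<^esub> \<sigma> (nf u) \<in> carrier K" using l Cons.prems by (simp add: \<sigma>l)
    ultimately show ?case
      using Cons l \<sigma>l[OF l(1)] by (simp add: H.m_assoc K.m_assoc out run_closed)
  qed
  have base_wds: "base r l \<Longrightarrow> r \<in> wds \<and> l \<in> wds" for r l
    by (induction rule: base.induct) (auto simp: wds_Cons Q_carrier \<phi>_closed)
  have run_base: "?run r s = ?run l s" if "base r l" "s \<in> carrier K" for r l s
    using that(1)
  proof cases
    case (mult a b)
    then show ?thesis using c1[of a b s] that(2) by (simp add: emb_def out \<sigma>l)
  next
    case one
    then show ?thesis using c2 that(2) by simp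
  next
    case (up_dn i)
    then show ?thesis using c3[of i s] that(2) by (simp add: st_def out \<sigma>l)
  next
    case (dn_up i)
    then show ?thesis using c5[of i s] that(2) by (simp add: out \<sigma>l)
  next
    case (conj i q)
    then show ?thesis using c4[of i q s] that(2) Q_carrier[of i q] \<phi>_closed[of i q]
      by (simp add: out \<sigma>l emb_def st_def)
  qed
  \<comment> \<open>Both sides of every relation consist of admissible letters, so a chain of
    equivalences that starts in \<open>wds\<close> stays there although \<open>weq\<close> allows
    arbitrary contexts.\<close>
  have weq_wds: "weq w w' \<Longrightarrow> w \<in> wds \<longleftrightarrow> w' \<in> wds" for w w'
    by (induction rule: weq.induct) (auto dest: base_wds)
  have run_weq: "weq w w' \<Longrightarrow> w \<in> wds \<Longrightarrow> s \<in> carrier K \<Longrightarrow> ?run w s = ?run w' s" for w w' s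
  proof (induction arbitrary: s rule: weq.induct)
    case (step r l u v)
    then have b: "r \<in> wds" "l \<in> wds" "u \<in> wds" "v \<in> wds" using base_wds by auto
    then show ?case using run_base[OF step(1)] nf_base[OF step(1)] step.prems
      by (simp add: run_append)
  qed (use weq_wds in auto)
  have run_wd: "?run (wd (nf w)) s = ?run w s" if "w \<in> wds" "s \<in> carrier K" for w s
  proof -
    have w: "wd (nf w) \<in> wds" "nf (wd (nf w)) = nf w" using wd[of "nf w"] that by auto
    then have "weq (wd (nf w)) w" using nf_eq_iff[OF w(1) that(1)] by simp
    then show ?thesis by (rule run_weq) (use w that in auto)
  qed
  show thesis
  proof (rule that[of "\<lambda>x. ?run (wd x)"])
    fix x y s assume "x \<in> carrier hnn" "y \<in> carrier hnn" and s: "s \<in> carrier K"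
    then obtain u v where uv: "u \<in> wds" "v \<in> wds" "x = nf u" "y = nf v" by (metis carrierE)
    then show "?run (wd (x \<otimes>\<^bsub>hnn\<^esub> y)) s = ?run (wd x) s \<otimes>\<^bsub>H\<^esub> ?run (wd y) (s \<otimes>\<^bsub>K\<^esub> \<sigma> x)"
      using s by (simp add: run_wd run_append flip: nf_append)
  next
    fix a s assume "a \<in> carrier P" "s \<in> carrier K"
    then show "?run (wd (emb a)) s = out (El a) s" by (simp add: emb_def run_wd wds_Cons out)
  next
    fix i s assume "i \<in> I" "s \<in> carrier K"
    then show "?run (wd (st i)) s = out (Up i) s" by (simp add: st_def run_wd wds_Cons out)
  qed (use run_closed wd in blast)
qed

text \<open>The universal property of the presentation, read off from an automaton with a single
  state.\<close>

lemma extend_hom: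
  fixes H :: "('h, 'd) monoid_scheme"
  assumes "group H" and v: "v \<in> hom P H" and t: "\<And>i. i \<in> I \<Longrightarrow> t i \<in> carrier H"
    and c: "\<And>i q. i \<in> I \<Longrightarrow> q \<in> Q i \<Longrightarrow> v q \<otimes>\<^bsub>H\<^esub> t i = t i \<otimes>\<^bsub>H\<^esub> v (\<phi> i q)"
  obtains h where "h \<in> hom hnn H" "\<And>a. a \<in> carrier P \<Longrightarrow> h (emb a) = v a" "\<And>i. i \<in> I \<Longrightarrow> h (st i) = t i"
proof -
  interpret H: group H by fact
  interpret v: group_hom P H v by unfold_locales (rule v)
  have K: "group (singleton_group ())" by simp
  have \<sigma>: "(\<lambda>_. ()) \<in> hom hnn (singleton_group ())" by (simp add: hom_def)
  obtain A where A: "\<And>x s. x \<in> carrier hnn \<Longrightarrow> s \<in> carrier (singleton_group ()) \<Longrightarrow> A x s \<in> carrier H"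
    "\<And>x y s. x \<in> carrier hnn \<Longrightarrow> y \<in> carrier hnn \<Longrightarrow> s \<in> carrier (singleton_group ()) \<Longrightarrow>
      A (x \<otimes>\<^bsub>hnn\<^esub> y) s = A x s \<otimes>\<^bsub>H\<^esub> A y (s \<otimes>\<^bsub>singleton_group ()\<^esub> ())"
    "\<And>a s. a \<in> carrier P \<Longrightarrow> s \<in> carrier (singleton_group ()) \<Longrightarrow> A (emb a) s = v a"
    "\<And>i s. i \<in> I \<Longrightarrow> s \<in> carrier (singleton_group ()) \<Longrightarrow> A (st i) s = t i"
    by (rule crossed_hom[OF K \<open>group H\<close> \<sigma>,
          of "\<lambda>l _. case l of El a \<Rightarrow> v a | Up i \<Rightarrow> t i | Dn i \<Rightarrow> inv\<^bsub>H\<^esub> (t i)"])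
      (use that in \<open>auto simp: t c split: letter.splits\<close>)
  show thesis
    by (rule that[of "\<lambda>x. A x ()"]) (auto simp: hom_def A)
qed

text \<open>The state is the group element reached so far and the outputs are added up in the
  integers, so the value at x sums the differences along a path from the unit to x. Elements of P
  contribute 0, which makes the sum right P-invariant, and the hypothesis on k is the condition that
  the relation between q and the letter imposes.\<close>

lemma lift_int:
  fixes k :: "'i \<Rightarrow> nat \<Rightarrow> int"
  assumes k: "\<And>i x q. i \<in> I \<Longrightarrow> x \<in> carrier hnn \<Longrightarrow> q \<in> Q i \<Longrightarrow> k i (x \<otimes>\<^bsub>hnn\<^esub> emb q) = k i x"
  shows "\<exists>l. \<forall>x\<in>carrier hnn. (\<forall>a\<in>carrier P. l (x \<otimes>\<^bsub>hnn\<^esub> emb a) = l x) \<and> (\<forall>i\<in>I. l (x \<otimes>\<^bsub>hnn\<^esub> st i) = l x + k i x)"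
proof -
  \<comment> \<open>An inverse letter crosses an edge backwards. That edge starts at the element
    reached after the letter, hence the shifted argument.\<close>
  let ?out = "\<lambda>l x. case l of El a \<Rightarrow> 0 | Up i \<Rightarrow> k i x | Dn i \<Rightarrow> - k i (x \<otimes>\<^bsub>hnn\<^esub> inv\<^bsub>hnn\<^esub> (st i))"
  have id: "(\<lambda>x. x) \<in> hom hnn hnn" by (simp add: hom_def)
  have emb: "emb a \<in> carrier hnn" if "a \<in> carrier P" for a using emb_hom that by (auto simp: hom_def)
  obtain A where A: "\<And>x y s. x \<in> carrier hnn \<Longrightarrow> y \<in> carrier hnn \<Longrightarrow> s \<in> carrier hnn \<Longrightarrow>
      A (x \<otimes>\<^bsub>hnn\<^esub> y) s = A x s \<otimes>\<^bsub>integer_group\<^esub> A y (s \<otimes>\<^bsub>hnn\<^esub> x)"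
    "\<And>a s. a \<in> carrier P \<Longrightarrow> s \<in> carrier hnn \<Longrightarrow> A (emb a) s = 0"
    "\<And>i s. i \<in> I \<Longrightarrow> s \<in> carrier hnn \<Longrightarrow> A (st i) s = k i s"
  proof (rule crossed_hom[OF group_hnn group_integer_group id, of ?out])
    fix i s assume "i \<in> I" "s \<in> carrier hnn"
    then show "?out (Up i) s \<otimes>\<^bsub>integer_group\<^esub> ?out (Dn i) (s \<otimes>\<^bsub>hnn\<^esub> st i) = \<one>\<^bsub>integer_group\<^esub>"
      by (simp add: hnn.m_assoc st_closed)
  qed (auto simp: k)
  show ?thesis
    by (rule exI[of _ "\<lambda>x. A x \<one>\<^bsub>hnn\<^esub>"]) (auto simp: A emb st_closed)
qed

end

section \<open>Freeness of the kernel of a finite quotient\<close>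

lemma reduced_word_Cons:
  "reduced_word (x # w) \<longleftrightarrow> reduced_word w \<and> (w = [] \<or> snd x \<noteq> snd (hd w) \<or> fst x = fst (hd w))"
proof
  assume r: "reduced_word (x # w)"
  have "reduced_word w"
    unfolding reduced_word_def
  proof (intro allI impI)
    fix i assume "Suc i < length w"
    then show "\<not> (snd (w ! i) = snd (w ! Suc i) \<and> fst (w ! i) \<noteq> fst (w ! Suc i))"
      using r[unfolded reduced_word_def, rule_format, of "Suc i"] by simp
  qed
  moreover have "w = [] \<or> snd x \<noteq> snd (hd w) \<or> fst x = fst (hd w)"
    using r[unfolded reduced_word_def, rule_format, of 0] by (cases w) auto
  ultimately show "reduced_word w \<and> (w = [] \<or> snd x \<noteq> snd (hd w) \<or> fst x = fst (hd w))" ..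
next
  assume r: "reduced_word w \<and> (w = [] \<or> snd x \<noteq> snd (hd w) \<or> fst x = fst (hd w))"
  show "reduced_word (x # w)"
    unfolding reduced_word_def
  proof (intro allI impI)
    fix i assume "Suc i < length (x # w)"
    then show "\<not> (snd ((x # w) ! i) = snd ((x # w) ! Suc i) \<and> fst ((x # w) ! i) \<noteq> fst ((x # w) ! Suc i))"
      using r by (cases i; cases w) (auto simp: reduced_word_def)
  qed
qed

text \<open>Left multiplication by a letter in the free group, as in van der Waerden's trick:
  letting letters act as permutations of reduced words spares a proof that multiplication of reduced
  words is associative.\<close>

definition push :: "bool \<Rightarrow> 'e \<Rightarrow> (bool \<times> 'e) list \<Rightarrow> (bool \<times> 'e) list" where
  "push b e w = (if w \<noteq> [] \<and> hd w = (\<not> b, e) then tl w else (b, e) # w)"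

lemma reduced_push: "reduced_word w \<Longrightarrow> reduced_word (push b e w)"
  by (cases w) (auto simp: push_def reduced_word_Cons)

lemma push_reduced:
  assumes "reduced_word ((b, e) # w)"
  shows "push b e w = (b, e) # w"
proof -
  have "w = [] \<or> hd w \<noteq> (\<not> b, e)"
    using assms unfolding reduced_word_Cons by fastforce
  then show ?thesis unfolding push_def by (intro if_not_P) blast
qed

lemma push_push: "reduced_word w \<Longrightarrow> push b e (push (\<not> b) e w) = w"
  by (cases w) (auto simp: push_def reduced_word_Cons)

definition free_gen :: "'e \<Rightarrow> (bool \<times> 'e) list \<Rightarrow> (bool \<times> 'e) list" where
  "free_gen e = (\<lambda>w\<in>Collect reduced_word. push True e w)"

lemma push_Bij: "(\<lambda>w\<in>Collect reduced_word. push b e w) \<in> Bij (Collect reduced_word)"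
proof -
  have "bij_betw (push b e) (Collect reduced_word) (Collect reduced_word)"
    by (rule bij_betw_byWitness[where f' = "push (\<not> b) e"])
      (use push_push[of _ b e] push_push[of _ "\<not> b" e] reduced_push in auto)
  then show ?thesis by (simp add: Bij_def)
qed

lemma inv_free_gen:
  "inv\<^bsub>BijGroup (Collect reduced_word)\<^esub> (free_gen e) = (\<lambda>w\<in>Collect reduced_word. push False e w)"
proof (rule group.inv_equality[OF group_BijGroup])
  show "(\<lambda>w\<in>Collect reduced_word. push False e w) \<otimes>\<^bsub>BijGroup (Collect reduced_word)\<^esub> free_gen e
      = \<one>\<^bsub>BijGroup (Collect reduced_word)\<^esub>"
    using push_Bij[of False e] push_Bij[of True e] push_push[of _ False e]
    by (auto simp: reduced_push BijGroup_def free_gen_def compose_def fun_eq_iff restrict_def)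
qed (use push_Bij[of False e] push_Bij[of True e] in \<open>auto simp: BijGroup_def free_gen_def\<close>)

lemma free_gen_closed: "free_gen e \<in> carrier (BijGroup (Collect reduced_word))"
  using push_Bij[of True e] by (simp add: BijGroup_def free_gen_def)

lemma word_eval_Cons:
  "word_eval G ((b, x) # w) = (if b then x else inv\<^bsub>G\<^esub> x) \<otimes>\<^bsub>G\<^esub> word_eval G w"
  by (simp add: word_eval_def)

lemma (in group) word_eval_closed: "set (map snd w) \<subseteq> carrier G \<Longrightarrow> word_eval G w \<in> carrier G"
  by (induction w) (auto simp: word_eval_Cons, simp add: word_eval_def)

lemma BijGroup_apply:
  "f \<in> carrier (BijGroup S) \<Longrightarrow> h \<in> carrier (BijGroup S) \<Longrightarrow> x \<in> S \<Longrightarrow> (f \<otimes>\<^bsub>BijGroup S\<^esub> h) x = f (h x)"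
  by (simp add: BijGroup_def compose_def)

text \<open>Applied to the empty word, the permutations of a reduced word prepend its letters one
  after the other and never cancel, so the result is the word itself.\<close>

lemma free_gen_reduced:
  assumes "reduced_word w" "w \<noteq> []"
  shows "word_eval (BijGroup (Collect reduced_word)) (map (\<lambda>(b, e). (b, free_gen e)) w)
    \<noteq> \<one>\<^bsub>BijGroup (Collect reduced_word)\<^esub>"
proof -
  let ?F = "BijGroup (Collect reduced_word)"
  let ?ev = "\<lambda>w. word_eval ?F (map (\<lambda>(b, e). (b, free_gen e)) w)"
  interpret F: group ?F by (rule group_BijGroup)
  have nil: "reduced_word []" by (simp add: reduced_word_def)
  have closed: "?ev w \<in> carrier ?F" for w :: "(bool \<times> 'a) list"
    by (rule F.word_eval_closed) (use free_gen_closed in auto)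
  have "?ev w [] = w" using assms(1)
  proof (induction w)
    case Nil
    then show ?case by (simp add: word_eval_def BijGroup_def nil)
  next
    case (Cons x w)
    obtain b e where x: "x = (b, e)" by (cases x)
    have r: "reduced_word w" using Cons.prems by (simp add: reduced_word_Cons)
    have "(if b then free_gen e else inv\<^bsub>?F\<^esub> (free_gen e)) = (\<lambda>w\<in>Collect reduced_word. push b e w)"
      using inv_free_gen[of e] by (simp add: free_gen_def)
    then have ev: "?ev (x # w) = (\<lambda>w\<in>Collect reduced_word. push b e w) \<otimes>\<^bsub>?F\<^esub> ?ev w"
      by (simp add: x word_eval_Cons)
    have "(\<lambda>w\<in>Collect reduced_word. push b e w) \<in> carrier ?F"
      using push_Bij[of b e] by (simp add: BijGroup_def)
    then have "?ev (x # w) [] = (\<lambda>w\<in>Collect reduced_word. push b e w) (?ev w [])"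
      unfolding ev by (rule BijGroup_apply[OF _ closed]) (simp add: nil)
    also have "\<dots> = push b e (?ev w [])" using Cons.IH[OF r] r by simp
    also have "\<dots> = x # w"
      unfolding Cons.IH[OF r] x by (rule push_reduced) (use Cons.prems x in simp)
    finally show ?case .
  qed
  moreover have "\<one>\<^bsub>?F\<^esub> [] = ([] :: (bool \<times> 'a) list)" by (simp add: BijGroup_def nil)
  ultimately show ?thesis using assms(2) by metis
qed

section \<open>Quotients of the HNN extension in which P embeds\<close>

locale finite_quotient = presentation P I Q \<phi>
  for P :: "('a, 'b) monoid_scheme" (structure) and I :: "'i set" and Q :: "'i \<Rightarrow> 'a set"
    and \<phi> :: "'i \<Rightarrow> 'a \<Rightarrow> 'a" +
  fixes G :: "('k, 'e) monoid_scheme" and \<theta> :: "'a \<Rightarrow> 'k" and \<tau> :: "'i \<Rightarrow> 'k" and j :: "'k \<Rightarrow> 'i"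
  assumes group_G: "group G" and \<theta>_hom: "\<theta> \<in> hom P G" and \<theta>_inj: "inj_on \<theta> (carrier P)"
    and \<tau>_closed: "\<And>i. i \<in> I \<Longrightarrow> \<tau> i \<in> carrier G"
    and \<tau>_conj: "\<And>i q. i \<in> I \<Longrightarrow> q \<in> Q i \<Longrightarrow> \<theta> q \<otimes>\<^bsub>G\<^esub> \<tau> i = \<tau> i \<otimes>\<^bsub>G\<^esub> \<theta> (\<phi> i q)"
    and j_I: "\<And>g. g \<in> carrier G \<Longrightarrow> j g \<in> I"
    and Q_j: "\<And>g. g \<in> carrier G \<Longrightarrow> Q (j g) = {\<one>}"
    and \<tau>_j: "\<And>g. g \<in> carrier G \<Longrightarrow> \<tau> (j g) = g"
begin

sublocale G: group G
  by (rule group_G)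

sublocale \<theta>: group_hom P G \<theta>
  by unfold_locales (rule \<theta>_hom)

lemma emb_closed [simp]: "a \<in> carrier P \<Longrightarrow> emb a \<in> carrier hnn"
  using emb_hom by (auto simp: hom_def)

lemma emb_one: "emb \<one> = \<one>\<^bsub>hnn\<^esub>"
  using group_hom.hom_one[of P hnn emb] emb_hom P.group_axioms hnn.group_axioms
  by (simp add: group_hom_def group_hom_axioms_def)

lemma quotient_map:
  obtains \<pi> where "\<pi> \<in> hom hnn G" "\<And>a. a \<in> carrier P \<Longrightarrow> \<pi> (emb a) = \<theta> a" "\<And>i. i \<in> I \<Longrightarrow> \<pi> (st i) = \<tau> i"
  using extend_hom[OF group_G \<theta>_hom \<tau>_closed \<tau>_conj] that by blast

lemma emb_inj: "inj_on emb (carrier P)"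
proof -
  obtain \<pi> where "\<pi> \<in> hom hnn G" and \<pi>: "\<And>a. a \<in> carrier P \<Longrightarrow> \<pi> (emb a) = \<theta> a"
    and "\<And>i. i \<in> I \<Longrightarrow> \<pi> (st i) = \<tau> i" using quotient_map by blast
  show ?thesis
  proof (rule inj_onI)
    fix a b assume "a \<in> carrier P" "b \<in> carrier P" "emb a = emb b"
    then show "a = b" using \<pi> \<theta>_inj by (metis inj_onD)
  qed
qed

text \<open>Inversion exchanges the left and right translations in
  \<open>coset_retraction\<close>.\<close>

lemma right_retraction:
  obtains \<rho> where "\<And>g. g \<in> carrier G \<Longrightarrow> \<rho> g \<in> carrier P"
    "\<And>g a. g \<in> carrier G \<Longrightarrow> a \<in> carrier P \<Longrightarrow> \<rho> (g \<otimes>\<^bsub>G\<^esub> \<theta> a) = \<rho> g \<otimes> a" "\<rho> \<one>\<^bsub>G\<^esub> = \<one>"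
proof -
  obtain \<rho> where \<rho>: "\<And>g. g \<in> carrier G \<Longrightarrow> \<rho> g \<in> carrier P"
    "\<And>a g. a \<in> carrier P \<Longrightarrow> g \<in> carrier G \<Longrightarrow> \<rho> (\<theta> a \<otimes>\<^bsub>G\<^esub> g) = a \<otimes> \<rho> g" "\<rho> \<one>\<^bsub>G\<^esub> = \<one>"
    using coset_retraction[OF group_G P.group_axioms \<theta>_hom \<theta>_inj] by blast
  show thesis
  proof (rule that[of "\<lambda>g. inv (\<rho> (inv\<^bsub>G\<^esub> g))"])
    fix g a assume g: "g \<in> carrier G" and a: "a \<in> carrier P"
    have "inv\<^bsub>G\<^esub> (g \<otimes>\<^bsub>G\<^esub> \<theta> a) = \<theta> (inv a) \<otimes>\<^bsub>G\<^esub> inv\<^bsub>G\<^esub> g" using g a by (simp add: G.inv_mult_group)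
    then show "inv (\<rho> (inv\<^bsub>G\<^esub> (g \<otimes>\<^bsub>G\<^esub> \<theta> a))) = inv (\<rho> (inv\<^bsub>G\<^esub> g)) \<otimes> a"
      using g a \<rho>(1) \<rho>(2)[of "inv a" "inv\<^bsub>G\<^esub> g"] by (simp add: P.inv_mult_group)
  qed (use \<rho> in auto)
qed

text \<open>The Reidemeister-Schreier method for a section that is equivariant under P: letters of P
  then give trivial Schreier generators, and the generator of a stable letter depends only on the
  edge it crosses. Freeness is detected in the free group on the edges instead of by rewriting
  relations.\<close>

theorem free_kernel:
  obtains N where "N \<lhd> hnn" "free_subgroup hnn N" "card (rcosets\<^bsub>hnn\<^esub> N) = card (carrier G)"
    "finite (carrier G) \<Longrightarrow> finite (rcosets\<^bsub>hnn\<^esub> N)"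
proof -
  obtain \<pi> where \<pi>_hom: "\<pi> \<in> hom hnn G" and \<pi>_emb: "\<And>a. a \<in> carrier P \<Longrightarrow> \<pi> (emb a) = \<theta> a"
    and \<pi>_st: "\<And>i. i \<in> I \<Longrightarrow> \<pi> (st i) = \<tau> i" using quotient_map by blast
  interpret \<pi>: group_hom hnn G \<pi> by unfold_locales (rule \<pi>_hom)
  obtain \<rho> where \<rho>: "\<And>g. g \<in> carrier G \<Longrightarrow> \<rho> g \<in> carrier P"
    "\<And>g a. g \<in> carrier G \<Longrightarrow> a \<in> carrier P \<Longrightarrow> \<rho> (g \<otimes>\<^bsub>G\<^esub> \<theta> a) = \<rho> g \<otimes> a" "\<rho> \<one>\<^bsub>G\<^esub> = \<one>"
    using right_retraction by blast
  \<comment> \<open>\<open>r g\<close> is the point of the coset g \<theta>(P) at which \<rho> is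
    trivial, so g is recovered from \<open>r g\<close> and \<open>\<rho> g\<close>.\<close>
  define r where "r g = g \<otimes>\<^bsub>G\<^esub> \<theta> (inv (\<rho> g))" for g
  have r_closed: "r g \<in> carrier G" if "g \<in> carrier G" for g using that \<rho>(1) by (simp add: r_def)
  have r_\<theta>: "r (g \<otimes>\<^bsub>G\<^esub> \<theta> a) = r g" if "g \<in> carrier G" "a \<in> carrier P" for g a
    using that by (simp add: r_def \<rho> P.inv_mult_group G.m_assoc) (simp add: \<rho> flip: G.m_assoc)
  have r_r: "r (r g) = r g" if "g \<in> carrier G" for g
    using r_\<theta>[OF that, of "inv (\<rho> g)"] \<rho>(1)[OF that] by (simp add: r_def)
  have \<rho>_r: "\<rho> (r g) = \<one>" if "g \<in> carrier G" for g
    using \<rho>(1)[OF that] \<rho>(2)[OF that, of "inv (\<rho> g)"] by (simp add: r_def)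
  have r_\<rho>: "r g \<otimes>\<^bsub>G\<^esub> \<theta> (\<rho> g) = g" if "g \<in> carrier G" for g
    using \<rho>(1)[OF that] that by (simp add: r_def G.m_assoc)
  have r_one: "r \<one>\<^bsub>G\<^esub> = \<one>\<^bsub>G\<^esub>" by (simp add: r_def \<rho>)
  \<comment> \<open>The base coset is lifted to the unit, and every other coset to the one letter
    that leads to it from the base.\<close>
  define s where "s g = (if g = \<one>\<^bsub>G\<^esub> then \<one>\<^bsub>hnn\<^esub> else st (j g))" for g
  have s_closed: "s g \<in> carrier hnn" and \<pi>_s: "\<pi> (s g) = g" if "g \<in> carrier G" for g
    using that by (auto simp: s_def j_I st_closed \<pi>_st \<tau>_j)
  txt \<open>A section of \<open>\<pi>\<close> which is equivariant for the right multiplication by P.\<close>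
  define n where "n g = s (r g) \<otimes>\<^bsub>hnn\<^esub> emb (\<rho> g)" for g
  have n_closed: "n g \<in> carrier hnn" and \<pi>_n: "\<pi> (n g) = g" if "g \<in> carrier G" for g
    using that s_closed[OF r_closed[OF that]] \<rho>(1)[OF that]
    by (auto simp: n_def \<pi>_emb \<pi>_s r_closed r_\<rho>)
  have n_\<theta>: "n (g \<otimes>\<^bsub>G\<^esub> \<theta> a) = n g \<otimes>\<^bsub>hnn\<^esub> emb a" if "g \<in> carrier G" "a \<in> carrier P" for g a
    using that s_closed[OF r_closed[OF that(1)]] \<rho>(1)[OF that(1)] hom_mult[OF emb_hom]
    by (simp add: n_def r_\<theta> \<rho> hnn.m_assoc)
  have n_one: "n \<one>\<^bsub>G\<^esub> = \<one>\<^bsub>hnn\<^esub>" by (simp add: n_def r_one s_def \<rho> emb_one)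
  \<comment> \<open>The loop that runs to g along the section, crosses the edge of i and returns
    along the section.\<close>
  define b where "b i g = n g \<otimes>\<^bsub>hnn\<^esub> st i \<otimes>\<^bsub>hnn\<^esub> inv\<^bsub>hnn\<^esub> (n (g \<otimes>\<^bsub>G\<^esub> \<tau> i))" for i g
  have b_closed: "b i g \<in> carrier hnn" if "i \<in> I" "g \<in> carrier G" for i g
    using that by (simp add: b_def n_closed st_closed \<tau>_closed)
  have b_n: "b i g \<otimes>\<^bsub>hnn\<^esub> n (g \<otimes>\<^bsub>G\<^esub> \<tau> i) = n g \<otimes>\<^bsub>hnn\<^esub> st i" if "i \<in> I" "g \<in> carrier G" for i g
    using that by (simp add: b_def n_closed st_closed \<tau>_closed hnn.m_assoc)
  \<comment> \<open>A generator is thus attached to an edge and not to the pair of i and g, which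
    later makes the labelling of generators by edges injective.\<close>
  have b_\<theta>: "b i (g \<otimes>\<^bsub>G\<^esub> \<theta> q) = b i g" if i: "i \<in> I" and g: "g \<in> carrier G" and q: "q \<in> Q i" for i g q
  proof -
    note q' = Q_carrier[OF i q] \<phi>_closed[OF i q]
    have "g \<otimes>\<^bsub>G\<^esub> \<theta> q \<otimes>\<^bsub>G\<^esub> \<tau> i = (g \<otimes>\<^bsub>G\<^esub> \<tau> i) \<otimes>\<^bsub>G\<^esub> \<theta> (\<phi> i q)"
      using g q' \<tau>_closed[OF i] by (simp add: G.m_assoc \<tau>_conj[OF i q])
    then have "b i (g \<otimes>\<^bsub>G\<^esub> \<theta> q) = n g \<otimes>\<^bsub>hnn\<^esub> (emb q \<otimes>\<^bsub>hnn\<^esub> st i) \<otimes>\<^bsub>hnn\<^esub>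
        inv\<^bsub>hnn\<^esub> (n (g \<otimes>\<^bsub>G\<^esub> \<tau> i) \<otimes>\<^bsub>hnn\<^esub> emb (\<phi> i q))"
      using g q' \<tau>_closed[OF i] by (simp add: b_def n_\<theta> hnn.m_assoc n_closed st_closed[OF i])
    also have "emb q \<otimes>\<^bsub>hnn\<^esub> st i = st i \<otimes>\<^bsub>hnn\<^esub> emb (\<phi> i q)" by (rule st_conj[OF i q])
    also have "n g \<otimes>\<^bsub>hnn\<^esub> (st i \<otimes>\<^bsub>hnn\<^esub> emb (\<phi> i q)) \<otimes>\<^bsub>hnn\<^esub>
        inv\<^bsub>hnn\<^esub> (n (g \<otimes>\<^bsub>G\<^esub> \<tau> i) \<otimes>\<^bsub>hnn\<^esub> emb (\<phi> i q)) = b i g"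
      using g q' \<tau>_closed[OF i]
      by (simp add: b_def hnn.m_assoc hnn.inv_mult_group n_closed st_closed[OF i])
        (simp add: n_closed flip: hnn.m_assoc)
    finally show ?thesis .
  qed
  txt \<open>Edges of the graph are pairs of a letter and a coset; the tree edges leave the base vertex.\<close>
  define tree where "tree i g \<longleftrightarrow> g = \<one>\<^bsub>G\<^esub> \<and> (\<exists>h\<in>carrier G. h \<noteq> \<one>\<^bsub>G\<^esub> \<and> r h = h \<and> i = j h)" for i g
  have b_tree: "b i g = \<one>\<^bsub>hnn\<^esub>" if tr: "tree i g" for i g
  proof -
    obtain h where h: "h \<in> carrier G" "h \<noteq> \<one>\<^bsub>G\<^esub>" "r h = h" "i = j h" "g = \<one>\<^bsub>G\<^esub>"
      using tr unfolding tree_def by blast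
    have "n h = st (j h)" using h \<rho>_r[of h] by (simp add: n_def s_def emb_one st_closed j_I)
    then show ?thesis using h by (simp add: b_def n_one \<tau>_j st_closed j_I)
  qed
  let ?B = "{b i g | i g. i \<in> I \<and> g \<in> carrier G \<and> \<not> tree i g}"
  let ?N = "kernel hnn G \<pi>"
  have B_N: "?B \<subseteq> ?N"
    by (auto simp: kernel_def b_def n_closed st_closed \<tau>_closed \<pi>_n \<pi>_st)
  then have B_closed: "?B \<subseteq> carrier hnn" by (auto simp: kernel_def)
  have subgroup_gen: "subgroup (generate hnn ?B) hnn" by (rule hnn.generate_is_subgroup[OF B_closed])
  have b_gen: "b i g \<in> generate hnn ?B" if "i \<in> I" "g \<in> carrier G" for i g
  proof (cases "tree i g")
    case True
    then show ?thesis by (simp add: b_tree generate.one)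
  next
    case False
    then show ?thesis using that by (intro generate.incl) blast
  qed
  have gen_closed: "y \<in> carrier hnn" if "y \<in> generate hnn ?B" for y
    using subgroup.subset[OF subgroup_gen] that by blast
  have shift: "x \<otimes>\<^bsub>hnn\<^esub> c = y \<otimes>\<^bsub>hnn\<^esub> (n (\<pi> x) \<otimes>\<^bsub>hnn\<^esub> c)"
    if x: "x \<in> carrier hnn" and y: "y \<in> generate hnn ?B" "x = y \<otimes>\<^bsub>hnn\<^esub> n (\<pi> x)" and c: "c \<in> carrier hnn" for x y c
  proof -
    have "x \<otimes>\<^bsub>hnn\<^esub> c = y \<otimes>\<^bsub>hnn\<^esub> n (\<pi> x) \<otimes>\<^bsub>hnn\<^esub> c" by (rule arg_cong[OF y(2)])
    also have "\<dots> = y \<otimes>\<^bsub>hnn\<^esub> (n (\<pi> x) \<otimes>\<^bsub>hnn\<^esub> c)"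
      by (rule hnn.m_assoc) (use x y(1) c in \<open>simp_all add: gen_closed n_closed\<close>)
    finally show ?thesis .
  qed
  \<comment> \<open>The set of elements that are a product of generators and their inverses times
    the section value over their image. For an element of the kernel that section value is the
    unit.\<close>
  let ?S = "{x \<in> carrier hnn. \<exists>y\<in>generate hnn ?B. x = y \<otimes>\<^bsub>hnn\<^esub> n (\<pi> x)}"
  have S_I: "x \<in> ?S" if "x = y \<otimes>\<^bsub>hnn\<^esub> n (\<pi> x)" "y \<in> generate hnn ?B" "x \<in> carrier hnn" for x y
    using that by blast
  have "carrier hnn \<subseteq> ?S"
  proof (rule hnn_induct)
    show "\<one>\<^bsub>hnn\<^esub> \<in> ?S" by (auto simp: n_one intro!: bexI[of _ "\<one>\<^bsub>hnn\<^esub>"] generate.one)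
  next
    fix x a assume x: "x \<in> carrier hnn" "x \<in> ?S" and a: "a \<in> carrier P"
    then obtain y where y: "y \<in> generate hnn ?B" "x = y \<otimes>\<^bsub>hnn\<^esub> n (\<pi> x)" by blast
    have "x \<otimes>\<^bsub>hnn\<^esub> emb a = y \<otimes>\<^bsub>hnn\<^esub> (n (\<pi> x) \<otimes>\<^bsub>hnn\<^esub> emb a)"
      by (rule shift[OF x(1) y]) (simp add: a)
    also have "n (\<pi> x) \<otimes>\<^bsub>hnn\<^esub> emb a = n (\<pi> (x \<otimes>\<^bsub>hnn\<^esub> emb a))" using x a by (simp add: n_\<theta> \<pi>_emb)
    finally have eq: "x \<otimes>\<^bsub>hnn\<^esub> emb a = y \<otimes>\<^bsub>hnn\<^esub> n (\<pi> (x \<otimes>\<^bsub>hnn\<^esub> emb a))" .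
    show "x \<otimes>\<^bsub>hnn\<^esub> emb a \<in> ?S"
      by (rule S_I[OF eq y(1)]) (use x(1) a in simp)
  next
    fix x i assume x: "x \<in> carrier hnn" "x \<in> ?S" and i: "i \<in> I"
    then obtain y where y: "y \<in> generate hnn ?B" "x = y \<otimes>\<^bsub>hnn\<^esub> n (\<pi> x)" by blast
    have "x \<otimes>\<^bsub>hnn\<^esub> st i = y \<otimes>\<^bsub>hnn\<^esub> (n (\<pi> x) \<otimes>\<^bsub>hnn\<^esub> st i)"
      by (rule shift[OF x(1) y st_closed[OF i]])
    also have "n (\<pi> x) \<otimes>\<^bsub>hnn\<^esub> st i = b i (\<pi> x) \<otimes>\<^bsub>hnn\<^esub> n (\<pi> (x \<otimes>\<^bsub>hnn\<^esub> st i))"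
      using x i by (simp add: b_n \<pi>_st st_closed)
    also have "y \<otimes>\<^bsub>hnn\<^esub> \<dots> = (y \<otimes>\<^bsub>hnn\<^esub> b i (\<pi> x)) \<otimes>\<^bsub>hnn\<^esub> n (\<pi> (x \<otimes>\<^bsub>hnn\<^esub> st i))"
      using x i y by (simp add: hnn.m_assoc gen_closed b_closed n_closed st_closed \<pi>_st \<tau>_closed)
    finally have eq: "x \<otimes>\<^bsub>hnn\<^esub> st i = (y \<otimes>\<^bsub>hnn\<^esub> b i (\<pi> x)) \<otimes>\<^bsub>hnn\<^esub> n (\<pi> (x \<otimes>\<^bsub>hnn\<^esub> st i))" .
    have "y \<otimes>\<^bsub>hnn\<^esub> b i (\<pi> x) \<in> generate hnn ?B"
      by (rule generate.eng[OF y(1) b_gen[OF i]]) (use x(1) in simp)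
    then show "x \<otimes>\<^bsub>hnn\<^esub> st i \<in> ?S"
      by (rule S_I[OF eq]) (use x(1) st_closed[OF i] in simp)
  next
    fix x i assume x: "x \<in> carrier hnn" "x \<in> ?S" and i: "i \<in> I"
    then obtain y where y: "y \<in> generate hnn ?B" "x = y \<otimes>\<^bsub>hnn\<^esub> n (\<pi> x)" by blast
    let ?t = "inv\<^bsub>hnn\<^esub> (st i)"
    let ?g = "\<pi> (x \<otimes>\<^bsub>hnn\<^esub> ?t)"
    have t: "?t \<in> carrier hnn" using st_closed[OF i] by simp
    have g: "?g \<in> carrier G" using x t by simp
    have "?g \<otimes>\<^bsub>G\<^esub> \<tau> i = \<pi> x" using x i st_closed[OF i] \<tau>_closed[OF i] by (simp add: \<pi>_st G.m_assoc)
    then have "b i ?g \<otimes>\<^bsub>hnn\<^esub> n (\<pi> x) = n ?g \<otimes>\<^bsub>hnn\<^esub> st i" using b_n[OF i g] by simp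
    then have "n (\<pi> x) = inv\<^bsub>hnn\<^esub> (b i ?g) \<otimes>\<^bsub>hnn\<^esub> (n ?g \<otimes>\<^bsub>hnn\<^esub> st i)"
      using x g i b_closed[OF i g] st_closed[OF i] n_closed[OF g] by (subst hnn.inv_solve_left) (auto simp: n_closed)
    then have "n (\<pi> x) \<otimes>\<^bsub>hnn\<^esub> ?t = inv\<^bsub>hnn\<^esub> (b i ?g) \<otimes>\<^bsub>hnn\<^esub> n ?g"
      using b_closed[OF i g] st_closed[OF i] n_closed[OF g] by (simp add: hnn.m_assoc)
    moreover have "x \<otimes>\<^bsub>hnn\<^esub> ?t = y \<otimes>\<^bsub>hnn\<^esub> (n (\<pi> x) \<otimes>\<^bsub>hnn\<^esub> ?t)"
      by (rule shift[OF x(1) y t])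
    ultimately have eq: "x \<otimes>\<^bsub>hnn\<^esub> ?t = (y \<otimes>\<^bsub>hnn\<^esub> inv\<^bsub>hnn\<^esub> (b i ?g)) \<otimes>\<^bsub>hnn\<^esub> n ?g"
      using y b_closed[OF i g] n_closed[OF g] by (simp add: hnn.m_assoc gen_closed)
    have "y \<otimes>\<^bsub>hnn\<^esub> inv\<^bsub>hnn\<^esub> (b i ?g) \<in> generate hnn ?B"
      using generate.eng[OF y(1) subgroup.m_inv_closed[OF subgroup_gen b_gen[OF i g]]] .
    then show "x \<otimes>\<^bsub>hnn\<^esub> ?t \<in> ?S"
      by (rule S_I[OF eq]) (use x(1) t in simp)
  qed
  then have "?N \<subseteq> generate hnn ?B"
    by (auto simp: kernel_def n_one gen_closed)
  moreover have "generate hnn ?B \<subseteq> ?N"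
    by (rule hnn.generate_subgroup_incl[OF B_N \<pi>.subgroup_kernel])
  ultimately have gen: "generate hnn ?B = ?N" by blast

  let ?W = "Collect reduced_word :: (bool \<times> 'i \<times> 'k set) list set"
  let ?F = "BijGroup ?W"
  interpret F: group ?F by (rule group_BijGroup)
  \<comment> \<open>The coset g \<theta>(Q i) is kept as a set, so that two descriptions of one edge
    give equal objects.\<close>
  define edge where "edge i g = (i, (\<lambda>q. g \<otimes>\<^bsub>G\<^esub> \<theta> q) ` Q i)" for i g
  have edge_mem: "g \<in> snd (edge i g)" if "i \<in> I" "g \<in> carrier G" for i g
    using that subgroup.one_closed[OF Q_sub[OF that(1)]] by (auto simp: edge_def intro!: image_eqI[of _ _ \<one>])
  have edge_\<theta>: "edge i (g \<otimes>\<^bsub>G\<^esub> \<theta> q) = edge i g" if i: "i \<in> I" and g: "g \<in> carrier G" and q: "q \<in> Q i" for i g q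
  proof -
    interpret Q: subgroup "Q i" P by (rule Q_sub[OF i])
    have "(\<lambda>q'. g \<otimes>\<^bsub>G\<^esub> \<theta> q \<otimes>\<^bsub>G\<^esub> \<theta> q') ` Q i = (\<lambda>q'. g \<otimes>\<^bsub>G\<^esub> \<theta> q') ` Q i"
    proof (intro equalityI subsetI)
      fix x assume "x \<in> (\<lambda>q'. g \<otimes>\<^bsub>G\<^esub> \<theta> q \<otimes>\<^bsub>G\<^esub> \<theta> q') ` Q i"
      then obtain q' where "q' \<in> Q i" "x = g \<otimes>\<^bsub>G\<^esub> \<theta> q \<otimes>\<^bsub>G\<^esub> \<theta> q'" by blast
      then show "x \<in> (\<lambda>q'. g \<otimes>\<^bsub>G\<^esub> \<theta> q') ` Q i"
        using g q by (intro image_eqI[of _ _ "q \<otimes> q'"]) (simp_all add: G.m_assoc)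
    next
      fix x assume "x \<in> (\<lambda>q'. g \<otimes>\<^bsub>G\<^esub> \<theta> q') ` Q i"
      then obtain q' where "q' \<in> Q i" "x = g \<otimes>\<^bsub>G\<^esub> \<theta> q'" by blast
      then show "x \<in> (\<lambda>q'. g \<otimes>\<^bsub>G\<^esub> \<theta> q \<otimes>\<^bsub>G\<^esub> \<theta> q') ` Q i"
        using g q by (intro image_eqI[of _ _ "inv q \<otimes> q'"]) (simp_all add: G.m_assoc, simp flip: G.m_assoc)
    qed
    then show ?thesis by (simp add: edge_def)
  qed
  \<comment> \<open>Tree edges belong to letters with trivial \<open>Q i\<close>, so being a tree
    edge depends only on the coset.\<close>
  have tree_\<theta>: "g \<otimes>\<^bsub>G\<^esub> \<theta> q = g" if "tree i g \<or> tree i (g \<otimes>\<^bsub>G\<^esub> \<theta> q)" "g \<in> carrier G" "q \<in> Q i" for i g q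
    using that Q_j by (auto simp: tree_def)
  define up where "up i g = (if tree i g then \<one>\<^bsub>?F\<^esub> else free_gen (edge i g))" for i g
  have up_closed: "up i g \<in> carrier ?F" for i g by (simp add: up_def free_gen_closed)
  have up_\<theta>: "up i (g \<otimes>\<^bsub>G\<^esub> \<theta> q) = up i g" if "i \<in> I" "g \<in> carrier G" "q \<in> Q i" for i g q
    using tree_\<theta>[of i g q] edge_\<theta>[OF that] that by (auto simp: up_def)
  \<comment> \<open>The states lie in G and the output records the edge crossed by each stable
    letter; tree edges and letters of P are recorded as the unit. On the kernel this is a
    homomorphism, because the state returns to where it started.\<close>
  obtain A where A: "\<And>x s. x \<in> carrier hnn \<Longrightarrow> s \<in> carrier G \<Longrightarrow> A x s \<in> carrier ?F"
    "\<And>x y s. x \<in> carrier hnn \<Longrightarrow> y \<in> carrier hnn \<Longrightarrow> s \<in> carrier G \<Longrightarrow>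
      A (x \<otimes>\<^bsub>hnn\<^esub> y) s = A x s \<otimes>\<^bsub>?F\<^esub> A y (s \<otimes>\<^bsub>G\<^esub> \<pi> x)"
    "\<And>a s. a \<in> carrier P \<Longrightarrow> s \<in> carrier G \<Longrightarrow> A (emb a) s = \<one>\<^bsub>?F\<^esub>"
    "\<And>i s. i \<in> I \<Longrightarrow> s \<in> carrier G \<Longrightarrow> A (st i) s = up i s"
  proof (rule crossed_hom[OF group_G F.group_axioms \<pi>_hom,
        of "\<lambda>l g. case l of El a \<Rightarrow> \<one>\<^bsub>?F\<^esub> | Up i \<Rightarrow> up i g | Dn i \<Rightarrow> inv\<^bsub>?F\<^esub> (up i (g \<otimes>\<^bsub>G\<^esub> inv\<^bsub>G\<^esub> (\<tau> i)))"])
  qed (auto simp: up_closed up_\<theta> \<pi>_emb \<pi>_st \<tau>_closed Q_carrier G.m_assoc split: letter.splits)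
  let ?A = "\<lambda>x. A x \<one>\<^bsub>G\<^esub>"
  have A_one: "?A \<one>\<^bsub>hnn\<^esub> = \<one>\<^bsub>?F\<^esub>" using A(3)[of \<one>] by (simp add: emb_one)
  \<comment> \<open>The section runs along tree edges and leaves no record, so all that remains of a
    generator is its one edge outside the tree.\<close>
  have A_s: "?A (s (r g)) = \<one>\<^bsub>?F\<^esub>" if "g \<in> carrier G" for g
    using that r_closed[OF that] r_r[OF that]
    by (auto simp: s_def A_one A(4) j_I up_def tree_def)
  have A_n: "?A (n g) = \<one>\<^bsub>?F\<^esub>" if "g \<in> carrier G" for g
    using that r_closed[OF that] \<rho>(1)[OF that] s_closed[OF r_closed[OF that]]
    by (simp add: n_def A(2) A_s A(3) \<pi>_s)
  have A_mult: "?A (x \<otimes>\<^bsub>hnn\<^esub> y) = ?A x \<otimes>\<^bsub>?F\<^esub> ?A y" if "x \<in> ?N" "y \<in> carrier hnn" for x y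
    using that A(2)[of x y "\<one>\<^bsub>G\<^esub>"] by (auto simp: kernel_def)
  have A_b: "?A (b i g) = free_gen (edge i g)" if i: "i \<in> I" and g: "g \<in> carrier G" and nt: "\<not> tree i g" for i g
  proof -
    have bN: "b i g \<in> ?N" using B_N i g nt by blast
    have "?A (b i g) = ?A (b i g) \<otimes>\<^bsub>?F\<^esub> ?A (n (g \<otimes>\<^bsub>G\<^esub> \<tau> i))"
      using A(1)[OF b_closed[OF i g]] g \<tau>_closed[OF i] by (simp add: A_n)
    also have "\<dots> = ?A (b i g \<otimes>\<^bsub>hnn\<^esub> n (g \<otimes>\<^bsub>G\<^esub> \<tau> i))"
      by (rule A_mult[symmetric, OF bN]) (simp add: n_closed g \<tau>_closed i)
    also have "\<dots> = up i g"
      using g i up_closed by (simp add: b_n A(2) n_closed st_closed A_n \<pi>_n A(4))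
    finally show ?thesis by (simp add: up_def nt)
  qed
  \<comment> \<open>Each generator is labelled by an edge. Equal labels force equal generators, so
    relabelling a reduced word in the generators gives a reduced word in the edges.\<close>
  have "\<forall>y\<in>?B. \<exists>e. ?A y = free_gen e \<and> (\<exists>i g. e = edge i g \<and> y = b i g \<and> i \<in> I \<and> g \<in> carrier G)"
    using A_b by blast
  from bchoice[OF this] obtain \<eta> where \<eta>: "\<And>y. y \<in> ?B \<Longrightarrow> ?A y = free_gen (\<eta> y)"
    "\<And>y. y \<in> ?B \<Longrightarrow> \<exists>i g. \<eta> y = edge i g \<and> y = b i g \<and> i \<in> I \<and> g \<in> carrier G"
    by blast
  have \<eta>_inj: "y = y'" if y: "y \<in> ?B" and y': "y' \<in> ?B" and eq: "\<eta> y = \<eta> y'" for y y'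
  proof -
    obtain i g where 1: "\<eta> y = edge i g" "y = b i g" "i \<in> I" "g \<in> carrier G" using \<eta>(2)[OF y] by blast
    obtain i' g' where 2: "\<eta> y' = edge i' g'" "y' = b i' g'" "i' \<in> I" "g' \<in> carrier G" using \<eta>(2)[OF y'] by blast
    have e: "edge i g = edge i' g'" using 1 2 eq by simp
    then have "i = i'" by (simp add: edge_def)
    moreover have "g \<in> snd (edge i' g')" using edge_mem[OF 1(3,4)] e by simp
    then obtain q where "q \<in> Q i'" "g = g' \<otimes>\<^bsub>G\<^esub> \<theta> q" by (auto simp: edge_def)
    ultimately show ?thesis using 1 2 b_\<theta> by simp
  qed
  have word: "word_eval hnn w \<in> ?N \<and>
      ?A (word_eval hnn w) = word_eval ?F (map (\<lambda>(c, e). (c, free_gen e)) (map (\<lambda>(c, y). (c, \<eta> y)) w))"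
    if "set (map snd w) \<subseteq> ?B" for w
    using that
  proof (induction w)
    case Nil
    then show ?case by (simp add: word_eval_def A_one subgroup.one_closed[OF \<pi>.subgroup_kernel])
  next
    case (Cons x w)
    obtain c y where x: "x = (c, y)" by (cases x)
    have y: "y \<in> ?B" "y \<in> ?N" using Cons.prems B_N by (auto simp: x)
    have yc: "y \<in> carrier hnn" using y(1) B_closed by blast
    have w: "word_eval hnn w \<in> ?N" "word_eval hnn w \<in> carrier hnn" using Cons by (auto simp: kernel_def)
    have invN: "inv\<^bsub>hnn\<^esub> y \<in> ?N" by (rule subgroup.m_inv_closed[OF \<pi>.subgroup_kernel y(2)])
    have "?A (inv\<^bsub>hnn\<^esub> y) = inv\<^bsub>?F\<^esub> (?A y)"
    proof (rule F.inv_equality[symmetric])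
      show "?A (inv\<^bsub>hnn\<^esub> y) \<otimes>\<^bsub>?F\<^esub> ?A y = \<one>\<^bsub>?F\<^esub>"
        using A_mult[OF invN yc] yc by (simp add: A_one)
    qed (use A(1) yc in auto)
    then have l: "?A (if c then y else inv\<^bsub>hnn\<^esub> y) = (if c then free_gen (\<eta> y) else inv\<^bsub>?F\<^esub> (free_gen (\<eta> y)))"
      using \<eta>(1)[OF y(1)] by simp
    have lN: "(if c then y else inv\<^bsub>hnn\<^esub> y) \<in> ?N" using y(2) invN by simp
    have "word_eval hnn (x # w) = (if c then y else inv\<^bsub>hnn\<^esub> y) \<otimes>\<^bsub>hnn\<^esub> word_eval hnn w"
      by (simp add: x word_eval_Cons)
    then show ?case
      using A_mult[OF lN w(2)] l subgroup.m_closed[OF \<pi>.subgroup_kernel lN w(1)] Cons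
      by (simp add: x word_eval_Cons)
  qed
  have free: "word_eval hnn w \<noteq> \<one>\<^bsub>hnn\<^esub>" if "w \<noteq> []" "set (map snd w) \<subseteq> ?B" "reduced_word w" for w
  proof
    assume "word_eval hnn w = \<one>\<^bsub>hnn\<^esub>"
    let ?w = "map (\<lambda>(c, y). (c, \<eta> y)) w"
    have "reduced_word ?w"
      unfolding reduced_word_def
    proof (intro allI impI notI)
      fix k assume k: "Suc k < length ?w" and h: "snd (?w ! k) = snd (?w ! Suc k) \<and> fst (?w ! k) \<noteq> fst (?w ! Suc k)"
      have m: "snd (w ! k) \<in> ?B" "snd (w ! Suc k) \<in> ?B"
        using k that(2) nth_mem[of k w] nth_mem[of "Suc k" w] by (auto simp del: nth_mem)
      have "\<eta> (snd (w ! k)) = \<eta> (snd (w ! Suc k))" "fst (w ! k) \<noteq> fst (w ! Suc k)"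
        using k h by (auto simp: split_beta)
      then show False
        using \<eta>_inj[OF m] that(3) k by (auto simp: reduced_word_def)
    qed
    then have "word_eval ?F (map (\<lambda>(c, e). (c, free_gen e)) ?w) \<noteq> \<one>\<^bsub>?F\<^esub>"
      by (rule free_gen_reduced) (use that in simp)
    then show False using word[OF that(2)] \<open>word_eval hnn w = \<one>\<^bsub>hnn\<^esub>\<close> A_one by metis
  qed
  have surj: "\<pi> ` carrier hnn = carrier G"
    using \<pi>_n n_closed by (auto intro!: image_eqI[of _ \<pi> "n _"])
  have "card (rcosets\<^bsub>hnn\<^esub> ?N) = card (carrier G)" "finite (carrier G) \<Longrightarrow> finite (rcosets\<^bsub>hnn\<^esub> ?N)"
  proof -
    have "(\<lambda>N. the_elem (\<pi> ` N)) \<in> iso (hnn Mod ?N) G" by (rule \<pi>.FactGroup_iso_set[OF surj])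
    then have bij: "bij_betw (\<lambda>N. the_elem (\<pi> ` N)) (rcosets\<^bsub>hnn\<^esub> ?N) (carrier G)"
      by (simp add: iso_def FactGroup_def)
    from bij_betw_same_card[OF bij] show "card (rcosets\<^bsub>hnn\<^esub> ?N) = card (carrier G)" .
    show "finite (rcosets\<^bsub>hnn\<^esub> ?N)" if "finite (carrier G)" using bij_betw_finite[OF bij] that by simp
  qed
  moreover have "free_subgroup hnn ?N"
    unfolding free_subgroup_def
    by (intro conjI exI[of _ ?B] \<pi>.subgroup_kernel B_N gen allI impI) (use free in blast)
  ultimately show thesis using that[OF \<pi>.normal_kernel] by blast
qed

end

section \<open>Regular representation and stable elements\<close>

text \<open>Functions in \<open>Bij S\<close> are undefined outside S, whereas permutations of S fix
  every point there; restriction matches the two.\<close>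

lemma card_Bij: "finite S \<Longrightarrow> card (Bij S) = fact (card S)"
proof -
  assume S: "finite S"
  have "bij_betw (\<lambda>f. restrict f S) {f. f permutes S} (Bij S)"
  proof (rule bij_betw_byWitness[where f' = "\<lambda>f x. if x \<in> S then f x else x"])
    show "\<forall>f\<in>{f. f permutes S}. (\<lambda>x. if x \<in> S then restrict f S x else x) = f"
      by (auto simp: fun_eq_iff permutes_not_in)
    show "\<forall>f\<in>Bij S. restrict (\<lambda>x. if x \<in> S then f x else x) S = f"
      by (auto simp: fun_eq_iff Bij_def extensional_def)
    show "(\<lambda>f. restrict f S) ` {f. f permutes S} \<subseteq> Bij S"
      by (auto simp: Bij_def permutes_imp_bij)
    show "(\<lambda>f x. if x \<in> S then f x else x) ` Bij S \<subseteq> {f. f permutes S}"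
    proof (intro subsetI CollectI, elim imageE)
      fix g f assume "f \<in> Bij S" and g: "g = (\<lambda>x. if x \<in> S then f x else x)"
      then have "bij_betw f S S" by (simp add: Bij_def)
      then have "bij_betw g S S" using bij_betw_cong[of S g f S] g by simp
      then show "g permutes S" by (rule bij_imp_permutes) (simp add: g)
    qed
  qed
  then show ?thesis using bij_betw_same_card card_permutations[OF refl S] by metis
qed

lemma finite_Bij: "finite S \<Longrightarrow> finite (Bij S)"
  using card_Bij[of S] card_ge_0_finite[of "Bij S"] by (simp add: fact_gt_zero)

lemma cohom_truncate:
  assumes "cohom m G F f" and "\<And>xs. length xs > N \<Longrightarrow> f xs = 0"
  shows "cohom m G (\<lambda>xs. if length xs > N then 0 else F xs) f" (is "cohom m G ?F f")
  unfolding cohom_iff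
proof
  fix n
  show "cohomologous G m n ?F f"
  proof (cases "n > N")
    case True
    then have "cohomologous G m n ?F f \<longleftrightarrow> cohomologous G m n f f"
      by (intro cohomologous_degree_cong) (simp_all add: assms)
    then show ?thesis by simp
  next
    case False
    then have "cohomologous G m n ?F f \<longleftrightarrow> cohomologous G m n F f"
      by (intro cohomologous_degree_cong) simp_all
    then show ?thesis using assms by (simp add: cohom_iff)
  qed
qed

section \<open>Left translations and free actions\<close>

context group
begin

definition ltrans :: "'a \<Rightarrow> 'a \<Rightarrow> 'a" where
  "ltrans a = (\<lambda>x\<in>carrier G. a \<otimes> x)"

lemma ltrans_Bij: "a \<in> carrier G \<Longrightarrow> ltrans a \<in> Bij (carrier G)"
proof -
  assume a: "a \<in> carrier G"
  have "bij_betw (\<lambda>x. a \<otimes> x) (carrier G) (carrier G)"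
    by (rule bij_betw_byWitness[where f' = "\<lambda>x. inv a \<otimes> x"]) (use a in \<open>auto simp flip: m_assoc\<close>)
  then show ?thesis by (simp add: Bij_def ltrans_def)
qed

lemma ltrans_hom: "ltrans \<in> hom G (BijGroup (carrier G))"
proof (rule homI)
  fix a b assume ab: "a \<in> carrier G" "b \<in> carrier G"
  then show "ltrans (a \<otimes> b) = ltrans a \<otimes>\<^bsub>BijGroup (carrier G)\<^esub> ltrans b"
    by (auto simp: BijGroup_def ltrans_Bij compose_def ltrans_def[of "a \<otimes> b"] fun_eq_iff restrict_def)
      (auto simp: ltrans_def m_assoc)
qed (simp add: BijGroup_def ltrans_Bij)

lemma ltrans_inj: "inj_on ltrans (carrier G)"
proof (rule inj_onI)
  fix a b assume "a \<in> carrier G" "b \<in> carrier G" "ltrans a = ltrans b"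
  then have "ltrans a \<one> = ltrans b \<one>" by simp
  then show "a = b" using \<open>a \<in> carrier G\<close> \<open>b \<in> carrier G\<close> by (simp add: ltrans_def)
qed

text \<open>A free K-set is the product of K with the transversal on which the retraction is trivial.\<close>

lemma bij_betw_transversal:
  assumes K: "group K" and \<alpha>: "\<alpha> \<in> hom K G"
    and \<sigma>: "\<And>x. x \<in> carrier G \<Longrightarrow> \<sigma> x \<in> carrier K"
      "\<And>k x. k \<in> carrier K \<Longrightarrow> x \<in> carrier G \<Longrightarrow> \<sigma> (\<alpha> k \<otimes> x) = k \<otimes>\<^bsub>K\<^esub> \<sigma> x"
  shows "bij_betw (\<lambda>x. (\<sigma> x, inv (\<alpha> (\<sigma> x)) \<otimes> x)) (carrier G) (carrier K \<times> {y \<in> carrier G. \<sigma> y = \<one>\<^bsub>K\<^esub>})"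
proof -
  interpret K: group K by fact
  interpret \<alpha>: group_hom K G \<alpha> by unfold_locales (rule \<alpha>)
  show ?thesis
  proof (rule bij_betw_byWitness[where f' = "\<lambda>(k, y). \<alpha> k \<otimes> y"])
    show "\<forall>x\<in>carrier G. (case (\<sigma> x, inv (\<alpha> (\<sigma> x)) \<otimes> x) of (k, y) \<Rightarrow> \<alpha> k \<otimes> y) = x"
      using \<sigma>(1) by (simp flip: m_assoc)
    show "\<forall>z\<in>carrier K \<times> {y \<in> carrier G. \<sigma> y = \<one>\<^bsub>K\<^esub>}.
        (\<sigma> (case z of (k, y) \<Rightarrow> \<alpha> k \<otimes> y), inv (\<alpha> (\<sigma> (case z of (k, y) \<Rightarrow> \<alpha> k \<otimes> y))) \<otimes> (case z of (k, y) \<Rightarrow> \<alpha> k \<otimes> y)) = z"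
      using \<sigma> by (auto simp flip: m_assoc)
    show "(\<lambda>x. (\<sigma> x, inv (\<alpha> (\<sigma> x)) \<otimes> x)) ` carrier G \<subseteq> carrier K \<times> {y \<in> carrier G. \<sigma> y = \<one>\<^bsub>K\<^esub>}"
    proof (intro subsetI, elim imageE)
      fix z x assume x: "x \<in> carrier G" and z: "z = (\<sigma> x, inv (\<alpha> (\<sigma> x)) \<otimes> x)"
      have "\<sigma> (inv (\<alpha> (\<sigma> x)) \<otimes> x) = \<one>\<^bsub>K\<^esub>"
        using \<sigma>(1)[OF x] \<sigma>(2)[of "inv\<^bsub>K\<^esub> (\<sigma> x)" x] x by simp
      then show "z \<in> carrier K \<times> {y \<in> carrier G. \<sigma> y = \<one>\<^bsub>K\<^esub>}" using \<sigma>(1)[OF x] x z by simp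
    qed
  qed auto
qed

text \<open>By injectivity of \<phi> both actions of Q are free, and in a finite group they then
  have equally many orbits, namely the index of Q. A bijection between transversals extends to an
  equivariant bijection.\<close>

lemma intertwiner:
  assumes fin: "finite (carrier G)" and Q: "subgroup Q G"
    and \<phi>: "\<phi> \<in> hom (G\<lparr>carrier := Q\<rparr>) G" and inj: "inj_on \<phi> Q"
  obtains \<tau> where "\<tau> \<in> Bij (carrier G)" "\<And>q x. q \<in> Q \<Longrightarrow> x \<in> carrier G \<Longrightarrow> \<tau> (\<phi> q \<otimes> x) = q \<otimes> \<tau> x"
proof -
  let ?K = "G\<lparr>carrier := Q\<rparr>"
  interpret Q: subgroup Q G by fact
  have K: "group ?K" by (rule Q.subgroup_is_group[OF is_group])
  have id: "(\<lambda>x. x) \<in> hom ?K G" by (auto simp: hom_def)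
  have inj': "inj_on \<phi> (carrier ?K)" "inj_on (\<lambda>x. x) (carrier ?K)" using inj by auto
  obtain \<sigma>\<^sub>1 where \<sigma>\<^sub>1: "\<And>x. x \<in> carrier G \<Longrightarrow> \<sigma>\<^sub>1 x \<in> carrier ?K"
    "\<And>k x. k \<in> carrier ?K \<Longrightarrow> x \<in> carrier G \<Longrightarrow> \<sigma>\<^sub>1 (\<phi> k \<otimes> x) = k \<otimes>\<^bsub>?K\<^esub> \<sigma>\<^sub>1 x" "\<sigma>\<^sub>1 \<one> = \<one>\<^bsub>?K\<^esub>"
    using coset_retraction[OF is_group K \<phi> inj'(1)] by blast
  obtain \<sigma>\<^sub>2 where \<sigma>\<^sub>2: "\<And>x. x \<in> carrier G \<Longrightarrow> \<sigma>\<^sub>2 x \<in> carrier ?K"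
    "\<And>k x. k \<in> carrier ?K \<Longrightarrow> x \<in> carrier G \<Longrightarrow> \<sigma>\<^sub>2 (k \<otimes> x) = k \<otimes>\<^bsub>?K\<^esub> \<sigma>\<^sub>2 x" "\<sigma>\<^sub>2 \<one> = \<one>\<^bsub>?K\<^esub>"
    using coset_retraction[OF is_group K id inj'(2)] by blast
  let ?T\<^sub>1 = "{y \<in> carrier G. \<sigma>\<^sub>1 y = \<one>\<^bsub>?K\<^esub>}" and ?T\<^sub>2 = "{y \<in> carrier G. \<sigma>\<^sub>2 y = \<one>\<^bsub>?K\<^esub>}"
  let ?e\<^sub>1 = "\<lambda>x. (\<sigma>\<^sub>1 x, inv (\<phi> (\<sigma>\<^sub>1 x)) \<otimes> x)" and ?e\<^sub>2 = "\<lambda>x. (\<sigma>\<^sub>2 x, inv (\<sigma>\<^sub>2 x) \<otimes> x)"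
  have e\<^sub>1: "bij_betw ?e\<^sub>1 (carrier G) (carrier ?K \<times> ?T\<^sub>1)" by (rule bij_betw_transversal[OF K \<phi> \<sigma>\<^sub>1(1,2)])
  have e\<^sub>2: "bij_betw ?e\<^sub>2 (carrier G) (carrier ?K \<times> ?T\<^sub>2)" by (rule bij_betw_transversal[OF K id \<sigma>\<^sub>2(1,2)])
  have "card (carrier ?K) * card ?T\<^sub>1 = card (carrier ?K) * card ?T\<^sub>2"
    using bij_betw_same_card[OF e\<^sub>1] bij_betw_same_card[OF e\<^sub>2] by (simp only: card_cartesian_product)
  moreover have "card (carrier ?K) \<noteq> 0"
    using finite_subset[OF Q.subset fin] Q.one_closed by (auto simp del: Q.one_closed)
  ultimately have "card ?T\<^sub>1 = card ?T\<^sub>2" by simp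
  then obtain \<beta> where \<beta>: "bij_betw \<beta> ?T\<^sub>1 ?T\<^sub>2"
    using finite_same_card_bij[of ?T\<^sub>1 ?T\<^sub>2] fin by auto
  have \<beta>_closed: "\<beta> y \<in> carrier G" "\<sigma>\<^sub>2 (\<beta> y) = \<one>" if "y \<in> ?T\<^sub>1" for y
    using bij_betwE[OF \<beta>] that by auto
  \<comment> \<open>In the coordinates given by the two transversals this keeps the element of Q and
    applies \<beta> to the point of the transversal.\<close>
  let ?\<tau> = "\<lambda>x. \<sigma>\<^sub>1 x \<otimes> \<beta> (inv (\<phi> (\<sigma>\<^sub>1 x)) \<otimes> x)"
  have mem: "inv (\<phi> (\<sigma>\<^sub>1 x)) \<otimes> x \<in> ?T\<^sub>1" "\<sigma>\<^sub>1 x \<in> Q" if "x \<in> carrier G" for x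
    using bij_betwE[OF e\<^sub>1] that by auto
  have bij: "bij_betw (\<lambda>z. (fst z, \<beta> (snd z))) (carrier ?K \<times> ?T\<^sub>1) (carrier ?K \<times> ?T\<^sub>2)"
    using bij_betw_map_prod[OF bij_betw_id[of "carrier ?K"] \<beta>] by (simp add: map_prod_def case_prod_unfold)
  have "bij_betw (inv_into (carrier G) ?e\<^sub>2 \<circ> ((\<lambda>z. (fst z, \<beta> (snd z))) \<circ> ?e\<^sub>1)) (carrier G) (carrier G)"
    by (rule bij_betw_trans[OF bij_betw_trans[OF e\<^sub>1 bij] bij_betw_inv_into[OF e\<^sub>2]])
  moreover have "(inv_into (carrier G) ?e\<^sub>2 \<circ> ((\<lambda>z. (fst z, \<beta> (snd z))) \<circ> ?e\<^sub>1)) x = ?\<tau> x" if x: "x \<in> carrier G" for x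
  proof -
    note b = \<beta>_closed[OF mem(1)[OF x]]
    have q: "\<sigma>\<^sub>1 x \<in> carrier G" using mem(2)[OF x] by auto
    have "\<sigma>\<^sub>2 (?\<tau> x) = \<sigma>\<^sub>1 x" using \<sigma>\<^sub>2(2)[of "\<sigma>\<^sub>1 x"] mem(2)[OF x] b q by simp
    then have e: "?e\<^sub>2 (?\<tau> x) = (\<sigma>\<^sub>1 x, \<beta> (inv (\<phi> (\<sigma>\<^sub>1 x)) \<otimes> x))" using b q by (simp flip: m_assoc)
    have "inv_into (carrier G) ?e\<^sub>2 (?e\<^sub>2 (?\<tau> x)) = ?\<tau> x"
      by (rule inv_into_f_f) (use e\<^sub>2 b q in \<open>auto simp: bij_betw_def\<close>)
    then show ?thesis unfolding e by simp
  qed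
  ultimately have "bij_betw ?\<tau> (carrier G) (carrier G)"
    using bij_betw_cong[of "carrier G" _ ?\<tau> "carrier G"] by blast
  then have 1: "restrict ?\<tau> (carrier G) \<in> Bij (carrier G)" by (simp add: Bij_def)
  show thesis
  proof (rule that[OF 1])
    fix q x assume q: "q \<in> Q" and x: "x \<in> carrier G"
    interpret \<phi>: group_hom ?K G \<phi>
      using K \<phi> by (simp add: group_hom_def group_hom_axioms_def is_group)
    have \<phi>q: "\<phi> q \<in> carrier G" "\<phi> (\<sigma>\<^sub>1 x) \<in> carrier G" using \<phi>.hom_closed q mem(2)[OF x] by auto
    have s: "\<sigma>\<^sub>1 (\<phi> q \<otimes> x) = q \<otimes> \<sigma>\<^sub>1 x" using \<sigma>\<^sub>1(2)[of q x] q x by simp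
    have "\<phi> (q \<otimes> \<sigma>\<^sub>1 x) = \<phi> q \<otimes> \<phi> (\<sigma>\<^sub>1 x)" using \<phi>.hom_mult[of q "\<sigma>\<^sub>1 x"] q mem(2)[OF x] by simp
    then have "inv (\<phi> (q \<otimes> \<sigma>\<^sub>1 x)) \<otimes> (\<phi> q \<otimes> x) = inv (\<phi> (\<sigma>\<^sub>1 x)) \<otimes> (inv (\<phi> q) \<otimes> \<phi> q) \<otimes> x"
      using \<phi>q x by (simp only: inv_mult_group m_assoc inv_closed m_closed)
    then have "inv (\<phi> (q \<otimes> \<sigma>\<^sub>1 x)) \<otimes> (\<phi> q \<otimes> x) = inv (\<phi> (\<sigma>\<^sub>1 x)) \<otimes> x" using \<phi>q x by simp
    then show "restrict ?\<tau> (carrier G) (\<phi> q \<otimes> x) = q \<otimes> restrict ?\<tau> (carrier G) x"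
      using \<phi>q x q mem(2)[OF x] \<beta>_closed(1)[OF mem(1)[OF x]] by (simp add: s m_assoc)
  qed
qed

end

text \<open>Restricting a class to Q keeps the representing function and only shrinks its domain, so
  stability compares f with its pullback in the cohomology of Q.\<close>

lemma stable_iff:
  fixes P :: "('a, 'b) monoid_scheme"
  assumes P: "group P" and C: "subcat_Cu P Obj Mor" and f: "cocyc m P f" and H: "coh_cls m P f \<in> Htot P m"
  shows "coh_cls m P f \<in> stable_elements P m Obj Mor \<longleftrightarrow>
    (\<forall>Q Q' \<phi>. \<phi> \<in> Mor Q Q' \<longrightarrow> cohom m (P\<lparr>carrier := Q\<rparr>) (\<lambda>l. f (map \<phi> l)) f)"
proof -
  have id: "id \<in> hom (P\<lparr>carrier := Q\<rparr>) P" if "Q \<in> Obj" for Q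
  proof -
    have "subgroup Q P" using C that by (simp add: subcat_Cu_def)
    then show ?thesis using subgroup.subset by (fastforce simp: hom_def)
  qed
  have fQ: "cocyc m (P\<lparr>carrier := Q\<rparr>) f" if "Q \<in> Obj" for Q
    using cocyc_hom[OF id[OF that] f] by simp
  have restr: "restr P m Q (coh_cls m P f) = coh_cls m (P\<lparr>carrier := Q\<rparr>) f" if "Q \<in> Obj" for Q
    unfolding restr_def using pullback_of_coh_cls[OF id[OF that] f] by simp
  have "pullback (P\<lparr>carrier := Q\<rparr>) m \<phi> (restr P m Q' (coh_cls m P f)) = restr P m Q (coh_cls m P f) \<longleftrightarrow>
      cohom m (P\<lparr>carrier := Q\<rparr>) (\<lambda>l. f (map \<phi> l)) f" if "\<phi> \<in> Mor Q Q'" for Q Q' \<phi>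
  proof -
    have Q: "Q \<in> Obj" "Q' \<in> Obj" "\<phi> \<in> hom (P\<lparr>carrier := Q\<rparr>) (P\<lparr>carrier := Q'\<rparr>)"
      using C that unfolding subcat_Cu_def by blast+
    have "pullback (P\<lparr>carrier := Q\<rparr>) m \<phi> (restr P m Q' (coh_cls m P f)) = coh_cls m (P\<lparr>carrier := Q\<rparr>) (\<lambda>l. f (map \<phi> l))"
      unfolding restr[OF Q(2)] by (rule pullback_of_coh_cls[OF Q(3) fQ[OF Q(2)]])
    then show ?thesis unfolding restr[OF Q(1)] by (simp add: coh_cls_eq_iff fQ[OF Q(1)])
  qed
  then show ?thesis using H by (auto simp: stable_elements_def)
qed

theorem theorem1:
  fixes P :: "('a, 'b) monoid_scheme" and p :: nat
    and Obj :: "'a set set" and Mor :: "'a set \<Rightarrow> 'a set \<Rightarrow> ('a \<Rightarrow> 'a) set"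
  assumes "Factorial_Ring.prime p"
    and "group P" and "finite (carrier P)" and "\<exists>k. order P = p ^ k"
    and "subcat_Cu P Obj Mor"
    and "carrier P \<in> Obj"
    and "\<forall>Q\<in>Obj. (\<lambda>x\<in>Q. x) \<in> Mor Q (carrier P)"
  shows "\<exists>(\<Gamma> :: nat monoid) \<iota>. group \<Gamma> \<and> \<iota> \<in> hom P \<Gamma> \<and> inj_on \<iota> (carrier P)
     \<and> pullback P (int p) \<iota> ` Htot \<Gamma> (int p) = stable_elements P (int p) Obj Mor
     \<and> (\<forall>x\<in>Htot \<Gamma> (int p). \<forall>y\<in>Htot \<Gamma> (int p).
          pullback P (int p) \<iota> x = coh_zero P (int p) \<longrightarrow> pullback P (int p) \<iota> y = coh_zero P (int p)
          \<longrightarrow> coh_mult \<Gamma> (int p) x y = coh_zero \<Gamma> (int p))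
     \<and> (\<forall>x\<in>Htot \<Gamma> (int p).
          coh_nilpotent P (int p) (pullback P (int p) \<iota> x) \<longleftrightarrow> coh_nilpotent \<Gamma> (int p) x)
     \<and> (\<exists>N. N \<lhd> \<Gamma> \<and> free_subgroup \<Gamma> N \<and> finite (rcosets\<^bsub>\<Gamma>\<^esub> N)
          \<and> card (rcosets\<^bsub>\<Gamma>\<^esub> N) dvd fact (card (carrier P)))"
proof -
  interpret P: group P by fact
  note fin = assms(3) and C = assms(5)
  let ?m = "int p"
  let ?S = "carrier P"
  \<comment> \<open>Targets of morphisms are enlarged to P. Extensionality leaves only finitely many
    triples, and the alternative of the trivial subgroup, where the condition on \<tau> holds for
    every permutation, supplies a letter over each element of Sym(P).\<close>
  define I where "I = {(Q, \<phi>, \<tau>). subgroup Q P \<and> \<phi> \<in> hom (P\<lparr>carrier := Q\<rparr>) P \<and> \<phi> \<in> extensional Q \<and>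
    \<tau> \<in> Bij ?S \<and> (\<forall>q\<in>Q. \<forall>x\<in>?S. \<tau> (\<phi> q \<otimes>\<^bsub>P\<^esub> x) = q \<otimes>\<^bsub>P\<^esub> \<tau> x) \<and> (\<phi> \<in> Mor Q ?S \<or> Q = {\<one>\<^bsub>P\<^esub>})}"
  define dom where "dom i = fst i" for i :: "'a set \<times> ('a \<Rightarrow> 'a) \<times> ('a \<Rightarrow> 'a)"
  define mor where "mor i = fst (snd i)" for i :: "'a set \<times> ('a \<Rightarrow> 'a) \<times> ('a \<Rightarrow> 'a)"
  define perm where "perm i = snd (snd i)" for i :: "'a set \<times> ('a \<Rightarrow> 'a) \<times> ('a \<Rightarrow> 'a)"
  define j where "j g = ({\<one>\<^bsub>P\<^esub>}, (\<lambda>x\<in>{\<one>\<^bsub>P\<^esub>}. \<one>\<^bsub>P\<^esub>), g)" for g :: "'a \<Rightarrow> 'a"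
  note defs = dom_def mor_def perm_def
  have I: "subgroup (dom i) P" "mor i \<in> hom (P\<lparr>carrier := dom i\<rparr>) P" "perm i \<in> Bij ?S"
    "\<And>q x. q \<in> dom i \<Longrightarrow> x \<in> ?S \<Longrightarrow> perm i (mor i q \<otimes>\<^bsub>P\<^esub> x) = q \<otimes>\<^bsub>P\<^esub> perm i x"
    "mor i \<in> Mor (dom i) ?S \<or> dom i = {\<one>\<^bsub>P\<^esub>}" if "i \<in> I" for i
    using that by (auto simp: I_def defs)
  have "I \<subseteq> (SIGMA Q:Pow ?S. (Q \<rightarrow>\<^sub>E ?S) \<times> Bij ?S)"
    by (auto simp: I_def hom_def PiE_def Pi_def extensional_def dest: subgroup.subset)
  then have finI: "finite I"
    by (rule finite_subset) (use fin in \<open>auto intro!: finite_SigmaI finite_cartesian_product finite_PiE finite_Bij dest: finite_subset\<close>)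
  have perm_conj: "P.ltrans q \<otimes>\<^bsub>BijGroup ?S\<^esub> perm i = perm i \<otimes>\<^bsub>BijGroup ?S\<^esub> P.ltrans (mor i q)"
    if i: "i \<in> I" and q: "q \<in> dom i" for i q
  proof
    fix x
    have c: "q \<in> ?S" "mor i q \<in> ?S" using I(1,2)[OF i] q subgroup.subset by (auto simp: hom_def)
    show "(P.ltrans q \<otimes>\<^bsub>BijGroup ?S\<^esub> perm i) x = (perm i \<otimes>\<^bsub>BijGroup ?S\<^esub> P.ltrans (mor i q)) x"
      using I(3)[OF i] I(4)[OF i q, of x] c P.ltrans_Bij[OF c(1)] P.ltrans_Bij[OF c(2)] Bij_imp_funcset[OF I(3)[OF i]]
      by (auto simp: BijGroup_def compose_def P.ltrans_def restrict_def)
  qed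
  interpret H: finite_quotient P I dom mor "BijGroup ?S" P.ltrans perm j
  proof (intro finite_quotient.intro presentation.intro presentation_axioms.intro finite_quotient_axioms.intro)
    show "group P" by fact
    show "group (BijGroup ?S)" by (rule group_BijGroup)
    show "P.ltrans \<in> hom P (BijGroup ?S)" by (rule P.ltrans_hom)
    show "inj_on P.ltrans ?S" by (rule P.ltrans_inj)
    show "countable ?S" "countable I" using fin finI by (auto intro: countable_finite)
    fix i assume i: "i \<in> I"
    show "subgroup (dom i) P" "mor i \<in> hom (P\<lparr>carrier := dom i\<rparr>) P" by (rule I[OF i])+
    show "perm i \<in> carrier (BijGroup ?S)" using I(3)[OF i] by (simp add: BijGroup_def)
  next
    fix i q assume "i \<in> I" "q \<in> dom i"
    then show "P.ltrans q \<otimes>\<^bsub>BijGroup ?S\<^esub> perm i = perm i \<otimes>\<^bsub>BijGroup ?S\<^esub> P.ltrans (mor i q)" by (rule perm_conj)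
  next
    fix g assume "g \<in> carrier (BijGroup ?S)"
    then have "g \<in> Bij ?S" by (simp add: BijGroup_def)
    then show "j g \<in> I"
      using P.triv_subgroup funcset_mem[OF Bij_imp_funcset[of g ?S]] by (auto simp: j_def I_def hom_def)
    show "dom (j g) = {\<one>\<^bsub>P\<^esub>}" "perm (j g) = g" by (simp_all add: j_def defs)
  qed
  interpret S: stable_letters H.hnn P H.emb I dom mor H.st
  proof (intro stable_letters.intro stable_letters_axioms.intro)
    show "group P" "group H.hnn" by (rule P.is_group H.group_hnn)+
    show "H.emb \<in> hom P H.hnn" by (rule H.emb_hom)
    show "inj_on H.emb ?S" by (rule H.emb_inj)
    show "subgroup (dom i) P" "mor i \<in> hom (P\<lparr>carrier := dom i\<rparr>) P" if "i \<in> I" for i by (rule I[OF that])+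
    show "H.st i \<in> carrier H.hnn" if "i \<in> I" for i by (rule H.st_closed[OF that])
    show "H.emb q \<otimes>\<^bsub>H.hnn\<^esub> H.st i = H.st i \<otimes>\<^bsub>H.hnn\<^esub> H.emb (mor i q)" if "i \<in> I" "q \<in> dom i" for i q
      by (rule H.st_conj[OF that])
  qed (fact H.hnn_induct, fact H.lift_int)
  note emb = H.emb_hom
  have stable: "cohom ?m (P\<lparr>carrier := dom i\<rparr>) (\<lambda>l. f (map (mor i) l)) f"
    if i: "i \<in> I" and f: "\<And>Q Q' \<phi>. \<phi> \<in> Mor Q Q' \<Longrightarrow> cohom ?m (P\<lparr>carrier := Q\<rparr>) (\<lambda>l. f (map \<phi> l)) f" for i f
    using I(5)[OF i]
  proof
    \<comment> \<open>The auxiliary letters impose no condition on f, because a homomorphism on the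
      trivial subgroup is the inclusion.\<close>
    assume one: "dom i = {\<one>\<^bsub>P\<^esub>}"
    have K: "group (P\<lparr>carrier := dom i\<rparr>)" by (rule subgroup.subgroup_is_group[OF I(1)[OF i] P.is_group])
    have "mor i \<one>\<^bsub>P\<^esub> = \<one>\<^bsub>P\<^esub>" using hom_one[OF I(2)[OF i] K P.is_group] by simp
    then have "map (mor i) xs = xs" if "set xs \<subseteq> dom i" for xs
      using that one by (induction xs) auto
    then show ?thesis by (intro cohom_cong) simp
  qed (rule f)
  have Mor_P: "\<exists>\<tau>. (Q, \<phi>, \<tau>) \<in> I" if "\<phi> \<in> Mor Q Q'" for Q Q' \<phi>
  proof -
    have M: "Q \<in> Obj" "Q' \<in> Obj" "\<phi> \<in> hom (P\<lparr>carrier := Q\<rparr>) (P\<lparr>carrier := Q'\<rparr>)" "inj_on \<phi> Q" "\<phi> \<in> extensional Q"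
      using C that unfolding subcat_Cu_def by blast+
    have sub: "subgroup Q P" "subgroup Q' P" using C M unfolding subcat_Cu_def by blast+
    have Q': "\<phi> x \<in> Q'" if "x \<in> Q" for x using M(3) that by (auto simp: hom_def)
    \<comment> \<open>Composition with the inclusion of Q' does not change the extensional function,
      so \<phi> itself is a morphism into P and belongs to a letter.\<close>
    have "(\<lambda>x\<in>Q. (\<lambda>x\<in>Q'. x) (\<phi> x)) \<in> Mor Q ?S"
      using C that assms(7) M(2) unfolding subcat_Cu_def by blast
    also have "(\<lambda>x\<in>Q. (\<lambda>x\<in>Q'. x) (\<phi> x)) = \<phi>"
      using M(5) Q' by (auto simp: fun_eq_iff extensional_def)
    finally have 1: "\<phi> \<in> Mor Q ?S" .
    have hom: "\<phi> \<in> hom (P\<lparr>carrier := Q\<rparr>) P" using M(3) subgroup.subset[OF sub(2)] by (auto simp: hom_def)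
    obtain \<tau> where "\<tau> \<in> Bij ?S" "\<And>q x. q \<in> Q \<Longrightarrow> x \<in> ?S \<Longrightarrow> \<tau> (\<phi> q \<otimes>\<^bsub>P\<^esub> x) = q \<otimes>\<^bsub>P\<^esub> \<tau> x"
      using P.intertwiner[OF fin sub(1) hom M(4)] by blast
    then show ?thesis using 1 hom sub(1) M(5) by (auto simp: I_def)
  qed
  have image: "pullback P ?m H.emb ` Htot H.hnn ?m = stable_elements P ?m Obj Mor"
  proof (intro equalityI subsetI)
    fix c assume "c \<in> pullback P ?m H.emb ` Htot H.hnn ?m"
    then obtain x where x: "x \<in> Htot H.hnn ?m" "c = pullback P ?m H.emb x" by blast
    obtain F N where F: "cocyc ?m H.hnn F" "x = coh_cls ?m H.hnn F" "\<And>xs. length xs > N \<Longrightarrow> F xs = 0"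
      using Htot_bounded[OF x(1)] by blast
    have c: "c = coh_cls ?m P (\<lambda>l. F (map H.emb l))" unfolding x(2) F(2) by (rule pullback_of_coh_cls[OF emb F(1)])
    have cf: "cocyc ?m P (\<lambda>l. F (map H.emb l))" by (rule cocyc_hom[OF emb F(1)])
    have "coh_cls ?m P (\<lambda>l. F (map H.emb l)) \<in> Htot P ?m" by (rule coh_cls_in_Htot[OF cf, of N]) (simp add: F(3))
    moreover have "cohom ?m (P\<lparr>carrier := Q\<rparr>) (\<lambda>l. F (map H.emb (map \<phi> l))) (\<lambda>l. F (map H.emb l))"
      if "\<phi> \<in> Mor Q Q'" for Q Q' \<phi>
    proof -
      obtain \<tau> where i: "(Q, \<phi>, \<tau>) \<in> I" using Mor_P[OF \<open>\<phi> \<in> Mor Q Q'\<close>] by blast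
      note Ii = I[OF i, unfolded defs, simplified]
      have K: "group (P\<lparr>carrier := Q\<rparr>)" by (rule subgroup.subgroup_is_group[OF Ii(1) P.is_group])
      have \<alpha>: "H.emb \<in> hom (P\<lparr>carrier := Q\<rparr>) H.hnn"
        using subgroup.subset[OF Ii(1)] by (intro homI) (auto simp: hom_mult[OF emb] subset_iff)
      have \<beta>: "(\<lambda>x. H.emb (\<phi> x)) \<in> hom (P\<lparr>carrier := Q\<rparr>) H.hnn"
        using hom_compose[OF Ii(2) emb] by (simp add: comp_def)
      \<comment> \<open>In \<Gamma> the stable letter conjugates q into \<open>\<phi> q\<close>, and
        conjugation acts trivially on cohomology.\<close>
      have "cohom ?m (P\<lparr>carrier := Q\<rparr>) (\<lambda>l. F (map (\<lambda>x. H.emb (\<phi> x)) l)) (\<lambda>l. F (map H.emb l))"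
        by (rule cohom_conj[OF K H.group_hnn \<alpha> \<beta> H.st_closed[OF i] _ F(1)])
          (use H.st_conj[OF i] in \<open>simp add: defs(1,2)[of "(Q, \<phi>, \<tau>)"]\<close>)
      then show ?thesis by (simp add: comp_def)
    qed
    ultimately show "c \<in> stable_elements P ?m Obj Mor"
      unfolding c using stable_iff[OF \<open>group P\<close> C cf] by blast
  next
    fix c assume c: "c \<in> stable_elements P ?m Obj Mor"
    then have "c \<in> Htot P ?m" by (simp add: stable_elements_def)
    then obtain f N where f: "cocyc ?m P f" "c = coh_cls ?m P f" "\<And>xs. length xs > N \<Longrightarrow> f xs = 0"
      using Htot_bounded by blast
    have "cohom ?m (P\<lparr>carrier := Q\<rparr>) (\<lambda>l. f (map \<phi> l)) f" if "\<phi> \<in> Mor Q Q'" for Q Q' \<phi>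
      using c \<open>c \<in> Htot P ?m\<close> stable_iff[OF \<open>group P\<close> C f(1)] that unfolding f(2) by blast
    then have "cohom ?m (P\<lparr>carrier := dom i\<rparr>) (\<lambda>l. f (map (mor i) l)) f" if "i \<in> I" for i
      by (rule stable[OF that])
    then obtain F where F: "cocyc ?m H.hnn F" "cohom ?m P (\<lambda>l. F (map H.emb l)) f"
      using S.extend_cocycle[OF f(1)] by blast
    \<comment> \<open>The extension may be nonzero in arbitrarily high degrees. The cut-off puts its
      class into \<open>Htot\<close> and keeps the restriction, because f already vanishes above
      N.\<close>
    let ?F = "\<lambda>xs. if length xs > N then 0 else F xs"
    have F': "cocyc ?m H.hnn ?F" by (rule cocyc_truncate[OF F(1)])
    have "coh_cls ?m H.hnn ?F \<in> Htot H.hnn ?m" by (rule coh_cls_in_Htot[OF F', of N]) simp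
    moreover have "pullback P ?m H.emb (coh_cls ?m H.hnn ?F) = c"
      unfolding pullback_of_coh_cls[OF emb F'] f(2)
      using cohom_truncate[OF F(2) f(3)] by (intro coh_cls_cong) simp
    ultimately show "c \<in> pullback P ?m H.emb ` Htot H.hnn ?m" by blast
  qed
  have kernel: "coh_mult H.hnn ?m x y = coh_zero H.hnn ?m"
    if x: "x \<in> Htot H.hnn ?m" "pullback P ?m H.emb x = coh_zero P ?m"
      and y: "y \<in> Htot H.hnn ?m" "pullback P ?m H.emb y = coh_zero P ?m" for x y
  proof -
    have z: "cohom ?m P (\<lambda>l. coh_rep u (map H.emb l)) (\<lambda>_. 0)" if "pullback P ?m H.emb u = coh_zero P ?m" for u
      using that unfolding pullback_coh_cls coh_zero_coh_cls by (simp add: coh_cls_eq_iff)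
    note cx = Htot_coh_rep[OF x(1)] and cy = Htot_coh_rep[OF y(1)]
    have "cohom ?m H.hnn (cup (coh_rep x) (coh_rep y)) (\<lambda>_. 0)"
      by (rule S.cup_kernel[OF cx(1) cy(1) z[OF x(2)] z[OF y(2)]])
    then show ?thesis unfolding coh_mult_coh_cls coh_zero_coh_cls by (rule coh_cls_cong)
  qed
  \<comment> \<open>Restriction preserves and reflects nilpotence; since its image is the ring of
    stable elements, this gives the isomorphism modulo nilradicals.\<close>
  have nilpotent: "coh_nilpotent P ?m (pullback P ?m H.emb x) \<longleftrightarrow> coh_nilpotent H.hnn ?m x"
    if "x \<in> Htot H.hnn ?m" for x
  proof -
    define f where "f = coh_rep x"
    have f: "cocyc ?m H.hnn f" "x = coh_cls ?m H.hnn f" using Htot_coh_rep[OF that] by (simp_all add: f_def)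
    have P: "coh_nilpotent P ?m (pullback P ?m H.emb x) \<longleftrightarrow> (\<exists>k>0. cohom ?m P (\<lambda>l. cup_pow f k (map H.emb l)) (\<lambda>_. 0))"
      unfolding f(2) pullback_of_coh_cls[OF emb f(1)] P.coh_nilpotent_of_coh_cls[OF cocyc_hom[OF emb f(1)]]
      by (simp add: cup_pow_map)
    have \<Gamma>: "coh_nilpotent H.hnn ?m x \<longleftrightarrow> (\<exists>k>0. cohom ?m H.hnn (cup_pow f k) (\<lambda>_. 0))"
      unfolding f(2) by (rule H.hnn.coh_nilpotent_of_coh_cls[OF f(1)])
    show ?thesis
      unfolding P \<Gamma>
    proof
      assume "\<exists>k>0. cohom ?m P (\<lambda>l. cup_pow f k (map H.emb l)) (\<lambda>_. 0)"
      then obtain k where k: "k > 0" "cohom ?m P (\<lambda>l. cup_pow f k (map H.emb l)) (\<lambda>_. 0)" by blast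
      have "cocyc ?m H.hnn (cup_pow f k)" by (rule H.hnn.cocyc_cup_pow[OF f(1)])
      \<comment> \<open>The k-th power restricts to zero, hence lies in the kernel, and its square
        vanishes; this doubles the exponent.\<close>
      then have "cohom ?m H.hnn (cup_pow f (k + k)) (\<lambda>_. 0)"
        unfolding cup_pow_add using k(2) by (intro S.cup_kernel)
      then show "\<exists>k>0. cohom ?m H.hnn (cup_pow f k) (\<lambda>_. 0)" using k(1) by (intro exI[of _ "k + k"]) simp
    next
      assume "\<exists>k>0. cohom ?m H.hnn (cup_pow f k) (\<lambda>_. 0)"
      then show "\<exists>k>0. cohom ?m P (\<lambda>l. cup_pow f k (map H.emb l)) (\<lambda>_. 0)" using cohom_hom[OF emb] by blast
    qed
  qed
  obtain N where N: "N \<lhd> H.hnn" "free_subgroup H.hnn N" "card (rcosets\<^bsub>H.hnn\<^esub> N) = card (carrier (BijGroup ?S))"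
    "finite (carrier (BijGroup ?S)) \<Longrightarrow> finite (rcosets\<^bsub>H.hnn\<^esub> N)"
    using H.free_kernel by blast
  \<comment> \<open>The quotient by N is all of Sym(P), so the index equals the factorial.\<close>
  have "finite (rcosets\<^bsub>H.hnn\<^esub> N)" "card (rcosets\<^bsub>H.hnn\<^esub> N) dvd fact (card ?S)"
    using N(3,4) finite_Bij[OF fin] card_Bij[OF fin] by (simp_all add: BijGroup_def)
  then show ?thesis
    using H.group_hnn emb H.emb_inj image kernel nilpotent N(1,2)
    by (intro exI[of _ H.hnn] exI[of _ H.emb] conjI ballI impI) blast+
qed

end
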